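(* Let $\{Q_n, n\ge 1\}$ be the measure-valued Markov chain defined by the recursive identity $$Q_n = W_n\,\delta_{Z_n} + (1-W_n)\,Q_{n-1},\qquad n\ge 1,$$ where $\{W_n,n\ge1\}$ is a sequence of independent random variables with $W_1=1$ almost surely and $W_n$ having Beta distribution with parameter $(1,n-1)$ for $n\ge2$, and $\{Z_n,n\ge1\}$ is a sequence of exchangeable $\mathbb{X}$-valued random variables, independent of $\{W_n,n\ge1\}$. Then: (i) an equivalent representation of $Q_n$, $n=1,2,\ldots$, is $$Q_n=\sum_{i=1}^n q_i^{(n)}\delta_{Z_i},$$ where $\sum_{i=1}^n q_i^{(n)}=1$, the random vector $q^{(n)}=(q_1^{(n)},\ldots,q_n^{(n)})$ has Dirichlet distribution with parameter $(1,1,\ldots,1)$, and $\{q^{(n)},n\ge1\}$ and $\{Z_n,n\ge1\}$ are independent; (ii) there exists a random probability measure $Q$ on $(\Omega,\mathscr{F},\mathbb{P})$ such that, as $n\to+\infty$, $$Q_n\Rightarrow Q\qquad \text{a.s.-}\mathbb{P},$$ where the law of $Q$ is the de Finetti measure of the sequence $\{Z_n,n\ge1\}$.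
   Context: $\mathbb{X}$ is a Polish space with Borel $\sigma$-field $\mathscr{X}$, and $\mathcal{P}_{\mathbb{X}}$ is the space of probability measures on $\mathbb{X}$ with the $\sigma$-field generated by the topology of weak convergence. All random elements are defined on a probability space $(\Omega,\mathscr{F},\mathbb{P})$. A random probability measure on $\mathbb{X}$ is a random element of $\mathcal{P}_{\mathbb{X}}$. Since $W_1=1$ a.s., $Q_1=\delta_{Z_1}$ a.s. and the choice of $Q_0$ is irrelevant. The de Finetti measure of an exchangeable sequence $\{Z_n\}$ is the probability law on $\mathcal{P}_{\mathbb{X}}$ of the random probability measure conditionally on which the $Z_n$ are independent and identically distributed with that random probability measure as common distribution. The notation $Q_n\Rightarrow Q$ a.s.-$\mathbb{P}$ means that there is $A\in\mathscr{F}$ with $\mathbb{P}(A)=1$ such that, for each $\omega\in A$, the probability measures $Q_n(\omega)$ converge weakly to $Q(\omega)$. *)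

theory Defs
  imports "HOL-Probability.Probability"
begin

section \<open>The space of probability measures\<close>

text \<open>
  \<^term>\<open>space (prob_algebra borel)\<close> is the set of all Borel probability measures.
  Only its carrier is used here; the \<open>\<sigma>\<close>-field is the one generated by the topology of
  weak convergence, the coarsest topology making \<open>\<mu> \<mapsto> \<integral>f d\<mu>\<close> continuous for all bounded
  continuous real functions \<open>f\<close>.
\<close>

definition weak_topology :: "'a::topological_space measure topology" where
  "weak_topology = topology_generated_by
     {{\<mu> \<in> space (prob_algebra borel). (\<integral>x. f x \<partial>\<mu>) \<in> U} | (f :: 'a \<Rightarrow> real) U.
        continuous_on UNIV f \<and> bounded (range f) \<and> open U}"

definition prob_measures :: "'a::topological_space measure measure" where
  "prob_measures = sigma (space (prob_algebra borel)) {U. openin weak_topology U}"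

definition weakly_converges ::
    "(nat \<Rightarrow> 'a::topological_space measure) \<Rightarrow> 'a measure \<Rightarrow> bool" where
  "weakly_converges \<mu> \<nu> \<longleftrightarrow>
     (\<forall>f :: 'a \<Rightarrow> real. continuous_on UNIV f \<longrightarrow> bounded (range f) \<longrightarrow>
        (\<lambda>n. \<integral>x. f x \<partial>\<mu> n) \<longlonglongrightarrow> (\<integral>x. f x \<partial>\<nu>))"

lemma topspace_weak_topology: "topspace weak_topology = space (prob_algebra borel)"
proof -
  have "space (prob_algebra borel) \<in>
     {{\<mu> \<in> space (prob_algebra borel). (\<integral>x. f x \<partial>\<mu>) \<in> U} | (f :: 'a \<Rightarrow> real) U.
        continuous_on UNIV f \<and> bounded (range f) \<and> open U}"
    by (intro CollectI exI[of _ "\<lambda>_. 0"] exI[of _ UNIV]) auto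
  then show ?thesis
    unfolding weak_topology_def topology_generated_by_topspace by blast
qed

lemma space_prob_measures: "space prob_measures = space (prob_algebra borel)"
  unfolding prob_measures_def
  by (rule space_measure_of) (use openin_subset topspace_weak_topology in blast)

lemma limitin_weak_topology_iff:
  assumes \<mu>: "\<And>n. \<mu> n \<in> space (prob_algebra borel)"
    and \<nu>: "\<nu> \<in> space (prob_algebra borel)"
  shows "limitin weak_topology \<mu> \<nu> sequentially \<longleftrightarrow> weakly_converges \<mu> \<nu>"
proof
  assume L: "limitin weak_topology \<mu> \<nu> sequentially"
  show "weakly_converges \<mu> \<nu>"
    unfolding weakly_converges_def
  proof (intro allI impI topological_tendstoI)
    fix f :: "'a \<Rightarrow> real" and U
    assume f: "continuous_on UNIV f" "bounded (range f)" and U: "open U" "(\<integral>x. f x \<partial>\<nu>) \<in> U"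
    have "openin weak_topology {\<mu> \<in> space (prob_algebra borel). (\<integral>x. f x \<partial>\<mu>) \<in> U}"
      unfolding weak_topology_def by (rule topology_generated_by_Basis) (use f U in blast)
    with L U \<nu> have "\<forall>\<^sub>F n in sequentially. \<mu> n \<in> {\<mu> \<in> space (prob_algebra borel). (\<integral>x. f x \<partial>\<mu>) \<in> U}"
      unfolding limitin_def by blast
    then show "\<forall>\<^sub>F n in sequentially. (\<integral>x. f x \<partial>\<mu> n) \<in> U"
      by (rule eventually_mono) blast
  qed
next
  assume W: "weakly_converges \<mu> \<nu>"
  have "\<forall>\<^sub>F n in sequentially. \<mu> n \<in> V" if V: "openin weak_topology V" "\<nu> \<in> V" for V
  proof -
    from V(1) have "generate_topology_on
     {{\<mu> \<in> space (prob_algebra borel). (\<integral>x. f x \<partial>\<mu>) \<in> U} | (f :: 'a \<Rightarrow> real) U.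
        continuous_on UNIV f \<and> bounded (range f) \<and> open U} V"
      unfolding weak_topology_def by (rule openin_topology_generated_by)
    then show ?thesis using V(2)
    proof induction
      case (Int a b)
      then show ?case by (auto intro: eventually_conj)
    next
      case (UN K)
      then obtain k where "k \<in> K" "\<nu> \<in> k" by blast
      with UN have "\<forall>\<^sub>F n in sequentially. \<mu> n \<in> k" by blast
      then show ?case by (rule eventually_mono) (use \<open>k \<in> K\<close> in blast)
    next
      case (Basis s)
      then obtain f :: "'a \<Rightarrow> real" and U where
        s: "s = {\<mu> \<in> space (prob_algebra borel). (\<integral>x. f x \<partial>\<mu>) \<in> U}"
        and f: "continuous_on UNIV f" "bounded (range f)" and U: "open U" by blast
      have "(\<lambda>n. \<integral>x. f x \<partial>\<mu> n) \<longlonglongrightarrow> (\<integral>x. f x \<partial>\<nu>)"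
        using W f unfolding weakly_converges_def by blast
      then have "\<forall>\<^sub>F n in sequentially. (\<integral>x. f x \<partial>\<mu> n) \<in> U"
        using U Basis(2) s by (auto dest: topological_tendstoD)
      then show ?case using \<mu> s by simp
    qed simp
  qed
  then show "limitin weak_topology \<mu> \<nu> sequentially"
    using \<nu> unfolding limitin_def topspace_weak_topology by blast
qed


section \<open>Independence, exchangeability, de Finetti measure\<close>

text \<open>
  \<^const>\<open>prob_space.indep_var\<close> forces both random variables to have the same value type;
  this is the same notion for random elements of two different types.
\<close>

definition indep_rand_elems ::
    "'w measure \<Rightarrow> 'b measure \<Rightarrow> ('w \<Rightarrow> 'b) \<Rightarrow> 'c measure \<Rightarrow> ('w \<Rightarrow> 'c) \<Rightarrow> bool" where
  "indep_rand_elems M N X N' Y \<longleftrightarrow>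
     X \<in> measurable M N \<and> Y \<in> measurable M N' \<and>
     prob_space.indep_set M
       {X -` A \<inter> space M | A. A \<in> sets N} {Y -` B \<inter> space M | B. B \<in> sets N'}"

definition exchangeable :: "'w measure \<Rightarrow> (nat \<Rightarrow> 'w \<Rightarrow> 'a::topological_space) \<Rightarrow> bool" where
  "exchangeable M Z \<longleftrightarrow>
     (\<forall>n\<ge>1. Z n \<in> borel_measurable M) \<and>
     (\<forall>n \<pi>. \<pi> permutes {1..n} \<longrightarrow>
        distr M (\<Pi>\<^sub>M i\<in>{1..n}. borel) (\<lambda>\<omega>. \<lambda>i\<in>{1..n}. Z (\<pi> i) \<omega>) =
        distr M (\<Pi>\<^sub>M i\<in>{1..n}. borel) (\<lambda>\<omega>. \<lambda>i\<in>{1..n}. Z i \<omega>))"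

text \<open>Conditionally on the random probability measure \<open>P\<close>, the \<open>Z n\<close> (\<open>n \<ge> 1\<close>) are
  independent with common distribution \<open>P\<close>; the conditioning is on the \<open>\<sigma>\<close>-field generated
  by \<open>P\<close>.\<close>

definition cond_iid :: "'w measure \<Rightarrow> (nat \<Rightarrow> 'w \<Rightarrow> 'a::topological_space) \<Rightarrow>
    ('w \<Rightarrow> 'a measure) \<Rightarrow> bool" where
  "cond_iid M Z P \<longleftrightarrow>
     P \<in> measurable M prob_measures \<and>
     (\<forall>n B. (\<forall>i\<in>{1..n}. B i \<in> sets borel) \<longrightarrow>
        (AE \<omega> in M.
           real_cond_exp M (vimage_algebra (space M) P prob_measures)
             (indicator {\<omega> \<in> space M. \<forall>i\<in>{1..n}. Z i \<omega> \<in> B i}) \<omega>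
           = (\<Prod>i = 1..n. measure (P \<omega>) (B i))))"

definition is_de_Finetti_measure :: "'w measure \<Rightarrow> (nat \<Rightarrow> 'w \<Rightarrow> 'a::topological_space) \<Rightarrow>
    'a measure measure \<Rightarrow> bool" where
  "is_de_Finetti_measure M Z m \<longleftrightarrow> (\<exists>P. cond_iid M Z P \<and> m = distr M prob_measures P)"


section \<open>Beta and Dirichlet distributions\<close>

definition beta_density :: "real \<Rightarrow> real \<Rightarrow> real \<Rightarrow> real" where
  "beta_density a b x =
     (if 0 < x \<and> x < 1 then x powr (a - 1) * (1 - x) powr (b - 1) / Beta a b else 0)"

text \<open>
  The Dirichlet distribution on the simplex in \<open>\<real>\<^sup>n\<close> (coordinates \<open>1, \<dots>, n\<close>) is singular, so
  it is given by the usual density of the first \<open>n - 1\<close> coordinates, the last coordinate being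
  one minus their sum. For \<open>n = 1\<close> this is the point mass at \<open>1\<close>.
\<close>

definition dirichlet_density :: "nat \<Rightarrow> (nat \<Rightarrow> real) \<Rightarrow> (nat \<Rightarrow> real) \<Rightarrow> real" where
  "dirichlet_density n \<alpha> x =
     (if (\<forall>i\<in>{1..<n}. 0 < x i) \<and> (\<Sum>i\<in>{1..<n}. x i) < 1
      then Gamma (\<Sum>i\<in>{1..n}. \<alpha> i) / (\<Prod>i\<in>{1..n}. Gamma (\<alpha> i)) *
           (\<Prod>i\<in>{1..<n}. x i powr (\<alpha> i - 1)) *
           (1 - (\<Sum>i\<in>{1..<n}. x i)) powr (\<alpha> n - 1)
      else 0)"

definition dirichlet :: "nat \<Rightarrow> (nat \<Rightarrow> real) \<Rightarrow> (nat \<Rightarrow> real) measure" where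
  "dirichlet n \<alpha> =
     distr (density (\<Pi>\<^sub>M i\<in>{1..<n}. lborel) (\<lambda>x. ennreal (dirichlet_density n \<alpha> x)))
       (\<Pi>\<^sub>M i\<in>{1..n}. borel)
       (\<lambda>x. \<lambda>i\<in>{1..n}. if i = n then 1 - (\<Sum>j\<in>{1..<n}. x j) else x i)"

end

theory Submission
  imports Defs
begin

text \<open>
  The weights \<open>q\<^sub>i\<^sup>n = W\<^sub>i \<Prod>\<^bsub>i < j \<le> n\<^esub> (1 - W\<^sub>j)\<close> come from unfolding the recursion. Passing from \<open>n\<close> to \<open>n + 1\<close>
  rescales the uniform law on a simplex by \<open>1 - w\<close> and mixes over the Beta variable \<open>w\<close>, which is the
  uniform law on the simplex of one more dimension.

  De Finetti's theorem: for exchangeable indicators, second moments of weighted sums whose weights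
  add up to zero are bounded by the sum of the squared weights. So the empirical frequencies of a
  Borel set \<open>B\<close> converge almost surely along a geometric subsequence to some \<open>L B\<close>. Inner regularity
  by compact sets on a countable generating algebra turns the almost surely additive family \<open>L\<close> into a random
  measure \<open>P\<close>. Since \<open>L\<close> is invariant under finite permutations of the sequence, \<open>Z\<^sub>n\<^sub>+\<^sub>1\<close> may be
  replaced by an average over later terms, which gives the conditional i.i.d. property given \<open>P\<close>.

  The same second moment bound applied to the random weights \<open>q\<^sup>n\<close> yields
  \<open>E (Q\<^sub>n B - L B)\<^sup>2 \<le> 4 / (n + 1)\<close>. This gives almost sure convergence along the squares, and the gaps between
  consecutive squares are controlled by sums of the \<open>W\<^sub>j\<close>. Countably many open sets \<open>B\<close> determine
  weak convergence.
\<close>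

section \<open>The weak topology and its Borel sets\<close>

text \<open>\<open>limfreq\<close> is a deterministic function of the whole path, invariant under
  finite permutations at every path and not only almost surely, and the random measure is chosen as
  a function of its values alone. Hence every event generated by \<open>P\<close> has an invariant
  indicator, which is what conditioning on the \<sigma>-field of \<open>P\<close> demands. The two
  limits need different subsequences. For the existence of \<open>limfreq\<close>, summable
  increments along any subsequence are enough, and powers of 4 give increments of order
  \<open>2 ^ -k\<close> in L2. For \<open>Q n\<close> the terms between the chosen indices must be
  controlled as well. Since \<open>V j\<close> has mean \<open>1 / j\<close>, the sticks between
  consecutive powers of 4 have total mean near \<open>ln 4\<close>; between consecutive squares it
  is of order \<open>1 / k\<close>. Squares are still sparse enough for the bounds
  \<open>4 / (n + 1)\<close> to be summable. The 4 is the 2 of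
  \<open>(a - b)^2 \<le> 2 * a^2 + 2 * b^2\<close> times the 2 of
  \<open>sum_second_moment_weight\<close>; the frequency over m terms adds \<open>2 / m\<close>,
  which vanishes as m grows.\<close>

lemma step_approximation:
  fixes t :: real
  assumes "0 \<le> t" "t \<le> 1" "m > 0"
  shows "(\<Sum>j = 1..m. of_bool (real j / real m < t)) / real m \<le> t"
    and "t - 1 / real m \<le> (\<Sum>j = 1..m. of_bool (real j / real m < t)) / real m"
proof -
  \<comment> \<open>The integers j in \<open>1..m\<close> with \<open>j < t * m\<close> number at
    least \<open>t * m - 1\<close> and at most \<open>t * m\<close>. The strict comparison matters
    later: for \<open>t = f x\<close> it makes the level sets open.\<close>
  define k where "k = card {j \<in> {1..m}. real j < t * real m}"
  have sum: "(\<Sum>j = 1..m. of_bool (real j / real m < t) :: real) = real k"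
  proof -
    have "(\<Sum>j = 1..m. of_bool (real j / real m < t) :: real) = (\<Sum>j = 1..m. of_bool (real j < t * real m))"
      using assms(3) by (intro sum.cong) (auto simp: field_simps)
    also have "\<dots> = real k" unfolding k_def by (simp add: Int_def)
    finally show ?thesis .
  qed
  have tm: "t * real m \<le> real m" using assms by (simp add: mult_left_le_one_le)
  have "{j \<in> {1..m}. real j < t * real m} \<subseteq> {1..nat \<lfloor>t * real m\<rfloor>}"
    by (auto simp: le_nat_iff le_floor_iff)
  from card_mono[OF _ this] have "real k \<le> real (nat \<lfloor>t * real m\<rfloor>)" unfolding k_def by simp
  also have "\<dots> \<le> t * real m" using assms by simp
  finally have 1: "real k \<le> t * real m" .
  have "{1..nat (\<lceil>t * real m\<rceil> - 1)} \<subseteq> {j \<in> {1..m}. real j < t * real m}"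
  proof safe
    fix j assume j: "j \<in> {1..nat (\<lceil>t * real m\<rceil> - 1)}"
    then have "int j < \<lceil>t * real m\<rceil>" by auto
    then show "real j < t * real m" by (simp add: less_ceiling_iff)
    with tm show "j \<in> {1..m}" using j by auto
  qed
  from card_mono[OF _ this] have "nat (\<lceil>t * real m\<rceil> - 1) \<le> k" unfolding k_def by simp
  then have 2: "t * real m - 1 \<le> real k" by linarith
  show "(\<Sum>j = 1..m. of_bool (real j / real m < t)) / real m \<le> t"
    using 1 assms(3) unfolding sum by (simp add: field_simps)
  show "t - 1 / real m \<le> (\<Sum>j = 1..m. of_bool (real j / real m < t)) / real m"
    using 2 assms(3) unfolding sum by (simp add: pos_le_divide_eq left_diff_distrib)
qed

text \<open>Finite unions rather than base sets alone: every open set is then the union of an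
  increasing sequence of members, so its mass under a given measure is nearly reached by one member,
  and the family stays countable.\<close>

definition base_unions :: "'a::second_countable_topology set set" where
  "base_unions = Union ` {F. finite F \<and> F \<subseteq> (SOME B. countable B \<and> topological_basis B)}"

lemma countable_base_unions: "countable (base_unions :: 'a::second_countable_topology set set)"
  unfolding base_unions_def
  using someI_ex[OF ex_countable_basis] by (intro countable_image countable_Collect_finite_subset) auto

lemma open_base_unions: "U \<in> base_unions \<Longrightarrow> open U"
  unfolding base_unions_def
  using someI_ex[OF ex_countable_basis] by (auto intro!: open_Union dest: topological_basis_open)

abbreviation borel_probs :: "'a::topological_space measure set" where
  "borel_probs \<equiv> space (prob_algebra borel)"

lemma base_unions_approx:
  fixes O' :: "'a::second_countable_topology set"
  assumes \<mu>: "\<mu> \<in> borel_probs" and O': "open O'" and e: "e > 0"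
  shows "\<exists>U\<in>base_unions. U \<subseteq> O' \<and> measure \<mu> O' - e < measure \<mu> U"
proof -
  define B where "B = (SOME B::'a set set. countable B \<and> topological_basis B)"
  have B: "countable B" "topological_basis B"
    using someI_ex[OF ex_countable_basis, where 'a1='a] unfolding B_def by auto
  from \<mu> interpret prob_space \<mu> by (simp add: space_prob_algebra)
  from \<mu> have [measurable_cong, simp]: "sets \<mu> = sets borel" by (simp add: space_prob_algebra)
  obtain B' where B': "B' \<subseteq> B" "\<Union>B' = O'" using B(2) O' unfolding topological_basis_def by metis
  show ?thesis
  \<comment> \<open>\<open>from_nat_into\<close> enumerates nonempty sets only, so the empty union
    is treated apart.\<close>
  proof (cases "B' = {}")
    case True
    then show ?thesis using B' e by (intro bexI[of _ "{}"]) (auto simp: base_unions_def intro!: image_eqI[of _ _ "{}"])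
  next
    case False
    have cB': "countable B'" using B B' countable_subset by blast
    define V where "V n = (\<Union>i\<le>n. from_nat_into B' i)" for n
    have op: "open b" if "b \<in> B'" for b using that B' B topological_basis_open by blast
    have fr: "from_nat_into B' i \<in> B'" for i using from_nat_into[OF False] .
    have "(\<lambda>n. measure \<mu> (V n)) \<longlonglongrightarrow> measure \<mu> (\<Union>n. V n)"
    proof (rule finite_Lim_measure_incseq)
      show "range V \<subseteq> sets \<mu>" unfolding V_def using op fr by (auto intro!: borel_open open_Union)
      show "incseq V" unfolding V_def incseq_def by (auto intro: order_trans)
    qed
    moreover have "(\<Union>n. V n) = O'"
    proof -
      have "(\<Union>n. V n) = (\<Union>n. from_nat_into B' n)" unfolding V_def by auto
      also have "\<dots> = \<Union>B'" using range_from_nat_into[OF False cB'] by auto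
      finally show ?thesis using B' by simp
    qed
    ultimately have "(\<lambda>n. measure \<mu> (V n)) \<longlonglongrightarrow> measure \<mu> O'" by simp
    from order_tendstoD(1)[OF this, of "measure \<mu> O' - e"] e
    have "\<forall>\<^sub>F n in sequentially. measure \<mu> O' - e < measure \<mu> (V n)" by simp
    then obtain n where "measure \<mu> O' - e < measure \<mu> (V n)" by (auto simp: eventually_sequentially)
    moreover have "V n \<in> base_unions"
      unfolding base_unions_def B_def[symmetric]
      by (rule image_eqI[of _ _ "from_nat_into B' ` {..n}"]) (use fr B' in \<open>auto simp: V_def\<close>)
    moreover have "V n \<subseteq> O'" using fr B' unfolding V_def by auto
    ultimately show ?thesis by blast
  qed
qed

lemma integral_prob_bounded:
  fixes f :: "'a::topological_space \<Rightarrow> real"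
  assumes \<mu>: "\<mu> \<in> borel_probs" and f: "f \<in> borel_measurable borel" "bounded (range f)"
  shows "integrable \<mu> f"
proof -
  from \<mu> interpret prob_space \<mu> by (simp add: space_prob_algebra)
  from \<mu> have [measurable_cong, simp]: "sets \<mu> = sets borel" by (simp add: space_prob_algebra)
  obtain c where "\<And>x. \<bar>f x\<bar> \<le> c" using f(2) by (auto simp: bounded_iff)
  then show ?thesis using f(1) by (intro integrable_const_bound[of _ c]) auto
qed

text \<open>Lower semicontinuous functionals only need to be tested on averages of indicators of
  countably many open sets: this gives both a countable subbase of the weak topology and a
  countable convergence-determining class.\<close>

lemma integral_lower_approx:
  fixes f :: "'a::second_countable_topology \<Rightarrow> real"
  assumes \<mu>: "\<mu> \<in> borel_probs"
    and f: "continuous_on UNIV f" "\<And>x. 0 \<le> f x" "\<And>x. f x \<le> 1"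
    and a: "a < (\<integral>x. f x \<partial>\<mu>)"
  shows "\<exists>Us. set Us \<subseteq> base_unions \<and> a < (\<Sum>U\<leftarrow>Us. measure \<mu> U) / real (length Us) \<and>
    (\<forall>\<nu>\<in>borel_probs. (\<Sum>U\<leftarrow>Us. measure \<nu> U) / real (length Us) \<le> (\<integral>x. f x \<partial>\<nu>))"
proof -
  from \<mu> interpret prob_space \<mu> by (simp add: space_prob_algebra)
  have [measurable]: "f \<in> borel_measurable borel" using f(1) by (rule borel_measurable_continuous_onI)
  have bf: "bounded (range f)" using f by (intro boundedI[of _ 1]) auto
  \<comment> \<open>The margin \<open>2 / m\<close> pays twice \<open>1 / m\<close>: once for
    replacing f by its step function, once for replacing the level sets \<open>E j\<close> by
    members of \<open>base_unions\<close>.\<close>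
  obtain m :: nat where m: "m > 0" "2 / real m < (\<integral>x. f x \<partial>\<mu>) - a"
  proof -
    obtain n :: nat where "2 / ((\<integral>x. f x \<partial>\<mu>) - a) < real n" using reals_Archimedean2 by blast
    moreover have "0 < 2 / ((\<integral>x. f x \<partial>\<mu>) - a)" using a by simp
    ultimately have n: "0 < real n" by linarith
    then have "2 / real n < (\<integral>x. f x \<partial>\<mu>) - a"
      using a \<open>2 / _ < real n\<close> by (simp add: pos_divide_less_eq mult.commute)
    then show thesis using that n by simp
  qed
  define E where "E j = {x. real j / real m < f x}" for j :: nat
  have opE: "open (E j)" for j unfolding E_def
    using open_Collect_less[OF continuous_on_const f(1)] by simp
  then have E_borel[measurable]: "E j \<in> sets borel" for j by simp
  have "\<forall>j. \<exists>U. U \<in> base_unions \<and> U \<subseteq> E j \<and> measure \<mu> (E j) - 1 / real m < measure \<mu> U"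
  proof
    fix j show "\<exists>U. U \<in> base_unions \<and> U \<subseteq> E j \<and> measure \<mu> (E j) - 1 / real m < measure \<mu> U"
      using base_unions_approx[OF \<mu> opE, of "1 / real m" j] m(1) by auto
  qed
  from choice[OF this] obtain V where V: "\<And>j. V j \<in> base_unions" "\<And>j. V j \<subseteq> E j"
    "\<And>j. measure \<mu> (E j) - 1 / real m < measure \<mu> (V j)" by blast
  have V_borel[measurable]: "V j \<in> sets borel" for j using open_base_unions[OF V(1)] by (rule borel_open)
  have sum_eq: "(\<Sum>U\<leftarrow>map V [1..<Suc m]. measure \<nu> U) = (\<Sum>j = 1..m. measure \<nu> (V j))" for \<nu>
    by (simp add: interv_sum_list_conv_sum_set_nat atLeastLessThanSuc_atLeastAtMost o_def del: upt_Suc)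
  have int_ind: "integrable \<nu> (\<lambda>x. (\<Sum>j = 1..m. indicator (F j) x) / real m)"
    and int_sum: "(\<integral>x. (\<Sum>j = 1..m. indicator (F j) x) / real m \<partial>\<nu>) = (\<Sum>j = 1..m. measure \<nu> (F j)) / real m"
    if "\<nu> \<in> borel_probs" "\<And>j. F j \<in> sets borel" for \<nu> and F :: "nat \<Rightarrow> 'a set"
  proof -
    from that interpret N: prob_space \<nu> by (simp add: space_prob_algebra)
    have [measurable_cong]: "sets \<nu> = sets borel" using that by (simp add: space_prob_algebra)
    have [measurable]: "F j \<in> sets \<nu>" for j using that by (simp add: space_prob_algebra)
    show "integrable \<nu> (\<lambda>x. (\<Sum>j = 1..m. indicator (F j) x) / real m)"
      "(\<integral>x. (\<Sum>j = 1..m. indicator (F j) x) / real m \<partial>\<nu>) = (\<Sum>j = 1..m. measure \<nu> (F j)) / real m"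
      by (simp_all add: Bochner_Integration.integral_sum integrable_real_indicator N.emeasure_finite less_top[symmetric])
  qed
  have ind: "indicator (E j) x = of_bool (real j / real m < f x)" for j x
    by (auto simp: E_def indicator_def)
  have up: "(\<integral>x. f x \<partial>\<mu>) \<le> (\<Sum>j = 1..m. measure \<mu> (E j)) / real m + 1 / real m"
  proof -
    have "(\<integral>x. f x - 1 / real m \<partial>\<mu>) \<le> (\<integral>x. (\<Sum>j = 1..m. indicator (E j) x) / real m \<partial>\<mu>)"
    proof (rule integral_mono)
      show "integrable \<mu> (\<lambda>x. f x - 1 / real m)" using integral_prob_bounded[OF \<mu> _ bf] by simp
      show "integrable \<mu> (\<lambda>x. (\<Sum>j = 1..m. indicator (E j) x) / real m)"
        by (rule int_ind[OF \<mu> E_borel])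
    qed (use step_approximation(2)[OF f(2,3) m(1)] in \<open>simp add: ind\<close>)
    moreover have "(\<integral>x. f x - 1 / real m \<partial>\<mu>) = (\<integral>x. f x \<partial>\<mu>) - 1 / real m"
      using integral_prob_bounded[OF \<mu> _ bf] by (simp add: prob_space)
    ultimately show ?thesis unfolding int_sum[of \<mu> E, OF \<mu> E_borel] by simp
  qed
  have "(\<Sum>j = 1..m. measure \<mu> (E j)) - (\<Sum>j = 1..m. measure \<mu> (V j)) \<le> 1"
  proof -
    have "(\<Sum>j = 1..m. measure \<mu> (E j) - measure \<mu> (V j)) \<le> (\<Sum>j = 1..m. 1 / real m)"
      using V(3) by (intro sum_mono) (smt (verit) )
    then show ?thesis using m(1) by (simp add: sum_subtractf)
  qed
  then have "(\<Sum>j = 1..m. measure \<mu> (E j)) / real m \<le> (\<Sum>j = 1..m. measure \<mu> (V j)) / real m + 1 / real m"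
    using m(1) by (simp add: field_simps)
  with up m(2) have "a < (\<Sum>j = 1..m. measure \<mu> (V j)) / real m" by simp
  \<comment> \<open>\<open>V\<close> was selected for \<open>\<mu>\<close>, but the inclusion of
    \<open>V j\<close> in \<open>E j\<close> does not mention a measure, so the average stays below
    the integral of f for every \<open>\<nu>\<close>.\<close>
  moreover have "(\<Sum>j = 1..m. measure \<nu> (V j)) / real m \<le> (\<integral>x. f x \<partial>\<nu>)"
    if \<nu>: "\<nu> \<in> borel_probs" for \<nu>
  proof -
    have "(\<integral>x. (\<Sum>j = 1..m. indicator (V j) x) / real m \<partial>\<nu>) \<le> (\<integral>x. f x \<partial>\<nu>)"
    proof (rule integral_mono)
      show "integrable \<nu> f" using integral_prob_bounded[OF \<nu> _ bf] by simp
      show "integrable \<nu> (\<lambda>x. (\<Sum>j = 1..m. indicator (V j) x) / real m)"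
        by (rule int_ind[OF \<nu> V_borel])
      fix x
      have "(\<Sum>j = 1..m. indicator (V j) x :: real) \<le> (\<Sum>j = 1..m. of_bool (real j / real m < f x))"
        using V(2) unfolding ind[symmetric] by (intro sum_mono) (auto simp: indicator_def)
      then have "(\<Sum>j = 1..m. indicator (V j) x) / real m \<le> (\<Sum>j = 1..m. of_bool (real j / real m < f x)) / real m"
        by (intro divide_right_mono) auto
      with step_approximation(1)[OF f(2,3) m(1)]
      show "(\<Sum>j = 1..m. indicator (V j) x) / real m \<le> f x" by (rule order_trans[rotated])
    qed
    then show ?thesis unfolding int_sum[of \<nu> V, OF \<nu> V_borel] by simp
  qed
  \<comment> \<open>A list instead of a set: different levels may share the same \<open>V j\<close>,
    and each must count in the average.\<close>
  ultimately show ?thesis using V(1) sum_eq m(1)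
    by (intro exI[of _ "map V [1..<Suc m]"]) (auto simp del: upt_Suc)
qed

text \<open>Finite intersections of these sets form a countable base of the weak topology; the affine
  rescaling reduces bounded functions to \<open>[0,1]\<close>-valued ones.\<close>

definition mass_halfspace :: "'a set list \<times> rat \<Rightarrow> 'a::topological_space measure set" where
  "mass_halfspace p = {\<nu> \<in> borel_probs.
     of_rat (snd p) < (\<Sum>U\<leftarrow>fst p. measure \<nu> U) / real (length (fst p))}"

lemma integral_halfspace_nhd:
  fixes f :: "'a::second_countable_topology \<Rightarrow> real"
  assumes \<mu>: "\<mu> \<in> borel_probs"
    and f: "continuous_on UNIV f" "bounded (range f)"
    and a: "a < (\<integral>x. f x \<partial>\<mu>)"
  shows "\<exists>p\<in>lists base_unions \<times> UNIV. \<mu> \<in> mass_halfspace p \<and> (\<forall>\<nu>\<in>mass_halfspace p. a < (\<integral>x. f x \<partial>\<nu>))"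
proof -
  obtain c where c: "\<And>x. \<bar>f x\<bar> \<le> c" "c > 0"
    using f(2) by (auto simp: bounded_pos)
  have fm[measurable]: "f \<in> borel_measurable borel" using f(1) by (rule borel_measurable_continuous_onI)
  define h where "h x = (f x + c) / (2 * c)" for x
  have h: "continuous_on UNIV h" "\<And>x. 0 \<le> h x" "\<And>x. h x \<le> 1"
    using c f(1) unfolding h_def by (auto intro!: continuous_intros simp: field_simps abs_le_iff) (smt (verit) c(1))+
  have int_h: "(\<integral>x. h x \<partial>\<nu>) = ((\<integral>x. f x \<partial>\<nu>) + c) / (2 * c)" if "\<nu> \<in> borel_probs" for \<nu>
  proof -
    from that interpret prob_space \<nu> by (simp add: space_prob_algebra)
    show ?thesis using integral_prob_bounded[OF that fm f(2)] unfolding h_def by (simp add: prob_space)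
  qed
  have "(a + c) / (2 * c) < (\<integral>x. h x \<partial>\<mu>)"
    using a c(2) unfolding int_h[OF \<mu>] by (simp add: divide_strict_right_mono)
  from integral_lower_approx[OF \<mu> h this] obtain Us where Us: "set Us \<subseteq> base_unions"
    "(a + c) / (2 * c) < (\<Sum>U\<leftarrow>Us. measure \<mu> U) / real (length Us)"
    "\<And>\<nu>. \<nu>\<in>borel_probs \<Longrightarrow> (\<Sum>U\<leftarrow>Us. measure \<nu> U) / real (length Us) \<le> (\<integral>x. h x \<partial>\<nu>)"
    by blast
  \<comment> \<open>A rational threshold in place of the real one leaves only countably many
    half-spaces.\<close>
  obtain r where r: "(a + c) / (2 * c) < of_rat r" "of_rat r < (\<Sum>U\<leftarrow>Us. measure \<mu> U) / real (length Us)"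
    using of_rat_dense[OF Us(2)] by blast
  show ?thesis
  proof (intro bexI conjI ballI)
    show "(Us, r) \<in> lists base_unions \<times> UNIV" using Us by auto
    show "\<mu> \<in> mass_halfspace (Us, r)" using \<mu> r by (simp add: mass_halfspace_def)
    fix \<nu> assume "\<nu> \<in> mass_halfspace (Us, r)"
    then have \<nu>: "\<nu> \<in> borel_probs" "of_rat r < (\<Sum>U\<leftarrow>Us. measure \<nu> U) / real (length Us)"
      by (auto simp: mass_halfspace_def)
    then have "(a + c) / (2 * c) < ((\<integral>x. f x \<partial>\<nu>) + c) / (2 * c)"
      using Us(3)[of \<nu>] r(1) int_h[of \<nu>] by simp
    then show "a < (\<integral>x. f x \<partial>\<nu>)" using c(2) by (simp add: divide_less_cancel)
  qed
qed

text \<open>Half-spaces bound the integrals of f eventually from below by any number under the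
  limit; the same for \<open>- f\<close> bounds them from above. Since the family is countable,
  almost sure convergence for each of its sets separately is enough for almost sure weak
  convergence.\<close>

lemma weakly_converges_base_unions:
  fixes \<mu> :: "nat \<Rightarrow> 'a::second_countable_topology measure"
  assumes \<mu>: "\<And>n. \<mu> n \<in> borel_probs" and \<nu>: "\<nu> \<in> borel_probs"
    and lim: "\<And>U. U \<in> base_unions \<Longrightarrow> (\<lambda>n. measure (\<mu> n) U) \<longlonglongrightarrow> measure \<nu> U"
  shows "weakly_converges \<mu> \<nu>"
  unfolding weakly_converges_def
proof (intro allI impI)
  have ev: "\<forall>\<^sub>F n in sequentially. a < (\<integral>x. f x \<partial>\<mu> n)"
    if f: "continuous_on UNIV f" "bounded (range f)" and a: "a < (\<integral>x. f x \<partial>\<nu>)" for f :: "'a \<Rightarrow> real" and a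
  proof -
    from integral_halfspace_nhd[OF \<nu> f a] obtain p where p: "p \<in> lists base_unions \<times> UNIV"
      "\<nu> \<in> mass_halfspace p" "\<And>\<rho>. \<rho> \<in> mass_halfspace p \<Longrightarrow> a < (\<integral>x. f x \<partial>\<rho>)" by blast
    have sl: "(\<lambda>n. \<Sum>U\<leftarrow>Us. measure (\<mu> n) U) \<longlonglongrightarrow> (\<Sum>U\<leftarrow>Us. measure \<nu> U)" if "set Us \<subseteq> base_unions" for Us
      using that by (induction Us) (auto intro!: tendsto_add lim)
    then have "(\<lambda>n. (\<Sum>U\<leftarrow>fst p. measure (\<mu> n) U) / real (length (fst p))) \<longlonglongrightarrow> (\<Sum>U\<leftarrow>fst p. measure \<nu> U) / real (length (fst p))"
      using p(1) unfolding divide_inverse by (intro tendsto_mult tendsto_const sl) auto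
    moreover have "of_rat (snd p) < (\<Sum>U\<leftarrow>fst p. measure \<nu> U) / real (length (fst p))"
      using p(2) by (simp add: mass_halfspace_def)
    ultimately have "\<forall>\<^sub>F n in sequentially. of_rat (snd p) < (\<Sum>U\<leftarrow>fst p. measure (\<mu> n) U) / real (length (fst p))"
      by (rule order_tendstoD)
    then show ?thesis by (rule eventually_mono) (use \<mu> p(3) in \<open>auto simp: mass_halfspace_def\<close>)
  qed
  fix f :: "'a \<Rightarrow> real" assume f: "continuous_on UNIV f" "bounded (range f)"
  have mf: "continuous_on UNIV (\<lambda>x. - f x)" "bounded (range (\<lambda>x. - f x))"
    using f by (auto intro!: continuous_intros simp: bounded_iff)
  show "(\<lambda>n. \<integral>x. f x \<partial>\<mu> n) \<longlonglongrightarrow> (\<integral>x. f x \<partial>\<nu>)"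
  proof (rule order_tendstoI)
    show "\<forall>\<^sub>F n in sequentially. a < (\<integral>x. f x \<partial>\<mu> n)" if "a < (\<integral>x. f x \<partial>\<nu>)" for a
      using ev[OF f that] .
    show "\<forall>\<^sub>F n in sequentially. (\<integral>x. f x \<partial>\<mu> n) < a" if "(\<integral>x. f x \<partial>\<nu>) < a" for a
      using ev[OF mf, of "-a"] that by simp
  qed
qed

section \<open>The Borel \<sigma>-field of the weak topology\<close>

lemma openin_weak_topology_sets:
  fixes V :: "'a::second_countable_topology measure set"
  assumes V: "openin weak_topology V"
  shows "V \<in> sets (prob_algebra borel)"
proof -
  define I where "I = lists (base_unions :: 'a set set) \<times> (UNIV :: rat set)"
  have cI: "countable I" unfolding I_def
    by (intro countable_SIGMA countable_lists countable_base_unions) auto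
  define T where "T F = borel_probs \<inter> (\<Inter>p\<in>F. mass_halfspace p)" for F :: "('a set list \<times> rat) set"
  \<comment> \<open>A weakly open set may be an uncountable union of subbasic ones, which a
    \<sigma>-field does not tolerate; neighbourhoods drawn from the countable index set
    \<open>I\<close> turn it into a countable union.\<close>
  have nhd: "V \<subseteq> borel_probs \<and> (\<forall>\<mu>\<in>V. \<exists>F. finite F \<and> F \<subseteq> I \<and> \<mu> \<in> T F \<and> T F \<subseteq> V)"
    if "openin weak_topology V" for V
  proof -
    from that have "generate_topology_on
     {{\<mu> \<in> borel_probs. (\<integral>x. f x \<partial>\<mu>) \<in> U} | (f :: 'a \<Rightarrow> real) U.
        continuous_on UNIV f \<and> bounded (range f) \<and> open U} V"
      unfolding weak_topology_def by (rule openin_topology_generated_by)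
    then show ?thesis
    proof induction
      case (Int a b)
      show ?case
      proof (intro conjI ballI)
        fix \<mu> assume "\<mu> \<in> a \<inter> b"
        with Int obtain F G where "finite F" "F \<subseteq> I" "\<mu> \<in> T F" "T F \<subseteq> a" "finite G" "G \<subseteq> I" "\<mu> \<in> T G" "T G \<subseteq> b"
          by (meson IntD1 IntD2)
        moreover have "T (F \<union> G) = T F \<inter> T G" by (auto simp: T_def)
        ultimately show "\<exists>F. finite F \<and> F \<subseteq> I \<and> \<mu> \<in> T F \<and> T F \<subseteq> a \<inter> b"
          by (intro exI[of _ "F \<union> G"]) auto
      qed (use Int in auto)
    next
      case (UN K)
      then show ?case by (metis (no_types, lifting) Sup_least UnionE Sup_upper dual_order.trans)
    next
      case (Basis s)
      then obtain f :: "'a \<Rightarrow> real" and U where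
        s: "s = {\<mu> \<in> borel_probs. (\<integral>x. f x \<partial>\<mu>) \<in> U}"
        and f: "continuous_on UNIV f" "bounded (range f)" and U: "open U" by blast
      have mf: "continuous_on UNIV (\<lambda>x. - f x)" "bounded (range (\<lambda>x. - f x))"
        using f by (auto intro!: continuous_intros simp: bounded_iff)
      show ?case
      proof (intro conjI ballI)
        fix \<mu> assume \<mu>: "\<mu> \<in> s"
        then obtain e where e: "e > 0" "ball (\<integral>x. f x \<partial>\<mu>) e \<subseteq> U" using U s by (auto elim: openE)
        have \<mu>': "\<mu> \<in> borel_probs" using \<mu> s by simp
        have "(\<integral>x. f x \<partial>\<mu>) - e < (\<integral>x. f x \<partial>\<mu>)" "- (\<integral>x. f x \<partial>\<mu>) - e < (\<integral>x. - f x \<partial>\<mu>)"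
          using e(1) by simp_all
        \<comment> \<open>A half-space for f and another for \<open>- f\<close> together confine the
          integral to an interval of radius e.\<close>
        note nhd = integral_halfspace_nhd[OF \<mu>' f this(1)] integral_halfspace_nhd[OF \<mu>' mf this(2)]
        from nhd(1) obtain p where p: "p \<in> I" "\<mu> \<in> mass_halfspace p"
          "\<And>\<rho>. \<rho> \<in> mass_halfspace p \<Longrightarrow> (\<integral>x. f x \<partial>\<mu>) - e < (\<integral>x. f x \<partial>\<rho>)"
          unfolding I_def by blast
        from nhd(2) obtain q where q: "q \<in> I" "\<mu> \<in> mass_halfspace q"
          "\<And>\<rho>. \<rho> \<in> mass_halfspace q \<Longrightarrow> - (\<integral>x. f x \<partial>\<mu>) - e < - (\<integral>x. f x \<partial>\<rho>)"
          unfolding I_def integral_minus by blast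
        have "(\<integral>x. f x \<partial>\<rho>) \<in> U" if "\<rho> \<in> mass_halfspace p" "\<rho> \<in> mass_halfspace q" for \<rho>
          using p(3)[OF that(1)] q(3)[OF that(2)] by (intro subsetD[OF e(2)]) (simp add: dist_real_def abs_less_iff)
        then have "T {p, q} \<subseteq> s" unfolding T_def s by auto
        then show "\<exists>F. finite F \<and> F \<subseteq> I \<and> \<mu> \<in> T F \<and> T F \<subseteq> s"
          using p q \<mu>' by (intro exI[of _ "{p, q}"]) (auto simp: T_def)
      qed (use s in auto)
    qed auto
  qed
  have mh: "mass_halfspace p \<in> sets (prob_algebra borel)" if "p \<in> I" for p
  proof -
    have sm: "(\<lambda>\<nu>. \<Sum>U\<leftarrow>Us. measure \<nu> U) \<in> borel_measurable (prob_algebra borel)"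
      if "set Us \<subseteq> base_unions" for Us :: "'a set list"
      using that
    proof (induction Us)
      case (Cons U Us)
      then have "(\<lambda>\<nu>. measure \<nu> U) \<in> borel_measurable (prob_algebra borel)"
        unfolding prob_algebra_def
        by (intro measurable_restrict_space1 measurable_measure_subprob_algebra) (auto simp: open_base_unions)
      with Cons show ?case by simp
    qed simp
    have [measurable]: "(\<lambda>\<nu>. \<Sum>U\<leftarrow>fst p. measure \<nu> U) \<in> borel_measurable (prob_algebra borel)"
      using that unfolding I_def by (intro sm) auto
    then show ?thesis unfolding mass_halfspace_def by measurable
  qed
  have "V = \<Union> (T ` {F. finite F \<and> F \<subseteq> I \<and> T F \<subseteq> V})"
    using nhd[OF V] by blast
  moreover have "\<Union> (T ` {F. finite F \<and> F \<subseteq> I \<and> T F \<subseteq> V}) \<in> sets (prob_algebra borel)"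
  proof (rule sets.countable_UN'')
    show "countable {F. finite F \<and> F \<subseteq> I \<and> T F \<subseteq> V}"
      by (rule countable_subset[OF _ countable_Collect_finite_subset[OF cI]]) auto
    fix F assume "F \<in> {F. finite F \<and> F \<subseteq> I \<and> T F \<subseteq> V}"
    then have "finite F" "F \<subseteq> I" by auto
    then show "T F \<in> sets (prob_algebra borel)"
      unfolding T_def
    proof (induction F)
      case (insert p F)
      have "borel_probs \<inter> (\<Inter>p\<in>insert p F. mass_halfspace p) =
        mass_halfspace p \<inter> (borel_probs \<inter> (\<Inter>p\<in>F. mass_halfspace p))" by auto
      then show ?case using insert mh by auto
    qed auto
  qed
  ultimately show ?thesis by simp
qed

lemma measurable_prob_measures_prob_algebra:
  "(\<lambda>\<mu>. \<mu>) \<in> measurable prob_measures (prob_algebra (borel :: 'a::polish_space measure))"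
proof (rule measurable_prob_algebra_generated[of borel UNIV "{U. open U}"])
  fix U :: "'a set" assume "U \<in> {U. open U}"
  then have U: "open U" by simp
  show "(\<lambda>\<mu>. emeasure \<mu> U) \<in> borel_measurable prob_measures"
  \<comment> \<open>\<open>infdist x {}\<close> is 0, so for \<open>U = UNIV\<close> the
    approximating functions below would vanish; there the mass is constantly 1.\<close>
  proof (cases "U = UNIV")
    case True
    have "(\<lambda>\<mu>. emeasure \<mu> U) \<in> borel_measurable prob_measures \<longleftrightarrow> (\<lambda>\<mu>. 1 :: ennreal) \<in> borel_measurable (prob_measures :: 'a measure measure)"
    proof (rule measurable_cong)
      fix \<mu> :: "'a measure" assume "\<mu> \<in> space prob_measures"
      then have "prob_space \<mu>" "space \<mu> = UNIV"
        using sets_eq_imp_space_eq[of \<mu> borel] by (auto simp: space_prob_measures space_prob_algebra)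
      then show "emeasure \<mu> U = 1" using True prob_space.emeasure_space_1 by metis
    qed
    then show ?thesis by simp
  next
    case False
    \<comment> \<open>Bounded continuous functions increasing to the indicator of U. Their integrals
      are weakly continuous, hence measurable, and dominated convergence passes this on to the mass
      of U.\<close>
    define g where "g k x = min 1 (real k * infdist x (- U))" for k :: nat and x
    have g: "continuous_on UNIV (g k)" "bounded (range (g k))" for k
      unfolding g_def by (auto intro!: continuous_intros boundedI[of _ 1] simp: infdist_nonneg abs_of_nonneg)
    have meas_int: "(\<lambda>\<mu>. \<integral>x. g k x \<partial>\<mu>) \<in> borel_measurable prob_measures" for k
    proof (rule borel_measurableI)
      fix S :: "real set" assume "open S"
      then have "openin weak_topology {\<mu> \<in> borel_probs. (\<integral>x. g k x \<partial>\<mu>) \<in> S}"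
        unfolding weak_topology_def by (intro topology_generated_by_Basis) (use g in blast)
      moreover have "{\<mu> \<in> borel_probs. (\<integral>x. g k x \<partial>\<mu>) \<in> S} = (\<lambda>\<mu>. \<integral>x. g k x \<partial>\<mu>) -` S \<inter> space prob_measures"
        by (auto simp: space_prob_measures)
      ultimately show "(\<lambda>\<mu>. \<integral>x. g k x \<partial>\<mu>) -` S \<inter> space prob_measures \<in> sets prob_measures"
        unfolding prob_measures_def
        using openin_subset[of weak_topology, unfolded topspace_weak_topology]
        by (subst sets_measure_of) (auto intro!: sigma_sets.Basic simp: topspace_weak_topology)
    qed
    have lim: "(\<lambda>k. g k x) \<longlonglongrightarrow> indicator U x" for x
    proof (cases "x \<in> U")
      case True
      then have "infdist x (- U) > 0"
        using U False by (intro infdist_pos_not_in_closed) auto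
      then obtain n where n: "1 < real n * infdist x (- U)" using ex_less_of_nat_mult by blast
      have "\<forall>\<^sub>F k in sequentially. g k x = indicator U x"
        using eventually_ge_at_top[of n]
      proof eventually_elim
        case (elim k)
        then have "real n * infdist x (- U) \<le> real k * infdist x (- U)" by (intro mult_right_mono) (auto simp: infdist_nonneg)
        with n True show ?case by (simp add: g_def)
      qed
      then show ?thesis by (rule tendsto_eventually)
    next
      case False
      then show ?thesis by (simp add: g_def)
    qed
    have "(\<lambda>\<mu>. measure \<mu> U) \<in> borel_measurable prob_measures"
    proof (rule borel_measurable_LIMSEQ_real[OF _ meas_int])
      fix \<mu> :: "'a measure" assume "\<mu> \<in> space prob_measures"
      then have \<mu>: "\<mu> \<in> borel_probs" by (simp add: space_prob_measures)
      then interpret prob_space \<mu> by (simp add: space_prob_algebra)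
      have [measurable_cong, simp]: "sets \<mu> = sets borel" using \<mu> by (simp add: space_prob_algebra)
      have [measurable]: "g k \<in> borel_measurable borel" for k using g(1) by (rule borel_measurable_continuous_onI)
      have [measurable]: "U \<in> sets borel" using U by simp
      have "(\<lambda>k. \<integral>x. g k x \<partial>\<mu>) \<longlonglongrightarrow> (\<integral>x. indicator U x \<partial>\<mu>)"
        by (rule integral_dominated_convergence[where w="\<lambda>_. 1"])
          (auto simp: lim, auto simp: g_def infdist_nonneg abs_of_nonneg)
      then show "(\<lambda>k. \<integral>x. g k x \<partial>\<mu>) \<longlonglongrightarrow> measure \<mu> U" by simp
    qed
    then have "(\<lambda>\<mu>. ennreal (measure \<mu> U)) \<in> borel_measurable prob_measures" by simp
    then show ?thesis
      by (subst measurable_cong[where g="\<lambda>\<mu>. ennreal (measure \<mu> U)"])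
        (auto simp: space_prob_measures space_prob_algebra finite_measure.emeasure_eq_measure prob_space_def)
  qed
qed (auto simp: Int_stable_def space_prob_measures space_prob_algebra borel_def open_Int)

text \<open>Random measures are constructed through the evaluations of single Borel sets, whereas
  the claim refers to the \<sigma>-field of the weak topology; this identification carries
  measurability across.\<close>

lemma sets_prob_measures:
  "sets (prob_measures :: 'a::polish_space measure measure) = sets (prob_algebra borel)"
proof
  show "sets (prob_measures :: 'a measure measure) \<subseteq> sets (prob_algebra borel)"
    unfolding prob_measures_def
    using openin_subset[of weak_topology, unfolded topspace_weak_topology]
    by (subst sets_measure_of, force, intro sets.sigma_sets_subset') (auto intro!: openin_weak_topology_sets)
  show "sets (prob_algebra borel) \<subseteq> sets (prob_measures :: 'a measure measure)"
  proof
    fix A assume A: "A \<in> sets (prob_algebra (borel :: 'a measure))"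
    have "(\<lambda>\<mu>. \<mu>) -` A \<inter> space prob_measures \<in> sets (prob_measures :: 'a measure measure)"
      using measurable_sets[OF measurable_prob_measures_prob_algebra A] .
    moreover have "(\<lambda>\<mu>. \<mu>) -` A \<inter> space prob_measures = A"
      using sets.sets_into_space[OF A] by (auto simp: space_prob_measures)
    ultimately show "A \<in> sets prob_measures" by simp
  qed
qed

section \<open>Random measures from almost surely additive set functions\<close>

text \<open>The \<open>n\<close>-th level consists of the unions of atoms of the partition generated by
  \<open>U 0, \<dots>, U (n - 1)\<close>.\<close>

definition seq_algebra :: "(nat \<Rightarrow> 'a set) \<Rightarrow> 'a set set" where
  "seq_algebra U = (\<Union>n. (\<lambda>T. {x. {k. k < n \<and> x \<in> U k} \<in> T}) ` Pow (Pow {..<n}))"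

lemma countable_seq_algebra: "countable (seq_algebra U)"
  unfolding seq_algebra_def by (intro countable_UN countable_image) (auto intro: countable_finite)

text \<open>The levels are nested: what is decided by the first n memberships is decided by the
  first m as well. This brings two members to a common level, as their union requires.\<close>

lemma seq_algebra_lift:
  assumes "A \<in> seq_algebra U"
  shows "\<exists>n. \<forall>m\<ge>n. \<exists>T\<subseteq>Pow {..<m}. A = {x. {k. k < m \<and> x \<in> U k} \<in> T}"
proof -
  obtain n T where A: "A = {x. {k. k < n \<and> x \<in> U k} \<in> T}" "T \<subseteq> Pow {..<n}"
    using assms unfolding seq_algebra_def by auto
  have "\<exists>T\<subseteq>Pow {..<m}. A = {x. {k. k < m \<and> x \<in> U k} \<in> T}" if "m \<ge> n" for m
  proof (intro exI conjI)
    show "{S \<in> Pow {..<m}. S \<inter> {..<n} \<in> T} \<subseteq> Pow {..<m}" by auto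
    have "{k. k < m \<and> x \<in> U k} \<inter> {..<n} = {k. k < n \<and> x \<in> U k}" for x using that by auto
    then show "A = {x. {k. k < m \<and> x \<in> U k} \<in> {S \<in> Pow {..<m}. S \<inter> {..<n} \<in> T}}"
      unfolding A by auto
  qed
  then show ?thesis by blast
qed

lemma algebra_seq_algebra: "algebra UNIV (seq_algebra U)"
  unfolding algebra_iff_Un
proof (intro conjI ballI)
  show "{} \<in> seq_algebra U" unfolding seq_algebra_def by (auto intro!: image_eqI[of _ _ "{}"])
  fix A assume A: "A \<in> seq_algebra U"
  then obtain n T where T: "A = {x. {k. k < n \<and> x \<in> U k} \<in> T}" "T \<subseteq> Pow {..<n}"
    unfolding seq_algebra_def by auto
  have "UNIV - A = {x. {k. k < n \<and> x \<in> U k} \<in> Pow {..<n} - T}" unfolding T by auto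
  then show "UNIV - A \<in> seq_algebra U" unfolding seq_algebra_def by blast
  fix B assume B: "B \<in> seq_algebra U"
  obtain n1 n2 where
    n: "\<forall>m\<ge>n1. \<exists>T\<subseteq>Pow {..<m}. A = {x. {k. k < m \<and> x \<in> U k} \<in> T}"
       "\<forall>m\<ge>n2. \<exists>T\<subseteq>Pow {..<m}. B = {x. {k. k < m \<and> x \<in> U k} \<in> T}"
    using seq_algebra_lift[OF A] seq_algebra_lift[OF B] by blast
  obtain T1 where T1: "T1 \<subseteq> Pow {..<max n1 n2}" "A = {x. {k. k < max n1 n2 \<and> x \<in> U k} \<in> T1}"
    using n(1)[rule_format, OF max.cobounded1] by blast
  obtain T2 where T2: "T2 \<subseteq> Pow {..<max n1 n2}" "B = {x. {k. k < max n1 n2 \<and> x \<in> U k} \<in> T2}"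
    using n(2)[rule_format, OF max.cobounded2] by blast
  have "A \<union> B = {x. {k. k < max n1 n2 \<and> x \<in> U k} \<in> T1 \<union> T2}" unfolding T1(2) T2(2) by auto
  then show "A \<union> B \<in> seq_algebra U" using T1(1) T2(1) unfolding seq_algebra_def by blast
qed auto

lemma generator_in_seq_algebra: "U n \<in> seq_algebra U"
proof -
  have "U n = {x. {k. k < Suc n \<and> x \<in> U k} \<in> {S \<in> Pow {..<Suc n}. n \<in> S}}" by auto
  then show ?thesis unfolding seq_algebra_def by blast
qed

lemma seq_algebra_subset_sets:
  assumes "\<And>n. U n \<in> sets M" "space M = UNIV"
  shows "seq_algebra U \<subseteq> sets M"
proof
  fix A assume "A \<in> seq_algebra U"
  then obtain n T where T: "A = {x. {k. k < n \<and> x \<in> U k} \<in> T}" "T \<subseteq> Pow {..<n}"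
    unfolding seq_algebra_def by auto
  have "finite T" using finite_subset[OF T(2)] by simp
  have "{x. {k. k < n \<and> x \<in> U k} = S} \<in> sets M" if "S \<subseteq> {..<n}" for S
  proof -
    have "{x. {k. k < n \<and> x \<in> U k} = S} = {x\<in>space M. \<forall>k\<in>{..<n}. x \<in> U k \<longleftrightarrow> k \<in> S}"
      using that assms(2) by auto
    also have "\<dots> \<in> sets M" using assms(1) by measurable
    finally show ?thesis .
  qed
  moreover have "A = (\<Union>S\<in>T. {x. {k. k < n \<and> x \<in> U k} = S})" unfolding T by auto
  ultimately show "A \<in> sets M" using T(2) \<open>finite T\<close> by (auto intro!: sets.finite_UN)
qed

text \<open>Compact inner approximation inside a countable algebra makes a finitely additive set function
  continuous at the empty set, so that it extends to a measure.\<close>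

lemma content_extension:
  fixes l :: "'a::polish_space set \<Rightarrow> real"
  assumes A: "algebra UNIV \<A>" "sets borel = sigma_sets UNIV \<A>"
    and B: "algebra UNIV \<B>" "\<A> \<subseteq> \<B>"
    and nonneg: "\<And>X. X \<in> \<B> \<Longrightarrow> 0 \<le> l X"
    and add: "\<And>X Y. X \<in> \<B> \<Longrightarrow> Y \<in> \<B> \<Longrightarrow> X \<inter> Y = {} \<Longrightarrow> l (X \<union> Y) = l X + l Y"
    and one: "l UNIV = 1"
    and inner: "\<And>X e. X \<in> \<A> \<Longrightarrow> e > 0 \<Longrightarrow> \<exists>K\<in>\<B>. compact K \<and> K \<subseteq> X \<and> l X - l K < e"
  shows "\<exists>\<rho>\<in>borel_probs. \<forall>X\<in>\<A>. measure \<rho> X = l X"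
proof -
  interpret A: algebra UNIV \<A> by fact
  interpret B: algebra UNIV \<B> by fact
  have mono: "l X \<le> l Y" if "X \<in> \<B>" "Y \<in> \<B>" "X \<subseteq> Y" for X Y
    using add[of X "Y - X"] nonneg[of "Y - X"] that by (simp add: Un_absorb1 B.Diff)
  have sub: "l (X \<union> Y) \<le> l X + l Y" if "X \<in> \<B>" "Y \<in> \<B>" for X Y
    using add[of X "Y - X"] mono[of "Y - X" Y] that by (simp add: B.Diff)
  have diff: "l (X - Y) = l X - l Y" if "X \<in> \<B>" "Y \<in> \<B>" "Y \<subseteq> X" for X Y
    using add[of Y "X - Y"] that by (simp add: Un_absorb1 B.Diff)
  have l0: "l {} = 0" using add[of "{}" "{}"] by simp
  \<comment> \<open>The extension starts from \<open>\<A>\<close>, whose members have compact inner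
    approximations; the compact sets themselves need only lie in the larger \<open>\<B>\<close>,
    where the set function is still additive.\<close>
  have "\<exists>\<mu>. (\<forall>s\<in>\<A>. \<mu> s = ennreal (l s)) \<and> measure_space UNIV (sigma_sets UNIV \<A>) \<mu>"
  proof (rule A.caratheodory_empty_continuous)
    show "positive \<A> (\<lambda>s. ennreal (l s))" by (simp add: positive_def l0)
    show "additive \<A> (\<lambda>s. ennreal (l s))"
      unfolding additive_def using B(2) by (auto simp: add ennreal_plus[symmetric] nonneg subset_iff simp del: ennreal_plus)
    fix X :: "nat \<Rightarrow> 'a set"
    assume X: "range X \<subseteq> \<A>" "decseq X" "(\<Inter>i. X i) = {}"
    have XB: "X n \<in> \<B>" for n using X(1) B(2) by auto
    have "(\<lambda>n. l (X n)) \<longlonglongrightarrow> 0"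
    proof (rule LIMSEQ_I)
      fix e :: real assume e: "e > 0"
      have "\<forall>n. \<exists>K. K \<in> \<B> \<and> compact K \<and> K \<subseteq> X n \<and> l (X n) - l K < e * (1/2) ^ Suc n"
      proof
        fix n
        have "X n \<in> \<A>" using X(1) by (rule range_subsetD)
        moreover have "0 < e * (1/2) ^ Suc n" using e by simp
        ultimately show "\<exists>K. K \<in> \<B> \<and> compact K \<and> K \<subseteq> X n \<and> l (X n) - l K < e * (1/2) ^ Suc n"
          by (rule inner[unfolded Bex_def])
      qed
      from choice[OF this] obtain K where K: "\<And>n. K n \<in> \<B>" "\<And>n. compact (K n)" "\<And>n. K n \<subseteq> X n"
        "\<And>n. l (X n) - l (K n) < e * (1/2) ^ Suc n" by blast
      have "\<Inter>(range K) \<subseteq> \<Inter>(range X)" by (rule INF_superset_mono[OF order_refl K(3)])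
      then have "K 0 \<inter> \<Inter>(range K) = {}" unfolding X(3) by simp
      \<comment> \<open>The sets \<open>K n\<close> have empty intersection because the
        \<open>X n\<close> do, and compactness of \<open>K 0\<close> makes a finite part of it empty
        already.\<close>
      then obtain I where I: "finite I" "K 0 \<inter> (\<Inter>i\<in>I. K i) = {}"
        using compact_imp_fip_image[OF K(2)[of 0], of UNIV K] K(2) compact_imp_closed by meson
      define N where "N = Max (insert 0 I)"
      define H where "H n = (\<Inter>i\<le>n. K i)" for n
      have HN: "H N = {}"
      proof -
        have "i \<le> N" if "i \<in> I" for i unfolding N_def using I(1) that by (intro Max_ge) auto
        then have "H N \<subseteq> K 0 \<inter> (\<Inter>i\<in>I. K i)" unfolding H_def by auto
        then show ?thesis unfolding I(2) by simp
      qed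
      have HB: "H n \<in> \<B>" for n unfolding H_def using K(1) by (intro B.finite_INT) auto
      have HX: "H n \<subseteq> X n" for n unfolding H_def using K(3)[of n] by (rule INF_lower2[rotated]) simp
      \<comment> \<open>Passing to \<open>n + 1\<close> adds at most the new error
        \<open>e / 2 ^ (n + 2)\<close>. The partial sums stay strictly below e, so
        \<open>H N = {}\<close> forces \<open>l (X N) < e\<close>.\<close>
      have bound: "l (X n) - l (H n) \<le> e * (1 - (1/2) ^ Suc n)" for n
      proof (induction n)
        case 0
        then show ?case using K(4)[of 0] by (simp add: H_def)
      next
        case (Suc n)
        have "l (X (Suc n) - H (Suc n)) \<le> l ((X n - H n) \<union> (X (Suc n) - K (Suc n)))"
          using decseq_SucD[OF X(2), of n]
          by (intro mono B.Un B.Diff XB HB K(1)) (auto simp: H_def atMost_Suc)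
        also have "\<dots> \<le> l (X n - H n) + l (X (Suc n) - K (Suc n))"
          by (intro sub B.Diff XB HB K(1))
        finally have "l (X (Suc n)) - l (H (Suc n)) \<le> (l (X n) - l (H n)) + (l (X (Suc n)) - l (K (Suc n)))"
          using XB HB HX K(1,3) by (simp add: diff)
        also have "\<dots> \<le> e * (1 - (1/2) ^ Suc n) + e * (1/2) ^ Suc (Suc n)"
          using Suc K(4)[of "Suc n"] by (intro add_mono) auto
        also have "\<dots> = e * (1 - (1/2) ^ Suc (Suc n))" by (simp add: algebra_simps)
        finally show ?case .
      qed
      have "e * (1 - (1/2) ^ Suc N) < e * 1" using e by (intro mult_strict_left_mono) simp_all
      then have "l (X N) < e" using bound[of N] unfolding HN l0 by simp
      moreover have "l (X n) \<le> l (X N)" if "n \<ge> N" for n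
        using decseqD[OF X(2) that] XB by (intro mono)
      ultimately show "\<exists>no. \<forall>n\<ge>no. norm (l (X n) - 0) < e"
        using nonneg[OF XB] by (intro exI[of _ N]) (simp, meson le_less_trans)
    qed
    then show "(\<lambda>n. ennreal (l (X n))) \<longlonglongrightarrow> 0"
      using tendsto_ennrealI[of "\<lambda>n. l (X n)" 0] by simp
  qed simp
  then obtain \<mu> where \<mu>: "\<And>X. X \<in> \<A> \<Longrightarrow> \<mu> X = ennreal (l X)" "measure_space UNIV (sigma_sets UNIV \<A>) \<mu>"
    by blast
  define \<rho> where "\<rho> = measure_of UNIV \<A> \<mu>"
  have sets: "sets \<rho> = sets borel" and sp: "space \<rho> = UNIV" unfolding \<rho>_def using A(2) by simp_all
  have em: "emeasure \<rho> X = ennreal (l X)" if "X \<in> \<A>" for X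
  proof -
    have "emeasure \<rho> X = \<mu> X" unfolding \<rho>_def
      using \<mu>(2) that
      by (intro emeasure_measure_of[OF refl]) (simp_all add: measure_space_def)
    then show ?thesis using \<mu>(1)[OF that] by simp
  qed
  have "prob_space \<rho>" using em[OF A.top] one sp by (intro prob_spaceI) simp
  then show ?thesis using em sets nonneg B(2)
    by (intro bexI[of _ \<rho>]) (auto simp: space_prob_algebra Sigma_Algebra.measure_def subset_iff)
qed

text \<open>The null set where additivity fails depends on the sets involved, so at a fixed \<omega>
  additivity can be had only on a countable algebra. Inner regularity of the mean
  \<open>\<mu>\<close> is transferred to almost every \<omega>, since the mean error of the
  approximation tends to 0. By the third conclusion \<open>P\<close> inherits every invariance of
  \<open>L\<close>.\<close>

theorem regular_random_measure:
  fixes L :: "'a::polish_space set \<Rightarrow> 'w \<Rightarrow> real"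
  assumes M: "prob_space M" and \<mu>: "\<mu> \<in> borel_probs"
    and meas: "\<And>B. B \<in> sets borel \<Longrightarrow> L B \<in> borel_measurable M"
    and nonneg: "\<And>B \<omega>. 0 \<le> L B \<omega>" and le1: "\<And>B \<omega>. L B \<omega> \<le> 1"
    and add: "\<And>A B. A \<in> sets borel \<Longrightarrow> B \<in> sets borel \<Longrightarrow> A \<inter> B = {} \<Longrightarrow>
      AE \<omega> in M. L (A \<union> B) \<omega> = L A \<omega> + L B \<omega>"
    and one: "AE \<omega> in M. L UNIV \<omega> = 1"
    and int: "\<And>B. B \<in> sets borel \<Longrightarrow> (\<integral>\<omega>. L B \<omega> \<partial>M) = measure \<mu> B"
  obtains P where "P \<in> measurable M (prob_algebra borel)"
    "\<forall>B\<in>sets borel. AE \<omega> in M. measure (P \<omega>) B = L B \<omega>"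
    "\<forall>\<omega> \<omega>'. (\<forall>B\<in>sets borel. L B \<omega> = L B \<omega>') \<longrightarrow> P \<omega> = P \<omega>'"
proof -
  interpret M: prob_space M by fact
  interpret mu: prob_space \<mu> using \<mu> by (simp add: space_prob_algebra)
  have sets_mu: "sets \<mu> = sets borel" using \<mu> by (simp add: space_prob_algebra)
  have intL: "integrable M (L B)" if "B \<in> sets borel" for B
    using meas[OF that] nonneg le1 by (intro M.integrable_const_bound[of _ 1]) auto
  obtain G :: "'a set set" where G: "countable G" "topological_basis G" using ex_countable_basis by blast
  define U where "U = from_nat_into (insert {} G)"
  have rU: "range U = insert {} G" unfolding U_def using G(1) by (intro range_from_nat_into) auto
  have U_borel: "U n \<in> sets borel" for n
    using rU G(2) topological_basis_open by (metis borel_open insertE open_empty rangeI)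
  define \<A> where "\<A> = seq_algebra U"
  have A_borel: "\<A> \<subseteq> sets borel" unfolding \<A>_def using U_borel by (intro seq_algebra_subset_sets) auto
  have algA: "algebra UNIV \<A>" unfolding \<A>_def by (rule algebra_seq_algebra)
  interpret A: algebra UNIV \<A> by fact
  have sigA: "sets (borel :: 'a measure) = sigma_sets UNIV \<A>"
  proof
    show "sigma_sets UNIV \<A> \<subseteq> sets (borel :: 'a measure)"
      using A_borel sets.sigma_sets_subset[of \<A> "borel :: 'a measure"] by simp
    have "sets (borel :: 'a measure) = sigma_sets UNIV G"
      unfolding borel_eq_countable_basis[OF G] by (rule sets_measure_of) simp
    also have "\<dots> \<subseteq> sigma_sets UNIV \<A>"
      using rU generator_in_seq_algebra[of U] unfolding \<A>_def by (intro sigma_sets_mono') (metis imageE insertI2 subsetI)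
    finally show "sets (borel :: 'a measure) \<subseteq> sigma_sets UNIV \<A>" .
  qed
  have Int_stable_A: "Int_stable \<A>" unfolding Int_stable_def by (intro ballI A.Int)
  have "\<exists>K. compact K \<and> K \<subseteq> X \<and> measure \<mu> X - 1 / real (Suc j) < measure \<mu> K"
    if "X \<in> sets borel" for X j
  proof -
    have "emeasure \<mu> X = (SUP K\<in>{K. K \<subseteq> X \<and> compact K}. emeasure \<mu> K)"
      using that sets_mu by (intro inner_regular) auto
    \<comment> \<open>A negative bound is truncated to 0 by \<open>ennreal\<close>, where the
      supremum gives no strict comparison; the empty set serves as K in that case.\<close>
    moreover have "ennreal (measure \<mu> X - 1 / real (Suc j)) < emeasure \<mu> X \<or> measure \<mu> X - 1 / real (Suc j) < 0"
      unfolding mu.emeasure_eq_measure by (auto simp: ennreal_less_iff not_less)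
    moreover have "\<exists>K. compact K \<and> K \<subseteq> X \<and> measure \<mu> X - 1 / real (Suc j) < measure \<mu> K"
      if "measure \<mu> X - 1 / real (Suc j) < 0"
      using that by (intro exI[of _ "{}"]) auto
    ultimately show ?thesis
      unfolding less_SUP_iff mu.emeasure_eq_measure
      by (smt (verit, best) ennreal_less_iff less_SUP_iff mem_Collect_eq)
  qed
  then have "\<forall>X j. \<exists>K. X \<in> sets borel \<longrightarrow> compact K \<and> K \<subseteq> X \<and> measure \<mu> X - 1 / real (Suc j) < measure \<mu> K"
    by blast
  then obtain Kc where Kc: "\<And>X j. X \<in> sets borel \<Longrightarrow> compact (Kc X j) \<and> Kc X j \<subseteq> X \<and> measure \<mu> X - 1 / real (Suc j) < measure \<mu> (Kc X j)"
    by metis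
  have Kc_borel: "Kc X j \<in> sets borel" if "X \<in> \<A>" for X j
    using Kc[of X j] that A_borel by (auto intro: borel_compact)
  \<comment> \<open>The compact sets are picked once for the mean measure and not for each \<omega>,
    so adjoining them to \<open>\<A>\<close> keeps everything countable.\<close>
  define \<G> where "\<G> = \<A> \<union> case_prod Kc ` (\<A> \<times> UNIV)"
  have cG: "countable \<G>" unfolding \<G>_def \<A>_def by (intro countable_Un countable_image countable_SIGMA countable_seq_algebra) auto
  define V where "V = from_nat_into \<G>"
  have rV: "range V = \<G>" unfolding V_def using cG A.top by (intro range_from_nat_into) (auto simp: \<G>_def)
  have V_borel: "V n \<in> sets borel" for n
    using rV A_borel Kc_borel unfolding \<G>_def by (auto 4 4 dest: equalityD1[THEN subsetD, OF _ rangeI])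
  define \<B> where "\<B> = seq_algebra V"
  have B_borel: "\<B> \<subseteq> sets borel" unfolding \<B>_def using V_borel by (intro seq_algebra_subset_sets) auto
  have algB: "algebra UNIV \<B>" unfolding \<B>_def by (rule algebra_seq_algebra)
  interpret B: algebra UNIV \<B> by fact
  have cB: "countable \<B>" unfolding \<B>_def by (rule countable_seq_algebra)
  have cA: "countable \<A>" unfolding \<A>_def by (rule countable_seq_algebra)
  have GB: "\<G> \<subseteq> \<B>" using rV generator_in_seq_algebra[of V] unfolding \<B>_def by (metis imageE subsetI)
  then have AB: "\<A> \<subseteq> \<B>" and KB: "\<And>X j. X \<in> \<A> \<Longrightarrow> Kc X j \<in> \<B>" unfolding \<G>_def by auto
  \<comment> \<open>Countably many conditions on the values of \<open>L\<close> alone, so the good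
    points form a measurable event.\<close>
  define good where "good l \<longleftrightarrow> (\<forall>X\<in>\<B>. \<forall>Y\<in>\<B>. X \<inter> Y = {} \<longrightarrow> l (X \<union> Y) = l X + l Y) \<and>
    l UNIV = 1 \<and> (\<forall>X\<in>\<A>. \<forall>i::nat. \<exists>j. l X - l (Kc X j) < 1 / real (Suc i))" for l :: "'a set \<Rightarrow> real"
  have good_ext: "\<exists>\<rho>\<in>borel_probs. \<forall>X\<in>\<A>. measure \<rho> X = L X \<omega>" if g: "good (\<lambda>X. L X \<omega>)" for \<omega>
  proof (rule content_extension[OF algA sigA algB AB])
    fix X :: "'a set" and e :: real assume X: "X \<in> \<A>" "e > 0"
    obtain i where i: "1 / real (Suc i) < e" using X(2) nat_approx_posE by blast
    obtain j where "L X \<omega> - L (Kc X j) \<omega> < 1 / real (Suc i)" using g X(1) unfolding good_def by blast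
    then show "\<exists>K\<in>\<B>. compact K \<and> K \<subseteq> X \<and> L X \<omega> - L K \<omega> < e"
      using Kc[of X j] X(1) A_borel KB i by (intro bexI[of _ "Kc X j"]) auto
  qed (use g nonneg in \<open>auto simp: good_def\<close>)
  have mB[measurable]: "L X \<in> borel_measurable M" if "X \<in> \<B>" for X using meas that B_borel by blast
  have mA[measurable]: "L X \<in> borel_measurable M" if "X \<in> \<A>" for X using meas that A_borel by blast
  have good_meas: "{\<omega>\<in>space M. good (\<lambda>X. L X \<omega>)} \<in> sets M"
    unfolding good_def
    using cA cB mB KB AB B.Un[of _ _] B.top
    by (intro sets.sets_Collect sets.sets_Collect_countable_Ball sets.sets_Collect_countable_Ex) measurable
  have add_mono: "AE \<omega> in M. L X \<omega> \<le> L Y \<omega>" if "X \<in> sets borel" "Y \<in> sets borel" "X \<subseteq> Y" for X Y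
    using add[of X "Y - X"] that
    by (auto simp: Un_absorb1 elim!: eventually_mono) (smt (verit) nonneg)
  have good_AE: "AE \<omega> in M. good (\<lambda>X. L X \<omega>)"
  proof -
    have 1: "AE \<omega> in M. \<forall>X\<in>\<B>. \<forall>Y\<in>\<B>. X \<inter> Y = {} \<longrightarrow> L (X \<union> Y) \<omega> = L X \<omega> + L Y \<omega>"
      unfolding AE_ball_countable[OF cB] by (intro ballI AE_impI add subsetD[OF B_borel])
    have 2: "AE \<omega> in M. \<forall>X\<in>\<A>. \<forall>i::nat. \<exists>j. L X \<omega> - L (Kc X j) \<omega> < 1 / real (Suc i)"
      unfolding AE_ball_countable[OF cA] AE_all_countable
    proof (intro ballI allI)
      fix X i assume X: "X \<in> \<A>"
      have Xb: "X \<in> sets borel" using X A_borel by blast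
      have Kb: "Kc X j \<in> sets borel" for j using Kc_borel[OF X] .
      define D where "D j \<omega> = L X \<omega> - L (Kc X j) \<omega>" for j \<omega>
      have Dm[measurable]: "D j \<in> borel_measurable M" for j unfolding D_def using meas[OF Xb] meas[OF Kb] by simp
      let ?N = "{\<omega>\<in>space M. \<forall>j. 1 / real (Suc i) \<le> D j \<omega>}"
      \<comment> \<open>Markov's inequality for \<open>D j\<close>, which is almost surely
        nonnegative with mean at most \<open>1 / (j + 1)\<close>. As j is arbitrary, the event that
        all \<open>D j\<close> stay above \<open>1 / (i + 1)\<close> is null.\<close>
      have "measure M ?N \<le> real (Suc i) * (1 / real (Suc j))" for j
      proof -
        have "(1 / real (Suc i)) * measure M ?N = (\<integral>\<omega>. (1 / real (Suc i)) * indicator ?N \<omega> \<partial>M)"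
          by simp
        also have "\<dots> \<le> (\<integral>\<omega>. D j \<omega> \<partial>M)"
        proof (rule integral_mono_AE)
          show "integrable M (D j)" unfolding D_def using intL[OF Xb] intL[OF Kb] by simp
          show "AE \<omega> in M. 1 / real (Suc i) * indicator ?N \<omega> \<le> D j \<omega>"
            using add_mono[OF Kb Xb, of j] Kc[OF Xb, of j]
            by (auto simp: D_def indicator_def elim!: eventually_mono)
        qed (auto simp: M.emeasure_finite less_top[symmetric])
        also have "\<dots> = measure \<mu> X - measure \<mu> (Kc X j)"
          unfolding D_def using intL[OF Xb] intL[OF Kb] int[OF Xb] int[OF Kb] by simp
        also have "\<dots> \<le> 1 / real (Suc j)" using Kc[OF Xb, of j] by simp
        finally show ?thesis by (simp add: field_simps)
      qed
      moreover have "(\<lambda>j. real (Suc i) * (1 / real (Suc j))) \<longlonglongrightarrow> real (Suc i) * 0"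
        by (intro tendsto_mult tendsto_const LIMSEQ_Suc lim_1_over_n)
      ultimately have "measure M ?N \<le> 0"
        by (intro LIMSEQ_le_const[where a="measure M ?N"]) (auto intro!: exI[of _ 0])
      then have "measure M ?N = 0" using measure_nonneg[of M ?N] by linarith
      then have "AE \<omega> in M. \<not> (\<forall>j. 1 / real (Suc i) \<le> D j \<omega>)"
        by (subst AE_iff_measurable[of ?N]) (auto simp: M.emeasure_eq_measure)
      then show "AE \<omega> in M. \<exists>j. L X \<omega> - L (Kc X j) \<omega> < 1 / real (Suc i)"
        by (auto simp: D_def not_le elim!: eventually_mono)
    qed
    from 1 one 2 show ?thesis unfolding good_def by eventually_elim auto
  qed
  \<comment> \<open>Only values of \<open>L\<close> enter the choice, so points with equal values
    receive the same measure. Off the good event any fixed probability measure will do.\<close>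
  define P where "P \<omega> = (if good (\<lambda>X. L X \<omega>)
    then SOME \<rho>. \<rho> \<in> borel_probs \<and> (\<forall>X\<in>\<A>. measure \<rho> X = L X \<omega>) else return borel undefined)" for \<omega>
  have P_good: "P \<omega> \<in> borel_probs \<and> (\<forall>X\<in>\<A>. measure (P \<omega>) X = L X \<omega>)" if "good (\<lambda>X. L X \<omega>)" for \<omega>
    unfolding P_def using that someI_ex[OF good_ext[OF that, unfolded Bex_def]] by auto
  have P_space: "P \<omega> \<in> borel_probs" for \<omega>
    using P_good[of \<omega>] by (cases "good (\<lambda>X. L X \<omega>)") (auto simp: P_def space_prob_algebra prob_space_return)
  have P_prob: "prob_space (P \<omega>)" and P_sets: "sets (P \<omega>) = sets borel" for \<omega>
    using P_space[of \<omega>] by (auto simp: space_prob_algebra)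
  have P_meas: "P \<in> measurable M (prob_algebra borel)"
  proof (rule measurable_prob_algebra_generated[OF sigA])
    show "Int_stable \<A>" by (rule Int_stable_A)
    fix X assume X: "X \<in> \<A>"
    have "emeasure (P \<omega>) X = ennreal (if good (\<lambda>X. L X \<omega>) then L X \<omega> else measure (return borel undefined) X)" for \<omega>
      using P_good[of \<omega>] X finite_measure.emeasure_eq_measure[OF prob_space.axioms(1)[OF P_prob, of \<omega>], of X]
      by (auto simp: P_def)
    then show "(\<lambda>\<omega>. emeasure (P \<omega>) X) \<in> borel_measurable M"
      using good_meas X by (simp cong: measurable_cong) measurable
  qed (use P_prob P_sets in auto)
  have nnL: "(\<integral>\<^sup>+\<omega>. ennreal (L B \<omega>) \<partial>M) = emeasure \<mu> B" if "B \<in> sets borel" for B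
    using nn_integral_eq_integral[OF intL[OF that]] nonneg int[OF that] by (simp add: mu.emeasure_eq_measure)
  have emP[measurable]: "(\<lambda>\<omega>. emeasure (P \<omega>) B) \<in> borel_measurable M" if "B \<in> sets borel" for B
    using measurable_emeasure_kernel[OF measurable_prob_algebraD[OF P_meas] that] .
  have P_AE: "AE \<omega> in M. emeasure (P \<omega>) B = ennreal (L B \<omega>)" if "B \<in> sets borel" for B
    using Int_stable_A A.space_closed that[unfolded sigA]
  proof (induction B rule: sigma_sets_induct_disjoint)
    case (basic A)
    from good_AE show ?case
    proof eventually_elim
      case (elim \<omega>)
      then show ?case using P_good[OF elim] basic
        finite_measure.emeasure_eq_measure[OF prob_space.axioms(1)[OF P_prob]] by auto
    qed
  next
    case empty
    have "AE \<omega> in M. L {} \<omega> = 0" using add[of "{}" "{}"] by (auto elim!: eventually_mono)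
    then show ?case by (auto elim!: eventually_mono)
  next
    case (compl A)
    then have A: "A \<in> sets borel" using sigA by simp
    have "AE \<omega> in M. L (A \<union> (UNIV - A)) \<omega> = L A \<omega> + L (UNIV - A) \<omega>" using A by (intro add) auto
    with compl(2) one show ?case
    proof eventually_elim
      case (elim \<omega>)
      interpret Pw: prob_space "P \<omega>" by (rule P_prob)
      have "measure (P \<omega>) (UNIV - A) = 1 - measure (P \<omega>) A"
        using Pw.prob_compl[of A] A P_sets[of \<omega>] sets_eq_imp_space_eq[OF P_sets[of \<omega>]] by simp
      moreover have "measure (P \<omega>) A = L A \<omega>"
        using elim(1) nonneg[of A \<omega>] by (simp add: Pw.emeasure_eq_measure)
      ultimately have "measure (P \<omega>) (UNIV - A) = L (UNIV - A) \<omega>" using elim(2,3) by simp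
      then show ?case by (simp add: Pw.emeasure_eq_measure)
    qed
  next
    \<comment> \<open>\<open>L\<close> is only finitely additive almost surely, which yields one
      inequality between \<open>P\<close> and \<open>L\<close> on the union. Both sides have the
      same finite integral, the \<open>\<mu>\<close>-mass of the union, so they agree almost
      surely.\<close>
    case (union A)
    have Ab: "A i \<in> sets borel" for i using union sigA by auto
    then have Ub: "(\<Union>i. A i) \<in> sets borel" by auto
    have "AE \<omega> in M. \<forall>i. emeasure (P \<omega>) (A i) = ennreal (L (A i) \<omega>)"
      using union by (simp add: AE_all_countable)
    moreover have "AE \<omega> in M. \<forall>n. (\<Sum>i<n. L (A i) \<omega>) \<le> L (\<Union>i. A i) \<omega>"
      unfolding AE_all_countable
    proof
      fix n
      have "AE \<omega> in M. L (\<Union>i<n. A i) \<omega> = (\<Sum>i<n. L (A i) \<omega>)"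
      proof (induction n)
        case 0
        then show ?case using add[of "{}" "{}"] by (auto elim!: eventually_mono)
      next
        case (Suc n)
        have "(\<Union>i<n. A i) \<inter> A n = {}"
          using union(1) by (auto simp: disjoint_family_on_def) (metis IntI empty_iff less_irrefl)
        then have "AE \<omega> in M. L ((\<Union>i<n. A i) \<union> A n) \<omega> = L (\<Union>i<n. A i) \<omega> + L (A n) \<omega>"
          using Ab by (intro add) auto
        with Suc show ?case by eventually_elim (simp add: lessThan_Suc Un_commute)
      qed
      moreover have "AE \<omega> in M. L (\<Union>i<n. A i) \<omega> \<le> L (\<Union>i. A i) \<omega>" using Ab by (intro add_mono) auto
      ultimately show "AE \<omega> in M. (\<Sum>i<n. L (A i) \<omega>) \<le> L (\<Union>i. A i) \<omega>" by eventually_elim simp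
    qed
    ultimately have le: "AE \<omega> in M. emeasure (P \<omega>) (\<Union>i. A i) \<le> ennreal (L (\<Union>i. A i) \<omega>)"
    proof eventually_elim
      case (elim \<omega>)
      have "emeasure (P \<omega>) (\<Union>i. A i) = (\<Sum>i. emeasure (P \<omega>) (A i))"
        using Ab P_sets union(1) by (intro suminf_emeasure[symmetric]) auto
      also have "\<dots> = (\<Sum>i. ennreal (L (A i) \<omega>))" using elim by simp
      also have "\<dots> \<le> ennreal (L (\<Union>i. A i) \<omega>)"
        using elim nonneg by (intro suminf_le_const) (auto simp: sum_ennreal ennreal_leI)
      finally show ?case .
    qed
    have eq: "(\<integral>\<^sup>+\<omega>. emeasure (P \<omega>) (\<Union>i. A i) \<partial>M) = (\<integral>\<^sup>+\<omega>. ennreal (L (\<Union>i. A i) \<omega>) \<partial>M)"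
    proof -
      have "(\<integral>\<^sup>+\<omega>. emeasure (P \<omega>) (\<Union>i. A i) \<partial>M) = (\<integral>\<^sup>+\<omega>. (\<Sum>i. emeasure (P \<omega>) (A i)) \<partial>M)"
        using Ab P_sets union(1) by (intro nn_integral_cong suminf_emeasure[symmetric]) auto
      also have "\<dots> = (\<Sum>i. \<integral>\<^sup>+\<omega>. emeasure (P \<omega>) (A i) \<partial>M)"
        using Ab by (intro nn_integral_suminf emP)
      also have "\<dots> = (\<Sum>i. \<integral>\<^sup>+\<omega>. ennreal (L (A i) \<omega>) \<partial>M)"
        using union by (intro suminf_cong nn_integral_cong_AE) auto
      also have "\<dots> = (\<Sum>i. emeasure \<mu> (A i))" using nnL Ab by simp
      also have "\<dots> = emeasure \<mu> (\<Union>i. A i)" using Ab sets_mu union(1) by (intro suminf_emeasure) auto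
      finally show ?thesis using nnL[OF Ub] by simp
    qed
    have "AE \<omega> in M. ennreal (L (\<Union>i. A i) \<omega>) - emeasure (P \<omega>) (\<Union>i. A i) = 0"
    proof -
      have fin: "(\<integral>\<^sup>+\<omega>. emeasure (P \<omega>) (\<Union>i. A i) \<partial>M) \<noteq> \<infinity>"
        unfolding eq nnL[OF Ub] by (simp add: mu.emeasure_finite)
      have "(\<integral>\<^sup>+\<omega>. (ennreal (L (\<Union>i. A i) \<omega>) - emeasure (P \<omega>) (\<Union>i. A i)) \<partial>M) = 0"
        using nn_integral_diff[OF _ _ fin le] Ub meas[OF Ub] eq fin by simp
      then show ?thesis using Ub meas[OF Ub] by (subst (asm) nn_integral_0_iff_AE) auto
    qed
    with le show ?case
      by eventually_elim (metis diff_eq_0_iff_ennreal ennreal_less_top antisym less_le_not_le top.not_eq_extremum)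
  qed
  have "AE \<omega> in M. measure (P \<omega>) B = L B \<omega>" if "B \<in> sets borel" for B
    using P_AE[OF that] by eventually_elim (simp add: Sigma_Algebra.measure_def nonneg)
  moreover have "P \<omega> = P \<omega>'" if eqL: "\<forall>B\<in>sets borel. L B \<omega> = L B \<omega>'" for \<omega> \<omega>'
  proof -
    have eqB: "L X \<omega> = L X \<omega>'" if "X \<in> \<B>" for X using that eqL B_borel by blast
    then have "good (\<lambda>X. L X \<omega>) = good (\<lambda>X. L X \<omega>')"
      unfolding good_def using AB KB B.Un by (simp add: subset_iff)
    moreover have "(\<forall>X\<in>\<A>. measure \<rho> X = L X \<omega>) \<longleftrightarrow> (\<forall>X\<in>\<A>. measure \<rho> X = L X \<omega>')" for \<rho>
      using eqB AB by auto
    ultimately show ?thesis unfolding P_def by simp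
  qed
  ultimately show thesis using P_meas by (intro that[of P]) simp_all
qed

section \<open>De Finetti's theorem\<close>

text \<open>The series has finite integral by monotone convergence, so it is finite almost
  everywhere. This converts summable moment bounds into almost sure convergence, in place of a
  Borel-Cantelli argument.\<close>

lemma (in finite_measure) AE_summable:
  fixes f :: "nat \<Rightarrow> 'a \<Rightarrow> real"
  assumes f: "\<And>k. integrable M (f k)" "\<And>k \<omega>. 0 \<le> f k \<omega>" "\<And>k. (\<integral>\<omega>. f k \<omega> \<partial>M) \<le> b k" and b: "summable b"
  shows "AE \<omega> in M. summable (\<lambda>k. f k \<omega>)"
proof -
  have [measurable]: "f k \<in> borel_measurable M" for k using f(1) by auto
  have int0: "0 \<le> (\<integral>\<omega>. f k \<omega> \<partial>M)" for k using f(2) by simp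
  have sm: "summable (\<lambda>k. \<integral>\<omega>. f k \<omega> \<partial>M)"
    using f(3) int0 by (intro summable_comparison_test'[OF b, of 0]) simp
  have "(\<integral>\<^sup>+\<omega>. (\<Sum>k. ennreal (f k \<omega>)) \<partial>M) = (\<Sum>k. \<integral>\<^sup>+\<omega>. ennreal (f k \<omega>) \<partial>M)"
    by (intro nn_integral_suminf) simp
  also have "\<dots> = (\<Sum>k. ennreal (\<integral>\<omega>. f k \<omega> \<partial>M))"
    using f(1,2) by (simp add: nn_integral_eq_integral)
  also have "\<dots> = ennreal (\<Sum>k. \<integral>\<omega>. f k \<omega> \<partial>M)"
    by (intro suminf_ennreal_eq summable_sums sm int0)
  finally have "(\<integral>\<^sup>+\<omega>. (\<Sum>k. ennreal (f k \<omega>)) \<partial>M) \<noteq> \<infinity>" by simp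
  then have "AE \<omega> in M. (\<Sum>k. ennreal (f k \<omega>)) \<noteq> \<infinity>"
    by (intro nn_integral_PInf_AE) simp_all
  then show ?thesis
    by eventually_elim (use f(2) in \<open>auto intro!: summable_suminf_not_top\<close>)
qed

section \<open>Empirical frequencies and their limits\<close>

definition freq :: "'a set \<Rightarrow> nat \<Rightarrow> (nat \<Rightarrow> 'a) \<Rightarrow> real" where
  "freq B n z = (\<Sum>i = 1..n. indicator B (z i)) / real n"

text \<open>The geometric subsequence makes almost sure convergence follow from second moments; the
  truncation only serves to bound the junk value of \<^const>\<open>lim\<close> on divergent sequences.\<close>

definition limfreq :: "'a set \<Rightarrow> (nat \<Rightarrow> 'a) \<Rightarrow> real" where
  "limfreq B z = max 0 (min 1 (lim (\<lambda>k. freq B (4 ^ k) z)))"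

lemma freq_nonneg: "0 \<le> freq B n z"
  unfolding freq_def by (intro divide_nonneg_nonneg sum_nonneg) simp_all

lemma freq_le_1: "freq B n z \<le> 1"
proof -
  have "(\<Sum>i = 1..n. indicator B (z i)) \<le> (\<Sum>i = 1..n. 1 :: real)" by (intro sum_mono) (simp add: indicator_def)
  then show ?thesis unfolding freq_def by (simp add: divide_le_eq)
qed

lemma limfreq_nonneg: "0 \<le> limfreq B z" and limfreq_le_1: "limfreq B z \<le> 1"
  unfolding limfreq_def by simp_all

lemma limfreqI:
  assumes "(\<lambda>k. freq B (4 ^ k) z) \<longlonglongrightarrow> l"
  shows "limfreq B z = l"
proof -
  have "0 \<le> l" using assms freq_nonneg by (intro LIMSEQ_le_const[of _ l]) auto
  moreover have "l \<le> 1" using assms freq_le_1 by (intro LIMSEQ_le_const2[of _ l]) auto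
  ultimately show ?thesis using limI[OF assms] unfolding limfreq_def by simp
qed

lemma measurable_freq [measurable]:
  assumes "B \<in> sets borel"
  shows "freq B n \<in> borel_measurable (\<Pi>\<^sub>M i\<in>{1..}. borel)"
proof -
  have "(\<lambda>z. indicator B (z i) :: real) \<in> borel_measurable (\<Pi>\<^sub>M i\<in>{1..}. borel)" if "i \<in> {1..n}" for i
    using assms that by (intro borel_measurable_indicator' measurable_component_singleton measurable_sets_borel | simp)+
  then show ?thesis unfolding freq_def by (intro borel_measurable_divide borel_measurable_sum) simp_all
qed

lemma measurable_limfreq [measurable]:
  assumes "B \<in> sets borel"
  shows "limfreq B \<in> borel_measurable (\<Pi>\<^sub>M i\<in>{1..}. borel)"
  unfolding limfreq_def using measurable_freq[OF assms] by measurable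

abbreviation swap :: "'a \<Rightarrow> 'a \<Rightarrow> 'a \<Rightarrow> 'a" where
  "swap \<equiv> Transposition.transpose"

lemma freq_transpose:
  assumes "i \<in> {1..n}" "j \<in> {1..n}"
  shows "freq B n (z \<circ> swap i j) = freq B n z"
proof -
  have "(\<Sum>l = 1..n. indicator B (z (swap i j l)) :: real) = (\<Sum>l = 1..n. indicator B (z l))"
    using permutes_swap_id[OF assms] by (intro sum.reindex_bij_betw permutes_imp_bij)
  then show ?thesis by (simp add: freq_def)
qed

text \<open>As soon as the index exceeds i and j, both frequencies sum the same terms in another
  order. The two sequences have the same tails, hence the same \<open>lim\<close> even when they
  diverge, and no exceptional set appears.\<close>

lemma limfreq_transpose:
  assumes "i \<ge> 1" "j \<ge> 1"
  shows "limfreq B (z \<circ> swap i j) = limfreq B z"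
proof -
  have "\<forall>\<^sub>F k in sequentially. freq B (4 ^ k) (z \<circ> swap i j) = freq B (4 ^ k) z"
  proof (rule eventually_sequentiallyI[of "max i j"])
    fix k assume "max i j \<le> k"
    moreover have "k \<le> 4 ^ k" using less_exp[of k] power_mono[of 2 4 k] by simp
    ultimately show "freq B (4 ^ k) (z \<circ> swap i j) = freq B (4 ^ k) z"
      using assms by (intro freq_transpose) (unfold atLeastAtMost_iff, linarith+)
  qed
  then have "((\<lambda>k. freq B (4 ^ k) (z \<circ> swap i j)) \<longlonglongrightarrow> l) \<longleftrightarrow> ((\<lambda>k. freq B (4 ^ k) z) \<longlonglongrightarrow> l)" for l
    by (rule tendsto_cong)
  then show ?thesis unfolding limfreq_def lim_def by simp
qed

section \<open>Permutation invariance and second moments\<close>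

locale exchangeable_sequence = prob_space M for M :: "'w measure" +
  fixes Z :: "nat \<Rightarrow> 'w \<Rightarrow> 'a::polish_space"
  assumes exch: "exchangeable M Z"
begin

abbreviation S :: "(nat \<Rightarrow> 'a) measure" where "S \<equiv> \<Pi>\<^sub>M i\<in>{1..}. borel"

definition path :: "'w \<Rightarrow> nat \<Rightarrow> 'a" where "path \<omega> = (\<lambda>n\<in>{1..}. Z n \<omega>)"

lemma measurable_Z: "n \<ge> 1 \<Longrightarrow> Z n \<in> borel_measurable M"
  using exch unfolding exchangeable_def by blast

lemma measurable_path [measurable]: "path \<in> measurable M S"
  unfolding path_def using measurable_Z by (intro measurable_restrict) simp

lemma path_eq: "n \<ge> 1 \<Longrightarrow> path \<omega> n = Z n \<omega>"
  by (simp add: path_def)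

lemma measurable_compose_transpose:
  assumes "i \<ge> 1" "j \<ge> 1"
  shows "(\<lambda>z. z \<circ> swap i j) \<in> measurable S S"
proof (rule measurable_PiM_single')
  fix n :: nat assume "n \<in> {1..}"
  then have "swap i j n \<in> {1..}" using assms by (auto simp: Transposition.transpose_def)
  then show "(\<lambda>z. (z \<circ> swap i j) n) \<in> borel_measurable S"
    unfolding comp_def by (rule measurable_component_singleton)
next
  show "(\<lambda>z. z \<circ> swap i j) \<in> space S \<rightarrow> (\<Pi>\<^sub>E i\<in>{1..}. space borel)"
    using assms by (auto simp: space_PiM PiE_def extensional_def Transposition.transpose_def)
qed

text \<open>Exchangeability speaks of finite blocks \<open>1..n\<close>. Laws on the sequence space
  are determined by finitely many coordinates, and n is taken large enough to cover these together
  with i and j.\<close>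

lemma distr_transpose:
  assumes ij: "i \<ge> 1" "j \<ge> 1"
  shows "distr M S (\<lambda>\<omega>. path \<omega> \<circ> swap i j) = distr M S path"
proof (rule measure_eqI_PiM_infinite)
  have mt: "(\<lambda>\<omega>. path \<omega> \<circ> swap i j) \<in> measurable M S"
    using measurable_compose[OF measurable_path measurable_compose_transpose[OF ij]] .
  show "finite_measure (distr M S (\<lambda>\<omega>. path \<omega> \<circ> swap i j))"
    using mt by (intro prob_space.finite_measure prob_space_distr)
  fix A :: "nat \<Rightarrow> 'a set" and J :: "nat set"
  assume J: "finite J" "J \<subseteq> {1..}" and A: "\<And>l. l \<in> J \<Longrightarrow> A l \<in> sets borel"
  define n where "n = Max (insert i (insert j J))"
  have n: "i \<in> {1..n}" "j \<in> {1..n}" "J \<subseteq> {1..n}"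
  proof -
    have "l \<le> n" if "l \<in> insert i (insert j J)" for l unfolding n_def using J(1) that by (intro Max_ge) simp_all
    then show "i \<in> {1..n}" "j \<in> {1..n}" "J \<subseteq> {1..n}" using ij J(2) by auto
  qed
  define X where "X = prod_emb {1..n} (\<lambda>_. borel :: 'a measure) J (Pi\<^sub>E J A)"
  have X: "X \<in> sets (\<Pi>\<^sub>M i\<in>{1..n}. borel)"
    unfolding X_def using J(1) n(3) A by (intro sets_PiM_I) auto
  have Y: "prod_emb {1..} (\<lambda>_. borel :: 'a measure) J (Pi\<^sub>E J A) \<in> sets S"
    using J A by (intro sets_PiM_I) auto
  have perm: "swap i j permutes {1..n}" using n by (intro permutes_swap_id)
  have tr1: "swap i j l \<ge> 1" if "l \<ge> 1" for l using that ij by (auto simp: Transposition.transpose_def)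
  have m1: "(\<lambda>\<omega>. \<lambda>l\<in>{1..n}. Z (\<pi> l) \<omega>) \<in> measurable M (\<Pi>\<^sub>M i\<in>{1..n}. borel)" if "\<And>l. l \<ge> 1 \<Longrightarrow> \<pi> l \<ge> 1" for \<pi>
    using that by (intro measurable_restrict measurable_Z) simp
  have vim: "(\<lambda>\<omega>. \<lambda>l\<in>{1..n}. Z (\<pi> l) \<omega>) -` X \<inter> space M = {\<omega>\<in>space M. \<forall>l\<in>J. Z (\<pi> l) \<omega> \<in> A l}" for \<pi>
    using n(3) J(2) unfolding X_def by (auto simp: prod_emb_iff PiE_iff Pi_iff subset_iff)
  have "emeasure (distr M S (\<lambda>\<omega>. path \<omega> \<circ> swap i j)) (prod_emb {1..} (\<lambda>_. borel) J (Pi\<^sub>E J A))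
      = emeasure M {\<omega>\<in>space M. \<forall>l\<in>J. Z (swap i j l) \<omega> \<in> A l}"
    unfolding emeasure_distr[OF mt Y] using J(2) tr1 measurable_space[OF mt]
    by (intro arg_cong2[where f=emeasure] refl)
      (auto simp: prod_emb_iff space_PiM PiE_iff path_def subset_iff)
  also have "\<dots> = emeasure (distr M (\<Pi>\<^sub>M i\<in>{1..n}. borel) (\<lambda>\<omega>. \<lambda>l\<in>{1..n}. Z (swap i j l) \<omega>)) X"
    using tr1 by (subst emeasure_distr[OF m1 X]) (simp_all only: vim)
  also have "\<dots> = emeasure (distr M (\<Pi>\<^sub>M i\<in>{1..n}. borel) (\<lambda>\<omega>. \<lambda>l\<in>{1..n}. Z l \<omega>)) X"
    using exch perm unfolding exchangeable_def by simp
  also have "\<dots> = emeasure M {\<omega>\<in>space M. \<forall>l\<in>J. Z l \<omega> \<in> A l}"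
    using vim[of "\<lambda>l. l"] by (subst emeasure_distr[OF m1[of "\<lambda>l. l"] X]) simp_all
  also have "\<dots> = emeasure (distr M S path) (prod_emb {1..} (\<lambda>_. borel) J (Pi\<^sub>E J A))"
    unfolding emeasure_distr[OF measurable_path Y] using J(2) measurable_space[OF measurable_path]
    by (intro arg_cong2[where f=emeasure] refl)
      (auto simp: prod_emb_iff space_PiM PiE_iff path_def subset_iff)
  finally show "emeasure (distr M S (\<lambda>\<omega>. path \<omega> \<circ> swap i j)) (prod_emb {1..} (\<lambda>_. borel) J (Pi\<^sub>E J A))
    = emeasure (distr M S path) (prod_emb {1..} (\<lambda>_. borel) J (Pi\<^sub>E J A))" .
qed simp_all

lemma integral_transpose:
  fixes f :: "(nat \<Rightarrow> 'a) \<Rightarrow> real"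
  assumes "i \<ge> 1" "j \<ge> 1" and [measurable]: "f \<in> borel_measurable S"
  shows "(\<integral>\<omega>. f (path \<omega> \<circ> swap i j) \<partial>M) = (\<integral>\<omega>. f (path \<omega>) \<partial>M)"
proof -
  have mt: "(\<lambda>\<omega>. path \<omega> \<circ> swap i j) \<in> measurable M S"
    using measurable_compose[OF measurable_path measurable_compose_transpose[OF assms(1,2)]] .
  have "(\<integral>\<omega>. f (path \<omega> \<circ> swap i j) \<partial>M) = (\<integral>z. f z \<partial>distr M S (\<lambda>\<omega>. path \<omega> \<circ> swap i j))"
    by (rule integral_distr[OF mt assms(3), symmetric])
  also have "\<dots> = (\<integral>z. f z \<partial>distr M S path)" unfolding distr_transpose[OF assms(1,2)] ..
  also have "\<dots> = (\<integral>\<omega>. f (path \<omega>) \<partial>M)" by (rule integral_distr[OF measurable_path assms(3)])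
  finally show ?thesis .
qed

abbreviation hit :: "'a set \<Rightarrow> nat \<Rightarrow> 'w \<Rightarrow> real" where "hit B n \<omega> \<equiv> indicator B (Z n \<omega>)"

lemma measurable_indicator_Z:
  assumes "B \<in> sets borel" "n \<ge> 1"
  shows "(\<lambda>\<omega>. hit B n \<omega> :: real) \<in> borel_measurable M"
  using measurable_compose[OF measurable_Z[OF assms(2)] borel_measurable_indicator[OF assms(1)]] .

lemma measurable_indicator_component:
  assumes "B \<in> sets borel" "n \<ge> 1"
  shows "(\<lambda>z. indicator B (z n) :: real) \<in> borel_measurable S"
  using assms by (intro measurable_compose[OF measurable_component_singleton borel_measurable_indicator]) simp_all

lemma expectation_one:
  assumes "B \<in> sets borel" "n \<ge> 1"
  shows "(\<integral>\<omega>. hit B n \<omega> \<partial>M) = (\<integral>\<omega>. hit B 1 \<omega> \<partial>M :: real)"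
  using integral_transpose[of n 1 "\<lambda>z. indicator B (z n)"] assms measurable_indicator_component[OF assms]
  by (simp add: path_eq)

lemma expectation_two:
  assumes B: "B \<in> sets borel" and "i \<ge> 1" "j \<ge> 1" "i \<noteq> j"
  shows "(\<integral>\<omega>. hit B i \<omega> * hit B j \<omega> \<partial>M) =
    (\<integral>\<omega>. hit B 1 \<omega> * hit B 2 \<omega> \<partial>M :: real)"
proof -
  define h where "h i j = (\<integral>\<omega>. hit B i \<omega> * hit B j \<omega> \<partial>M :: real)" for i j
  have sym: "h i j = h j i" for i j unfolding h_def by (simp add: mult.commute)
  have move: "h i j = h i' j" if "i \<ge> 1" "i' \<ge> 1" "j \<ge> 1" "j \<noteq> i" "j \<noteq> i'" for i i' j
    using integral_transpose[of i i' "\<lambda>z. indicator B (z i') * indicator B (z j)"] that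
      measurable_indicator_component[OF B]
    by (simp add: path_eq h_def)
  \<comment> \<open>A transposition may move one index only if it leaves the other fixed. The fresh
    index l, different from i, j, 1 and 2, allows the route from \<open>(i, j)\<close> over
    \<open>(i, l)\<close> and \<open>(1, l)\<close> to \<open>(1, 2)\<close>.\<close>
  define l where "l = i + j + 3"
  have l: "l \<ge> 1" "l \<noteq> i" "l \<noteq> j" "l \<noteq> 1" "l \<noteq> 2" unfolding l_def by simp_all
  have "h i j = h i l" using move[of j l i] sym l assms by simp
  also have "\<dots> = h 1 l" using move[of i 1 l] l assms by simp
  also have "\<dots> = h 1 2" using move[of l 2 1] sym l by simp
  finally show ?thesis unfolding h_def .
qed

text \<open>Exchangeable indicators have constant diagonal and constant off-diagonal second moments, so
  for weights summing to zero only the diagonal contributes.\<close>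

lemma second_moment_bound:
  fixes c :: "nat \<Rightarrow> 'w \<Rightarrow> real"
  assumes B: "B \<in> sets borel" and I: "finite I" "I \<subseteq> {1..}"
    and c_meas: "\<And>i. i \<in> I \<Longrightarrow> c i \<in> borel_measurable M"
    and c_bound: "\<And>i \<omega>. i \<in> I \<Longrightarrow> \<bar>c i \<omega>\<bar> \<le> C"
    and c_sum: "\<And>\<omega>. (\<Sum>i\<in>I. c i \<omega>) = 0"
    and indep: "\<And>i j. i \<in> I \<Longrightarrow> j \<in> I \<Longrightarrow>
      (\<integral>\<omega>. c i \<omega> * c j \<omega> * (hit B i \<omega> * hit B j \<omega>) \<partial>M) =
      (\<integral>\<omega>. c i \<omega> * c j \<omega> \<partial>M) * (\<integral>\<omega>. hit B i \<omega> * hit B j \<omega> \<partial>M)"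
  shows "(\<integral>\<omega>. (\<Sum>i\<in>I. c i \<omega> * hit B i \<omega>)\<^sup>2 \<partial>M) \<le> (\<Sum>i\<in>I. \<integral>\<omega>. (c i \<omega>)\<^sup>2 \<partial>M)"
proof -
  define \<alpha> \<beta> where "\<alpha> = (\<integral>\<omega>. hit B 1 \<omega> \<partial>M :: real)"
    and "\<beta> = (\<integral>\<omega>. hit B 1 \<omega> * hit B 2 \<omega> \<partial>M :: real)"
  have h: "(\<integral>\<omega>. hit B i \<omega> * hit B j \<omega> \<partial>M) = \<beta> + (\<alpha> - \<beta>) * of_bool (i = j)"
    if "i \<in> I" "j \<in> I" for i j
  proof (cases "i = j")
    case True
    have "(\<integral>\<omega>. hit B i \<omega> * hit B i \<omega> \<partial>M) = (\<integral>\<omega>. hit B i \<omega> \<partial>M :: real)"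
      by (intro Bochner_Integration.integral_cong refl) (simp add: indicator_def)
    then show ?thesis using expectation_one[OF B, of i] that I(2) True by (auto simp: \<alpha>_def)
  next
    case False
    then show ?thesis using expectation_two[OF B, of i j] that I(2) by (auto simp: \<beta>_def)
  qed
  have \<beta>0: "\<beta> \<ge> 0" unfolding \<beta>_def by simp
  have \<alpha>1: "\<alpha> \<le> 1" unfolding \<alpha>_def
    using measurable_indicator_Z[OF B, of 1] by (intro integral_le_const integrable_const_bound[of _ 1]) (simp_all add: indicator_def)
  have int_cc: "integrable M (\<lambda>\<omega>. c i \<omega> * c j \<omega>)" if "i \<in> I" "j \<in> I" for i j
  proof (rule integrable_const_bound[of _ "C * C"])
    show "AE \<omega> in M. norm (c i \<omega> * c j \<omega>) \<le> C * C"
      using c_bound[OF that(1)] c_bound[OF that(2)] by (intro AE_I2) (simp add: abs_mult mult_mono')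
  qed (use c_meas that in simp)
  have int_cca: "integrable M (\<lambda>\<omega>. c i \<omega> * c j \<omega> * (hit B i \<omega> * hit B j \<omega>))" if "i \<in> I" "j \<in> I" for i j
  proof (rule Bochner_Integration.integrable_bound[OF int_cc[OF that]])
    have "i \<ge> 1" "j \<ge> 1" using that I(2) by auto
    then show "(\<lambda>\<omega>. c i \<omega> * c j \<omega> * (hit B i \<omega> * hit B j \<omega>)) \<in> borel_measurable M"
      using c_meas that measurable_indicator_Z[OF B] by (intro borel_measurable_times)
    show "AE \<omega> in M. norm (c i \<omega> * c j \<omega> * (hit B i \<omega> * hit B j \<omega>)) \<le> norm (c i \<omega> * c j \<omega>)"
      by (intro AE_I2) (simp add: indicator_def)
  qed
  have "(\<integral>\<omega>. (\<Sum>i\<in>I. c i \<omega> * hit B i \<omega>)\<^sup>2 \<partial>M) =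
    (\<integral>\<omega>. (\<Sum>i\<in>I. \<Sum>j\<in>I. c i \<omega> * c j \<omega> * (hit B i \<omega> * hit B j \<omega>)) \<partial>M)"
    unfolding power2_eq_square sum_product by (simp add: mult_ac)
  also have "\<dots> = (\<Sum>i\<in>I. \<Sum>j\<in>I. \<integral>\<omega>. c i \<omega> * c j \<omega> * (hit B i \<omega> * hit B j \<omega>) \<partial>M)"
    using int_cca by (simp add: Bochner_Integration.integral_sum Bochner_Integration.integrable_sum)
  also have "\<dots> = (\<Sum>i\<in>I. \<Sum>j\<in>I. (\<integral>\<omega>. c i \<omega> * c j \<omega> \<partial>M) * (\<beta> + (\<alpha> - \<beta>) * of_bool (i = j)))"
    by (intro sum.cong refl) (simp add: indep h)
  also have "\<dots> = \<beta> * (\<Sum>i\<in>I. \<Sum>j\<in>I. \<integral>\<omega>. c i \<omega> * c j \<omega> \<partial>M) + (\<alpha> - \<beta>) * (\<Sum>i\<in>I. \<integral>\<omega>. c i \<omega> * c i \<omega> \<partial>M)"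
  proof -
    have "(\<integral>\<omega>. c i \<omega> * c j \<omega> \<partial>M) * (\<beta> + (\<alpha> - \<beta>) * of_bool (i = j)) =
      \<beta> * (\<integral>\<omega>. c i \<omega> * c j \<omega> \<partial>M) + (\<alpha> - \<beta>) * (if i = j then \<integral>\<omega>. c i \<omega> * c j \<omega> \<partial>M else 0)" for i j
      by (simp add: algebra_simps)
    then show ?thesis using I(1) by (simp add: sum.distrib sum_distrib_left[symmetric] sum.delta)
  qed
  also have "(\<Sum>i\<in>I. \<Sum>j\<in>I. \<integral>\<omega>. c i \<omega> * c j \<omega> \<partial>M) = (\<integral>\<omega>. (\<Sum>i\<in>I. c i \<omega>) * (\<Sum>j\<in>I. c j \<omega>) \<partial>M)"
    unfolding sum_product using int_cc by (simp add: Bochner_Integration.integral_sum Bochner_Integration.integrable_sum)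
  also have "\<dots> = 0" by (simp add: c_sum)
  finally have "(\<integral>\<omega>. (\<Sum>i\<in>I. c i \<omega> * hit B i \<omega>)\<^sup>2 \<partial>M) = (\<alpha> - \<beta>) * (\<Sum>i\<in>I. \<integral>\<omega>. (c i \<omega>)\<^sup>2 \<partial>M)"
    by (simp add: power2_eq_square)
  also have "\<dots> \<le> 1 * (\<Sum>i\<in>I. \<integral>\<omega>. (c i \<omega>)\<^sup>2 \<partial>M)"
    using \<alpha>1 \<beta>0 by (intro mult_right_mono sum_nonneg) simp_all
  finally show ?thesis by simp
qed

section \<open>Almost sure convergence of the empirical frequencies\<close>

lemma measurable_freq_path:
  assumes "B \<in> sets borel"
  shows "(\<lambda>\<omega>. freq B n (path \<omega>)) \<in> borel_measurable M"
  using measurable_compose[OF measurable_path measurable_freq[OF assms]] .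

lemma freq_path: "freq B n (path \<omega>) = (\<Sum>i = 1..n. (1 / real n) * hit B i \<omega>)"
  unfolding freq_def sum_divide_distrib by (intro sum.cong) (simp_all add: path_eq)

text \<open>The difference is a weighted sum of indicators whose weights, \<open>1 / m\<close> minus
  \<open>1 / n\<close> on the first n places, have total 0;
  \<open>(a - b)^2 \<le> 2 * a^2 + 2 * b^2\<close> splits their squares.\<close>

lemma freq_diff_L2:
  assumes B: "B \<in> sets borel" and n: "1 \<le> n" "n \<le> m"
  shows "(\<integral>\<omega>. (freq B m (path \<omega>) - freq B n (path \<omega>))\<^sup>2 \<partial>M) \<le> 2 / real m + 2 / real n"
proof -
  define c where "c i = 1 / real m - (if i \<le> n then 1 / real n else 0)" for i
  have restr: "(\<Sum>i = 1..m. if i \<le> n then f i else 0) = (\<Sum>i = 1..n. f i)" for f :: "nat \<Rightarrow> real"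
  proof -
    have "{1..m} \<inter> {i. i \<le> n} = {1..n}" using n by auto
    then show ?thesis by (simp add: sum.If_cases)
  qed
  have eq: "freq B m (path \<omega>) - freq B n (path \<omega>) = (\<Sum>i = 1..m. c i * hit B i \<omega>)" for \<omega>
  proof -
    have "c i * hit B i \<omega> = (1 / real m) * hit B i \<omega> - (if i \<le> n then (1 / real n) * hit B i \<omega> else 0)" for i
      by (simp add: c_def algebra_simps)
    then show ?thesis unfolding freq_path by (simp only: sum_subtractf restr)
  qed
  have csum: "(\<Sum>i = 1..m. c i) = 0"
    unfolding c_def sum_subtractf restr using n by simp
  have "(\<integral>\<omega>. (freq B m (path \<omega>) - freq B n (path \<omega>))\<^sup>2 \<partial>M) \<le> (\<Sum>i = 1..m. \<integral>\<omega>. (c i)\<^sup>2 \<partial>M)"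
    unfolding eq
  proof (rule second_moment_bound[OF B])
    show "\<bar>c i\<bar> \<le> 1" if "i \<in> {1..m}" for i
    proof -
      have "\<bar>a - (if P then b else 0)\<bar> \<le> 1" if "0 \<le> a" "a \<le> 1" "0 \<le> b" "b \<le> 1" for a b :: real and P
        using that by (simp add: abs_le_iff)
      then show ?thesis unfolding c_def using n by simp
    qed
    fix i j assume "i \<in> {1..m}" "j \<in> {1..m}"
    show "(\<integral>\<omega>. c i * c j * (hit B i \<omega> * hit B j \<omega>) \<partial>M) =
      (\<integral>\<omega>. c i * c j \<partial>M) * (\<integral>\<omega>. hit B i \<omega> * hit B j \<omega> \<partial>M)"
      by (simp add: prob_space)
  qed (use csum in simp_all)
  also have "\<dots> = (\<Sum>i = 1..m. (c i)\<^sup>2)" by (simp add: prob_space)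
  also have "\<dots> \<le> (\<Sum>i = 1..m. 2 * (1 / real m)\<^sup>2 + (if i \<le> n then 2 * (1 / real n)\<^sup>2 else 0))"
  proof (rule sum_mono)
    fix i
    have "(a - b)\<^sup>2 \<le> 2 * a\<^sup>2 + 2 * b\<^sup>2" for a b :: real using sum_squares_bound[of a "- b"] by (simp add: power2_diff)
    from this[of "1 / real m" "if i \<le> n then 1 / real n else 0"]
    show "(c i)\<^sup>2 \<le> 2 * (1 / real m)\<^sup>2 + (if i \<le> n then 2 * (1 / real n)\<^sup>2 else 0)"
      unfolding c_def by (cases "i \<le> n") simp_all
  qed
  also have "\<dots> = 2 / real m + 2 / real n"
    unfolding sum.distrib restr using n by (simp add: power2_eq_square)
  finally show ?thesis .
qed

lemma freq_convergent:
  assumes B: "B \<in> sets borel"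
  shows "AE \<omega> in M. (\<lambda>k. freq B (4 ^ k) (path \<omega>)) \<longlonglongrightarrow> limfreq B (path \<omega>)"
proof -
  define d where "d k \<omega> = freq B (4 ^ Suc k) (path \<omega>) - freq B (4 ^ k) (path \<omega>)" for k \<omega>
  have dm[measurable]: "d k \<in> borel_measurable M" for k
    unfolding d_def using measurable_freq_path[OF B] by simp
  have d1: "\<bar>d k \<omega>\<bar> \<le> 1" for k \<omega>
    using freq_nonneg[of B "4 ^ Suc k" "path \<omega>"] freq_nonneg[of B "4 ^ k" "path \<omega>"]
      freq_le_1[of B "4 ^ Suc k" "path \<omega>"] freq_le_1[of B "4 ^ k" "path \<omega>"] unfolding d_def by simp
  have id: "integrable M (\<lambda>\<omega>. \<bar>d k \<omega>\<bar>)" for k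
    using d1 by (intro integrable_const_bound[of _ 1]) simp_all
  have id2: "integrable M (\<lambda>\<omega>. (d k \<omega>)\<^sup>2)" for k
    using d1 by (intro integrable_const_bound[of _ 1]) (simp_all add: abs_square_le_1)
  have "AE \<omega> in M. summable (\<lambda>k. \<bar>d k \<omega>\<bar>)"
  proof (rule AE_summable[where b="\<lambda>k. 4 * (1/2) ^ k"])
    fix k :: nat
    \<comment> \<open>A weighted arithmetic-geometric mean inequality leads from second to first
      moments: the mean of \<open>(d k)^2\<close> is of order \<open>4 ^ -k\<close>, so with the
      factor \<open>2 ^ k\<close> both terms are of order \<open>2 ^ -k\<close>.\<close>
    have "\<bar>x\<bar> \<le> (1/2) ^ k + 2 ^ k * x\<^sup>2 / 2" for x :: real
    proof -
      have "2 * (1/2) ^ k * \<bar>x\<bar> \<le> (1/2) ^ k * (1/2) ^ k + x\<^sup>2"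
        using sum_squares_bound[of "(1/2) ^ k" "\<bar>x\<bar>"] by (simp add: power2_eq_square)
      then have "2 ^ k * (2 * (1/2) ^ k * \<bar>x\<bar>) \<le> 2 ^ k * ((1/2) ^ k * (1/2) ^ k + x\<^sup>2)" by (intro mult_left_mono) simp_all
      moreover have "2 ^ k * (1/2) ^ k = (1::real)" by (simp add: power_mult_distrib[symmetric])
      ultimately have "2 * \<bar>x\<bar> \<le> (1/2) ^ k + 2 ^ k * x\<^sup>2" by (simp add: algebra_simps power_one_over)
      moreover have "0 \<le> (1/2::real) ^ k" by simp
      ultimately show ?thesis by linarith
    qed
    then have "(\<integral>\<omega>. \<bar>d k \<omega>\<bar> \<partial>M) \<le> (\<integral>\<omega>. (1/2) ^ k + 2 ^ k * (d k \<omega>)\<^sup>2 / 2 \<partial>M)"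
      using id id2 by (intro integral_mono) simp_all
    also have "\<dots> = (1/2) ^ k + 2 ^ k * (\<integral>\<omega>. (d k \<omega>)\<^sup>2 \<partial>M) / 2" using id2 by (simp add: prob_space)
    also have "\<dots> \<le> (1/2) ^ k + 2 ^ k * (2 / real (4 ^ Suc k) + 2 / real (4 ^ k)) / 2"
      unfolding d_def by (intro add_left_mono divide_right_mono mult_left_mono freq_diff_L2 B) simp_all
    also have "\<dots> \<le> 4 * (1/2) ^ k"
    proof -
      have "(4::real) ^ k = 2 ^ k * 2 ^ k" by (simp add: power_mult_distrib[symmetric])
      then show ?thesis by (simp add: field_simps)
    qed
    finally show "(\<integral>\<omega>. \<bar>d k \<omega>\<bar> \<partial>M) \<le> 4 * (1/2) ^ k" .
  qed (use id in \<open>simp_all add: summable_geometric\<close>)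
  then show ?thesis
  proof eventually_elim
    case (elim \<omega>)
    then have "summable (\<lambda>k. d k \<omega>)" by (rule summable_rabs_cancel)
    then have "convergent (\<lambda>n. \<Sum>k<n. d k \<omega>)" by (simp add: summable_iff_convergent)
    moreover have "(\<Sum>k<n. d k \<omega>) = freq B (4 ^ n) (path \<omega>) - freq B (4 ^ 0) (path \<omega>)" for n
      unfolding d_def by (rule sum_lessThan_telescope)
    ultimately have "convergent (\<lambda>n. freq B (4 ^ n) (path \<omega>) - freq B (4 ^ 0) (path \<omega>))" by simp
    from convergent_add[OF this convergent_const[of "freq B (4 ^ 0) (path \<omega>)"]]
    have "convergent (\<lambda>n. freq B (4 ^ n) (path \<omega>))" by simp
    then obtain l where "(\<lambda>n. freq B (4 ^ n) (path \<omega>)) \<longlonglongrightarrow> l" unfolding convergent_def by blast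
    with limfreqI[OF this] show ?case by simp
  qed
qed

abbreviation mass :: "'a set \<Rightarrow> 'w \<Rightarrow> real" where "mass B \<omega> \<equiv> limfreq B (path \<omega>)"

lemma measurable_limfreq_path:
  "B \<in> sets borel \<Longrightarrow> (\<lambda>\<omega>. mass B \<omega>) \<in> borel_measurable M"
  using measurable_compose[OF measurable_path measurable_limfreq] .

lemma limfreq_additive:
  assumes A: "A \<in> sets borel" and B: "B \<in> sets borel" and disj: "A \<inter> B = {}"
  shows "AE \<omega> in M. mass (A \<union> B) \<omega> = mass A \<omega> + mass B \<omega>"
  using freq_convergent[OF A] freq_convergent[OF B]
proof eventually_elim
  case (elim \<omega>)
  have "indicator (A \<union> B) x = indicator A x + (indicator B x :: real)" for x
    using disj by (auto simp: indicator_def)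
  then have "freq (A \<union> B) n z = freq A n z + freq B n z" for n z
    by (simp add: freq_def sum.distrib add_divide_distrib)
  then show ?case using tendsto_add[OF elim] by (intro limfreqI) simp
qed

lemma limfreq_UNIV: "limfreq UNIV z = 1"
proof (rule limfreqI)
  show "(\<lambda>k. freq UNIV (4 ^ k) z) \<longlonglongrightarrow> 1" by (simp add: freq_def)
qed

text \<open>This supplies the mean measure for \<open>regular_random_measure\<close>: the expected
  limiting frequencies form the law of \<open>Z 1\<close>, a genuine measure to which inner
  regularity applies.\<close>

lemma integral_limfreq:
  assumes B: "B \<in> sets borel"
  shows "(\<integral>\<omega>. mass B \<omega> \<partial>M) = measure (distr M borel (Z 1)) B"
proof -
  have one: "(\<integral>\<omega>. freq B (4 ^ k) (path \<omega>) \<partial>M) = (\<integral>\<omega>. hit B 1 \<omega> \<partial>M)" for k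
  proof -
    have "integrable M (\<lambda>\<omega>. hit B i \<omega> :: real)" if "i \<in> {1..4 ^ k}" for i
      using measurable_indicator_Z[OF B, of i] that by (intro integrable_const_bound[of _ 1]) (simp_all add: indicator_def)
    then have "(\<integral>\<omega>. freq B (4 ^ k) (path \<omega>) \<partial>M) = (\<Sum>i = 1..4 ^ k. (1 / real (4 ^ k)) * (\<integral>\<omega>. hit B i \<omega> \<partial>M))"
      unfolding freq_path by (subst Bochner_Integration.integral_sum) simp_all
    also have "\<dots> = (\<Sum>i::nat = 1..4 ^ k. (1 / real (4 ^ k)) * (\<integral>\<omega>. hit B 1 \<omega> \<partial>M))"
      by (intro sum.cong refl arg_cong2[where f="(*)"] expectation_one B) simp
    also have "\<dots> = (\<integral>\<omega>. hit B 1 \<omega> \<partial>M)" by simp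
    finally show ?thesis .
  qed
  have "(\<lambda>k. \<integral>\<omega>. freq B (4 ^ k) (path \<omega>) \<partial>M) \<longlonglongrightarrow> (\<integral>\<omega>. mass B \<omega> \<partial>M)"
    using measurable_freq_path[OF B] measurable_limfreq_path[OF B] freq_convergent[OF B]
    by (intro integral_dominated_convergence[where w="\<lambda>_. 1"]) (simp_all add: freq_nonneg freq_le_1)
  then have "(\<integral>\<omega>. mass B \<omega> \<partial>M) = (\<integral>\<omega>. hit B 1 \<omega> \<partial>M)"
    unfolding one by (simp add: LIMSEQ_const_iff)
  also have "\<dots> = (\<integral>x. indicator B x \<partial>distr M borel (Z 1))"
    using measurable_Z[of 1] B by (intro integral_distr[symmetric]) simp_all
  also have "\<dots> = measure (distr M borel (Z 1)) B" using B by simp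
  finally show ?thesis .
qed

text \<open>A window shifted by \<open>n\<close> has the same limiting frequency. Since an invariant function does not
  distinguish the positions in the window, \<open>indicator (B (n + 1)) (z (n + 1))\<close> may be replaced by the
  window average and then by the limiting frequency.\<close>

lemma shifted_window:
  "\<bar>(\<Sum>j = n + 1..n + N. indicator B (z j)) / real N - freq B N z\<bar> \<le> real n / real N"
proof -
  have "(\<Sum>j = 1..n. indicator B (z j)) + (\<Sum>j = n + 1..n + N. indicator B (z j)) = (\<Sum>j = 1..n + N. indicator B (z j) :: real)"
    by (subst sum.ub_add_nat[symmetric]) simp_all
  moreover have "(\<Sum>j = 1..N. indicator B (z j)) + (\<Sum>j = N + 1..N + n. indicator B (z j)) = (\<Sum>j = 1..N + n. indicator B (z j) :: real)"
    by (subst sum.ub_add_nat[symmetric]) simp_all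
  moreover have "0 \<le> (\<Sum>j = a..b. indicator B (z j) :: real)" for a b by (intro sum_nonneg) simp
  moreover have "(\<Sum>j = a..b. indicator B (z j) :: real) \<le> real (Suc b - a)" for a b :: nat
  proof -
    have "(\<Sum>j = a..b. indicator B (z j) :: real) \<le> (\<Sum>j = a..b. 1)" by (intro sum_mono) (simp add: indicator_def)
    then show ?thesis by simp
  qed
  ultimately have "\<bar>(\<Sum>j = n + 1..n + N. indicator B (z j)) - (\<Sum>j = 1..N. indicator B (z j) :: real)\<bar> \<le> real n"
    by (smt (verit, best) add.commute add_diff_cancel_left' add_diff_cancel_right' plus_1_eq_Suc add_Suc_right)
  then have "\<bar>(\<Sum>j = n + 1..n + N. indicator B (z j)) - (\<Sum>j = 1..N. indicator B (z j) :: real)\<bar> / real N \<le> real n / real N"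
    by (intro divide_right_mono) simp_all
  then show ?thesis unfolding freq_def by (simp add: diff_divide_distrib[symmetric])
qed

text \<open>The last factor is treated first. Once \<open>hit C (Suc n)\<close> has become
  \<open>mass C\<close>, it is an invariant function itself and is absorbed into k, which is why the
  induction leaves k arbitrary.\<close>

lemma integral_prod_indicators:
  fixes k :: "(nat \<Rightarrow> 'a) \<Rightarrow> real"
  assumes B: "\<And>i. i \<in> {1..n} \<Longrightarrow> B i \<in> sets borel"
    and k: "k \<in> borel_measurable S" "\<And>z. \<bar>k z\<bar> \<le> 1"
    and inv: "\<And>i j z. i \<ge> 1 \<Longrightarrow> j \<ge> 1 \<Longrightarrow> z \<in> space S \<Longrightarrow> k (z \<circ> swap i j) = k z"
  shows "(\<integral>\<omega>. (\<Prod>i = 1..n. hit (B i) i \<omega>) * k (path \<omega>) \<partial>M) =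
    (\<integral>\<omega>. (\<Prod>i = 1..n. mass (B i) \<omega>) * k (path \<omega>) \<partial>M)"
  using assms
proof (induction n arbitrary: k)
  case 0
  then show ?case by simp
next
  case (Suc n)
  define C where "C = B (Suc n)"
  have C: "C \<in> sets borel" and Bn: "\<And>i. i \<in> {1..n} \<Longrightarrow> B i \<in> sets borel" using Suc.prems(1) unfolding C_def by simp_all
  note km = Suc.prems(2) and kb = Suc.prems(3) and kinv = Suc.prems(4)
  define F where "F z = (\<Prod>i = 1..n. indicator (B i) (z i) :: real)" for z :: "nat \<Rightarrow> 'a"
  have F_meas: "F \<in> borel_measurable S"
    unfolding F_def using Bn measurable_indicator_component by (intro borel_measurable_prod) simp
  have F_bound: "0 \<le> F z" "F z \<le> 1" for z
    unfolding F_def by (intro prod_nonneg prod_le_1 ballI conjI; simp add: indicator_def)+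
  have F_path: "F (path \<omega>) = (\<Prod>i = 1..n. hit (B i) i \<omega>)" for \<omega>
    unfolding F_def by (intro prod.cong refl) (simp add: path_eq)
  have Fk_bound: "\<bar>a * F z * k z\<bar> \<le> 1" if "0 \<le> a" "a \<le> 1" for a z
    using that F_bound[of z] kb[of z] by (simp add: abs_mult mult_le_one)
  define h where "h j \<omega> = hit C j \<omega> * F (path \<omega>) * k (path \<omega>)" for j \<omega>
  have path_meas: "(\<lambda>\<omega>. F (path \<omega>)) \<in> borel_measurable M" "(\<lambda>\<omega>. k (path \<omega>)) \<in> borel_measurable M"
    using measurable_compose[OF measurable_path F_meas] measurable_compose[OF measurable_path km] .
  have h_int: "integrable M (h j)" if "j \<ge> 1" for j
    unfolding h_def using Fk_bound path_meas measurable_indicator_Z[OF C that]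
    by (intro integrable_const_bound[of _ 1]) simp_all
  \<comment> \<open>Swapping \<open>n + 1\<close> with a place j in the window changes neither
    \<open>F\<close>, which reads the coordinates up to n, nor the invariant k.\<close>
  have h_eq: "(\<integral>\<omega>. h (Suc n) \<omega> \<partial>M) = (\<integral>\<omega>. h j \<omega> \<partial>M)" if "j \<ge> Suc n" for j
  proof -
    define f where "f z = indicator C (z (Suc n)) * F z * k z" for z
    have "f \<in> borel_measurable S" unfolding f_def
      using F_meas km measurable_indicator_component[OF C] by (intro borel_measurable_times) simp_all
    then have "(\<integral>\<omega>. f (path \<omega> \<circ> swap (Suc n) j) \<partial>M) = (\<integral>\<omega>. f (path \<omega>) \<partial>M)"
      using that by (intro integral_transpose) simp_all
    moreover have "f (path \<omega>) = h (Suc n) \<omega>" for \<omega> by (simp add: f_def h_def path_eq)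
    moreover have "f (path \<omega> \<circ> swap (Suc n) j) = h j \<omega>" if \<omega>: "\<omega> \<in> space M" for \<omega>
    proof -
      have "F (path \<omega> \<circ> swap (Suc n) j) = F (path \<omega>)"
        unfolding F_def using \<open>j \<ge> Suc n\<close> by (intro prod.cong refl) (simp add: Transposition.transpose_def)
      moreover have "k (path \<omega> \<circ> swap (Suc n) j) = k (path \<omega>)"
        using \<open>j \<ge> Suc n\<close> by (intro kinv measurable_space[OF measurable_path \<omega>]) simp_all
      ultimately show ?thesis using \<open>j \<ge> Suc n\<close> by (simp add: f_def h_def path_eq)
    qed
    ultimately show ?thesis by (simp cong: Bochner_Integration.integral_cong)
  qed
  define w where "w m \<omega> = (\<Sum>j = n + 1..n + 4 ^ m. indicator C (path \<omega> j)) / real (4 ^ m)" for m \<omega>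
  have w_bound: "0 \<le> w m \<omega>" "w m \<omega> \<le> 1" for m \<omega>
  proof -
    show "0 \<le> w m \<omega>" unfolding w_def by (intro divide_nonneg_nonneg sum_nonneg) simp_all
    have "(\<Sum>j = n + 1..n + 4 ^ m. indicator C (path \<omega> j)) \<le> (\<Sum>j = n + 1..n + 4 ^ m. 1 :: real)"
      by (intro sum_mono) (simp add: indicator_def)
    then show "w m \<omega> \<le> 1" unfolding w_def by simp
  qed
  have w_h: "w m \<omega> * F (path \<omega>) * k (path \<omega>) = (\<Sum>j = n + 1..n + 4 ^ m. h j \<omega>) / real (4 ^ m)" for m \<omega>
  proof -
    have "(\<Sum>j = n + 1..n + 4 ^ m. indicator C (path \<omega> j) * F (path \<omega>) * k (path \<omega>)) = (\<Sum>j = n + 1..n + 4 ^ m. h j \<omega>)"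
      by (intro sum.cong refl) (simp add: h_def path_eq)
    then show ?thesis unfolding w_def by (simp add: sum_distrib_right[symmetric])
  qed
  have w_int: "(\<integral>\<omega>. w m \<omega> * F (path \<omega>) * k (path \<omega>) \<partial>M) = (\<integral>\<omega>. h (Suc n) \<omega> \<partial>M)" for m
  proof -
    have "(\<integral>\<omega>. w m \<omega> * F (path \<omega>) * k (path \<omega>) \<partial>M) = (\<Sum>j = n + 1..n + 4 ^ m. \<integral>\<omega>. h j \<omega> \<partial>M) / real (4 ^ m)"
      unfolding w_h using h_int by (simp add: Bochner_Integration.integral_sum)
    also have "(\<Sum>j = n + 1..n + 4 ^ m. \<integral>\<omega>. h j \<omega> \<partial>M) = (\<Sum>j = n + 1..n + 4 ^ m. \<integral>\<omega>. h (Suc n) \<omega> \<partial>M)"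
      by (intro sum.cong refl h_eq[symmetric]) simp
    finally show ?thesis by simp
  qed
  have w_lim: "AE \<omega> in M. (\<lambda>m. w m \<omega>) \<longlonglongrightarrow> mass C \<omega>"
    using freq_convergent[OF C]
  proof eventually_elim
    case (elim \<omega>)
    have "(\<lambda>m. w m \<omega> - freq C (4 ^ m) (path \<omega>)) \<longlonglongrightarrow> 0"
    proof (rule Lim_null_comparison)
      show "\<forall>\<^sub>F m in sequentially. norm (w m \<omega> - freq C (4 ^ m) (path \<omega>)) \<le> real n * (1/4) ^ m"
      proof (intro always_eventually allI)
        fix m
        have "norm (w m \<omega> - freq C (4 ^ m) (path \<omega>)) \<le> real n / real (4 ^ m)"
          unfolding w_def real_norm_def by (rule shifted_window)
        also have "\<dots> = real n * (1/4) ^ m" by (simp add: power_one_over)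
        finally show "norm (w m \<omega> - freq C (4 ^ m) (path \<omega>)) \<le> real n * (1/4) ^ m" .
      qed
      show "(\<lambda>m. real n * (1/4) ^ m) \<longlonglongrightarrow> 0"
        by (intro tendsto_mult_right_zero LIMSEQ_power_zero) simp
    qed
    from tendsto_add[OF this elim] show ?case by simp
  qed
  have w_meas: "w m \<in> borel_measurable M" for m
    unfolding w_def using measurable_indicator_Z[OF C]
    by (intro borel_measurable_divide borel_measurable_sum) (simp_all add: path_eq)
  have "(\<lambda>m. \<integral>\<omega>. w m \<omega> * F (path \<omega>) * k (path \<omega>) \<partial>M) \<longlonglongrightarrow> (\<integral>\<omega>. mass C \<omega> * F (path \<omega>) * k (path \<omega>) \<partial>M)"
  proof (rule integral_dominated_convergence[where w="\<lambda>_. 1"])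
    show "AE \<omega> in M. (\<lambda>m. w m \<omega> * F (path \<omega>) * k (path \<omega>)) \<longlonglongrightarrow> mass C \<omega> * F (path \<omega>) * k (path \<omega>)"
      using w_lim by eventually_elim (intro tendsto_mult tendsto_const)
    show "AE \<omega> in M. norm (w m \<omega> * F (path \<omega>) * k (path \<omega>)) \<le> 1" for m
      using Fk_bound[OF w_bound] by simp
  qed (use path_meas w_meas measurable_limfreq_path[OF C] in simp_all)
  then have step: "(\<integral>\<omega>. h (Suc n) \<omega> \<partial>M) = (\<integral>\<omega>. mass C \<omega> * F (path \<omega>) * k (path \<omega>) \<partial>M)"
    unfolding w_int by (simp add: LIMSEQ_const_iff)
  have "(\<integral>\<omega>. (\<Prod>i = 1..Suc n. hit (B i) i \<omega>) * k (path \<omega>) \<partial>M) = (\<integral>\<omega>. h (Suc n) \<omega> \<partial>M)"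
    by (intro Bochner_Integration.integral_cong refl) (simp add: h_def F_path C_def)
  also have "\<dots> = (\<integral>\<omega>. (\<Prod>i = 1..n. hit (B i) i \<omega>) * (mass C \<omega> * k (path \<omega>)) \<partial>M)"
    unfolding step by (intro Bochner_Integration.integral_cong refl) (simp add: F_path)
  also have "\<dots> = (\<integral>\<omega>. (\<Prod>i = 1..n. mass (B i) \<omega>) * (mass C \<omega> * k (path \<omega>)) \<partial>M)"
  proof (rule Suc.IH[OF Bn])
    show "(\<lambda>z. limfreq C z * k z) \<in> borel_measurable S"
      using measurable_limfreq[OF C] km by (rule borel_measurable_times)
    show "\<bar>limfreq C z * k z\<bar> \<le> 1" for z
      using limfreq_nonneg[of C z] limfreq_le_1[of C z] kb[of z] by (simp add: abs_mult mult_le_one)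
    show "limfreq C (z \<circ> swap i j) * k (z \<circ> swap i j) = limfreq C z * k z"
      if "i \<ge> 1" "j \<ge> 1" "z \<in> space S" for i j z
      unfolding kinv[OF that] limfreq_transpose[OF that(1,2)] ..
  qed
  also have "\<dots> = (\<integral>\<omega>. (\<Prod>i = 1..Suc n. mass (B i) \<omega>) * k (path \<omega>) \<partial>M)"
    by (intro Bochner_Integration.integral_cong refl) (simp add: C_def)
  finally show ?case .
qed

text \<open>Permutations act on paths and not on the points of \<open>M\<close>, so the random
  measure is built over the law of the path and then pulled back along \<open>path\<close>.\<close>

theorem de_Finetti:
  obtains P where "P \<in> measurable M (prob_algebra borel)" "cond_iid M Z P"
    "\<forall>B\<in>sets borel. AE \<omega> in M. measure (P \<omega>) B = mass B \<omega>"
proof -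
  define N where "N = distr M S path"
  have N_prob: "prob_space N" unfolding N_def by (intro prob_space_distr measurable_path)
  have N_sets: "sets N = sets S" unfolding N_def by simp
  have AE_N: "AE z in N. Q z" if "AE \<omega> in M. Q (path \<omega>)" "{z\<in>space S. Q z} \<in> sets S" for Q
    unfolding N_def using AE_distr_iff[OF measurable_path that(2)] that(1) by blast
  have lm: "limfreq B \<in> borel_measurable N" if "B \<in> sets borel" for B
    using measurable_limfreq[OF that] measurable_cong_sets[OF N_sets refl] by blast
  have mu: "distr M borel (Z 1) \<in> borel_probs"
    using measurable_Z[of 1] by (simp add: space_prob_algebra prob_space_distr)
  have add: "AE z in N. limfreq (A \<union> B) z = limfreq A z + limfreq B z"
    if "A \<in> sets borel" "B \<in> sets borel" "A \<inter> B = {}" for A B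
  proof (rule AE_N[OF limfreq_additive[OF that]])
    show "{z \<in> space S. limfreq (A \<union> B) z = limfreq A z + limfreq B z} \<in> sets S"
      using measurable_limfreq[OF that(1)] measurable_limfreq[OF that(2)] measurable_limfreq[OF sets.Un[OF that(1,2)]]
      by measurable
  qed
  have int: "(\<integral>z. limfreq B z \<partial>N) = measure (distr M borel (Z 1)) B" if "B \<in> sets borel" for B
    unfolding N_def integral_limfreq[OF that, symmetric]
    by (rule integral_distr[OF measurable_path measurable_limfreq[OF that]])
  have one: "AE z in N. limfreq UNIV z = 1" by (simp add: limfreq_UNIV)
  obtain p where p: "p \<in> measurable N (prob_algebra borel)"
    "\<forall>B\<in>sets borel. AE z in N. measure (p z) B = limfreq B z"
    "\<forall>z z'. (\<forall>B\<in>sets borel. limfreq B z = limfreq B z') \<longrightarrow> p z = p z'"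
    by (rule regular_random_measure[OF N_prob mu lm limfreq_nonneg limfreq_le_1 add one int])
  have pS: "p \<in> measurable S (prob_algebra borel)"
    using p(1) measurable_cong_sets[OF N_sets refl] by blast
  define P where "P \<omega> = p (path \<omega>)" for \<omega>
  have P: "P \<in> measurable M (prob_algebra borel)"
    unfolding P_def using measurable_compose[OF measurable_path pS] .
  have P_AE: "AE \<omega> in M. measure (P \<omega>) B = mass B \<omega>" if "B \<in> sets borel" for B
    unfolding P_def using AE_distrD[OF measurable_path bspec[OF p(2) that, unfolded N_def]] .
  have sets_eq: "sets (prob_measures :: 'a measure measure) = sets (prob_algebra borel)" by (rule sets_prob_measures)
  have Pm: "P \<in> measurable M prob_measures"
    using P measurable_cong_sets[OF refl sets_eq] by blast
  let ?F = "vimage_algebra (space M) P prob_measures"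
  have sub: "subalgebra M ?F"
    unfolding subalgebra_def
  proof
    show "sets ?F \<subseteq> sets M"
      using measurable_sets[OF Pm] measurable_space[OF Pm] by (subst sets_vimage_algebra2) auto
  qed simp
  interpret sfs: finite_measure_subalgebra M ?F
    by (intro finite_measure_subalgebra.intro finite_measure_axioms finite_measure_subalgebra_axioms.intro sub)
  have eval: "(\<lambda>\<mu>. measure \<mu> B) \<in> borel_measurable prob_measures" if "B \<in> sets borel" for B :: "'a set"
  proof -
    have "(\<lambda>\<mu>. measure \<mu> B) \<in> borel_measurable (prob_algebra borel)"
      unfolding prob_algebra_def using that by (intro measurable_restrict_space1 measurable_measure_subprob_algebra)
    then show ?thesis using measurable_cong_sets[OF sets_eq refl] by blast
  qed
  have "cond_iid M Z P"
    unfolding cond_iid_def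
  proof (intro conjI allI impI Pm)
    fix n :: nat and B :: "nat \<Rightarrow> 'a set"
    assume B: "\<forall>i\<in>{1..n}. B i \<in> sets borel"
    define E where "E = {\<omega> \<in> space M. \<forall>i\<in>{1..n}. Z i \<omega> \<in> B i}"
    have E_ind: "indicator E \<omega> = (\<Prod>i = 1..n. hit (B i) i \<omega> :: real)" if w: "\<omega> \<in> space M" for \<omega>
    proof (cases "\<omega> \<in> E")
      case False
      with w obtain i where "i \<in> {1..n}" "Z i \<omega> \<notin> B i" unfolding E_def by blast
      then have "(\<Prod>i = 1..n. hit (B i) i \<omega> :: real) = 0" by (intro prod_zero) (auto intro!: bexI[of _ i])
      then show ?thesis using False by simp
    qed (auto simp: E_def)
    have E_meas: "E \<in> sets M"
    proof -
      have "{\<omega> \<in> space M. Z i \<omega> \<in> B i} \<in> sets M" if "i \<in> {1..n}" for i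
        using measurable_sets[OF measurable_Z[of i], of "B i"] that B by (simp add: vimage_def Int_def conj_commute)
      then show ?thesis unfolding E_def by (intro sets.sets_Collect_finite_All) simp_all
    qed
    define g where "g \<omega> = (\<Prod>i = 1..n. measure (P \<omega>) (B i))" for \<omega>
    have P_prob: "prob_space (P \<omega>)" if "\<omega> \<in> space M" for \<omega>
      using measurable_space[OF P that] by (simp add: space_prob_algebra)
    have g_F: "g \<in> borel_measurable ?F"
      unfolding g_def
    proof (intro borel_measurable_prod)
      fix i assume "i \<in> {1..n}"
      then have "B i \<in> sets borel" using B by blast
      moreover have "P \<in> measurable ?F prob_measures"
        using measurable_space[OF Pm] by (intro measurable_vimage_algebra1) auto
      ultimately show "(\<lambda>\<omega>. measure (P \<omega>) (B i)) \<in> borel_measurable ?F"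
        using measurable_compose[OF _ eval] by blast
    qed
    have g_int: "integrable M g"
    proof (rule integrable_const_bound[of _ 1])
      show "AE \<omega> in M. norm (g \<omega>) \<le> 1"
      proof (rule AE_I2)
        fix \<omega> assume "\<omega> \<in> space M"
        then interpret Pw: prob_space "P \<omega>" by (rule P_prob)
        show "norm (g \<omega>) \<le> 1" unfolding g_def
          by (simp add: abs_of_nonneg prod_nonneg prod_le_1)
      qed
      show "g \<in> borel_measurable M" using measurable_from_subalg[OF sub g_F] .
    qed
    have "AE \<omega> in M. real_cond_exp M ?F (indicator E) \<omega> = g \<omega>"
    proof (rule sfs.real_cond_exp_charact[OF _ _ g_int g_F])
      show "integrable M (indicator E :: 'w \<Rightarrow> real)" using E_meas by (simp add: emeasure_finite less_top[symmetric])
      fix A assume "A \<in> sets ?F"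
      then obtain V where V: "V \<in> sets prob_measures" "A = P -` V \<inter> space M"
        using measurable_space[OF Pm] by (subst (asm) sets_vimage_algebra2) auto
      \<comment> \<open>This writes the conditioning event A as an invariant function of the path;
        the restriction to \<open>space S\<close> is where p is known to be measurable.\<close>
      define k where "k z = (if z \<in> space S \<and> p z \<in> V then 1 else 0 :: real)" for z
      have A_ind: "indicator A \<omega> = k (path \<omega>)" if "\<omega> \<in> space M" for \<omega>
        using that measurable_space[OF measurable_path that] by (simp add: k_def V P_def indicator_def)
      have k_meas: "k \<in> borel_measurable S"
      proof -
        have "p -` V \<inter> space S \<in> sets S" using measurable_sets[OF pS] V(1) sets_eq by blast
        then have "indicator (p -` V \<inter> space S) \<in> borel_measurable S" by (rule borel_measurable_indicator)
        moreover have "k = indicator (p -` V \<inter> space S)" by (auto simp: k_def indicator_def fun_eq_iff)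
        ultimately show ?thesis by simp
      qed
      have k_inv: "k (z \<circ> swap i j) = k z" if "i \<ge> 1" "j \<ge> 1" "z \<in> space S" for i j z
      proof -
        have "p (z \<circ> swap i j) = p z" using p(3) limfreq_transpose[OF that(1,2)] by blast
        moreover have "z \<circ> swap i j \<in> space S"
          using measurable_space[OF measurable_compose_transpose[OF that(1,2)] that(3)] .
        ultimately show ?thesis using that(3) by (simp add: k_def)
      qed
      have "(\<integral>\<omega>\<in>A. indicator E \<omega> \<partial>M) = (\<integral>\<omega>. (\<Prod>i = 1..n. hit (B i) i \<omega>) * k (path \<omega>) \<partial>M)"
        unfolding set_lebesgue_integral_def
        by (intro Bochner_Integration.integral_cong refl) (simp add: A_ind E_ind)
      also have "\<dots> = (\<integral>\<omega>. (\<Prod>i = 1..n. mass (B i) \<omega>) * k (path \<omega>) \<partial>M)"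
      proof (rule integral_prod_indicators[OF _ k_meas _ k_inv])
        show "\<bar>k z\<bar> \<le> 1" for z by (simp add: k_def)
      qed (use B in blast)
      also have "\<dots> = (\<integral>\<omega>. indicator A \<omega> * g \<omega> \<partial>M)"
      proof (rule integral_cong_AE)
        have "AE \<omega> in M. \<forall>i\<in>{1..n}. measure (P \<omega>) (B i) = mass (B i) \<omega>"
          using P_AE B by (intro AE_finite_allI) simp_all
        then show "AE \<omega> in M. (\<Prod>i = 1..n. mass (B i) \<omega>) * k (path \<omega>) = indicator A \<omega> * g \<omega>"
          using AE_space
        proof eventually_elim
          case (elim \<omega>)
          have "g \<omega> = (\<Prod>i = 1..n. mass (B i) \<omega>)"
            unfolding g_def using elim(1) by (intro prod.cong refl) simp
          then show ?case using A_ind[OF elim(2)] by simp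
        qed
        have "A \<in> sets M" using V measurable_sets[OF Pm] by simp
        then show "(\<lambda>\<omega>. indicator A \<omega> * g \<omega>) \<in> borel_measurable M"
          using borel_measurable_integrable[OF g_int] by (intro borel_measurable_times borel_measurable_indicator)
        show "(\<lambda>\<omega>. (\<Prod>i = 1..n. mass (B i) \<omega>) * k (path \<omega>)) \<in> borel_measurable M"
          using measurable_compose[OF measurable_path k_meas] measurable_limfreq_path B
          by (intro borel_measurable_times borel_measurable_prod) simp_all
      qed
      also have "\<dots> = (\<integral>\<omega>\<in>A. g \<omega> \<partial>M)" unfolding set_lebesgue_integral_def by simp
      finally show "(\<integral>\<omega>\<in>A. indicator E \<omega> \<partial>M) = (\<integral>\<omega>\<in>A. g \<omega> \<partial>M)" .
    qed
    then show "AE \<omega> in M. real_cond_exp M ?F (indicator {\<omega> \<in> space M. \<forall>i\<in>{1..n}. Z i \<omega> \<in> B i}) \<omega> =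
      (\<Prod>i = 1..n. measure (P \<omega>) (B i))"
      unfolding E_def g_def .
  qed
  then show thesis using P_AE by (intro that[OF P]) simp_all
qed

end

section \<open>Uniform Dirichlet distributions\<close>

abbreviation Rn :: "nat \<Rightarrow> (nat \<Rightarrow> real) measure" where "Rn n \<equiv> \<Pi>\<^sub>M i\<in>{1..n}. borel"

abbreviation Ln :: "nat \<Rightarrow> (nat \<Rightarrow> real) measure" where "Ln n \<equiv> \<Pi>\<^sub>M i\<in>{1..<n}. lborel"

abbreviation Rinf :: "(nat \<Rightarrow> real) measure" where "Rinf \<equiv> \<Pi>\<^sub>M n\<in>{1..}. borel"

text \<open>The scaling has Jacobian \<open>c ^ card I\<close>. One coordinate is split off at a
  time, so that only the one-dimensional affine substitution and the iterated integral are
  involved.\<close>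

lemma nn_integral_PiM_lborel_scale:
  fixes c :: real
  assumes I: "finite I" and c: "c > 0" and f: "f \<in> borel_measurable (\<Pi>\<^sub>M i\<in>I. lborel)"
  shows "(\<integral>\<^sup>+x. f x \<partial>(\<Pi>\<^sub>M i\<in>I. lborel)) =
    ennreal (c ^ card I) * (\<integral>\<^sup>+x. f (\<lambda>i\<in>I. c * x i) \<partial>(\<Pi>\<^sub>M i\<in>I. lborel))"
  using I f
proof (induction I arbitrary: f)
  case empty
  show ?case by (simp add: PiM_empty nn_integral_count_space_finite)
next
  case (insert j I)
  interpret product_sigma_finite "\<lambda>_::'a. lborel :: real measure" by standard
  interpret L: sigma_finite_measure "\<Pi>\<^sub>M i\<in>I. lborel :: real measure" by (rule sigma_finite[OF insert.hyps(1)])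
  note fm[measurable] = insert.prems
  have upd: "(\<lambda>i\<in>insert j I. c * (x(j := y)) i) = (\<lambda>i\<in>I. c * x i)(j := c * y)" for x :: "'a \<Rightarrow> real" and y
    using insert.hyps by (auto simp: fun_eq_iff)
  have f_upd: "(\<lambda>x. f (x(j := y))) \<in> borel_measurable (\<Pi>\<^sub>M i\<in>I. lborel)" for y
    by (rule measurable_compose[OF measurable_fun_upd[where J=I] fm]) simp_all
  have scale_meas: "(\<lambda>x. \<lambda>i\<in>insert j I. c * x i) \<in> measurable (\<Pi>\<^sub>M i\<in>insert j I. lborel) (\<Pi>\<^sub>M i\<in>insert j I. lborel)"
    by (intro measurable_restrict) measurable
  define H where "H y = (\<integral>\<^sup>+x. f ((\<lambda>i\<in>I. c * x i)(j := y)) \<partial>(\<Pi>\<^sub>M i\<in>I. lborel))" for y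
  have H: "H \<in> borel_measurable borel"
  proof -
    have "(\<lambda>(y, x). f ((\<lambda>i\<in>I. c * x i)(j := y))) \<in> borel_measurable (lborel \<Otimes>\<^sub>M (\<Pi>\<^sub>M i\<in>I. lborel))"
      by measurable
    from L.borel_measurable_nn_integral[OF this] show ?thesis unfolding H_def by simp
  qed
  have "(\<integral>\<^sup>+x. f x \<partial>(\<Pi>\<^sub>M i\<in>insert j I. lborel)) = (\<integral>\<^sup>+y. (\<integral>\<^sup>+x. f (x(j := y)) \<partial>(\<Pi>\<^sub>M i\<in>I. lborel)) \<partial>lborel)"
    by (rule product_nn_integral_insert_rev[OF insert.hyps fm])
  also have "\<dots> = (\<integral>\<^sup>+y. ennreal (c ^ card I) * (\<integral>\<^sup>+x. f ((\<lambda>i\<in>I. c * x i)(j := y)) \<partial>(\<Pi>\<^sub>M i\<in>I. lborel)) \<partial>lborel)"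
    by (intro nn_integral_cong insert.IH[OF f_upd])
  also have "\<dots> = ennreal (c ^ card I) * (\<integral>\<^sup>+y. H y \<partial>lborel)"
    unfolding H_def[symmetric] by (intro nn_integral_cmult) (simp add: H)
  also have "\<dots> = ennreal (c ^ card I) * (ennreal c * (\<integral>\<^sup>+y. H (c * y) \<partial>lborel))"
    using nn_integral_real_affine[OF H, of c 0] c by simp
  also have "\<dots> = ennreal (c ^ card (insert j I)) * (\<integral>\<^sup>+y. H (c * y) \<partial>lborel)"
    using insert.hyps c by (simp add: ennreal_mult mult_ac)
  also have "(\<integral>\<^sup>+y. H (c * y) \<partial>lborel) =
      (\<integral>\<^sup>+x. f (\<lambda>i\<in>insert j I. c * x i) \<partial>(\<Pi>\<^sub>M i\<in>insert j I. lborel))"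
    using measurable_compose[OF scale_meas fm]
    unfolding H_def by (subst product_nn_integral_insert_rev[OF insert.hyps]) (simp_all only: upd)
  finally show ?case .
qed

section \<open>Beta and Dirichlet densities on simplices\<close>

lemma sets_dirichlet: "sets (dirichlet n \<alpha>) = sets (Rn n)"
  by (simp add: dirichlet_def)

lemma dirichlet_density_one:
  assumes "n \<ge> 1"
  shows "dirichlet_density n (\<lambda>_. 1) x =
    (if (\<forall>i\<in>{1..<n}. 0 < x i) \<and> (\<Sum>i\<in>{1..<n}. x i) < 1 then fact (n - 1) else 0)"
proof -
  have "Gamma (\<Sum>i\<in>{1..n}. 1) = (fact (n - 1) :: real)"
    using assms Gamma_fact[of "n - 1", where 'a=real] by (simp add: of_nat_diff)
  \<comment> \<open>\<open>0 powr 0\<close> is 0, so the exponent alone does not make the factors 1;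
    positivity of the coordinates is needed.\<close>
  moreover have "(\<Prod>i\<in>{1..<n}. x i powr (1 - 1)) = 1" if "\<forall>i\<in>{1..<n}. 0 < x i"
    using that by (intro prod.neutral) force
  ultimately show ?thesis unfolding dirichlet_density_def by simp
qed

text \<open>Parameter n belongs to the stick \<open>n + 1\<close>, so this is the density met when
  passing from n to \<open>n + 1\<close> weights.\<close>

lemma beta_density_one:
  assumes "n \<ge> 1"
  shows "beta_density 1 (real n) x = (if 0 < x \<and> x < 1 then real n * (1 - x) ^ (n - 1) else 0)"
proof -
  have "Gamma (1 + real n) = real n * Gamma (real n)" "Gamma (real n) > 0"
    using Gamma_plus1[of "real n"] assms nonpos_Ints_nonpos[of "real n"]
    by (auto simp: Gamma_real_pos add.commute)
  then have "Beta 1 (real n) = 1 / real n" unfolding Beta_def by simp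
  moreover have "(1 - x) powr (real n - 1) = (1 - x) ^ (n - 1)" if "x < 1"
    using that assms by (subst powr_realpow[symmetric]) (simp_all add: of_nat_diff)
  ultimately show ?thesis by (simp add: beta_density_def)
qed

definition simplex_point :: "nat \<Rightarrow> (nat \<Rightarrow> real) \<Rightarrow> nat \<Rightarrow> real" where
  "simplex_point n x = (\<lambda>i\<in>{1..n}. if i = n then 1 - (\<Sum>j\<in>{1..<n}. x j) else x i)"

text \<open>The size s is a parameter because scaling by \<open>1 - w\<close> maps the standard
  simplex onto the one of size \<open>1 - w\<close>. The n-th coordinate is implied by the total and
  does not occur.\<close>

definition open_simplex :: "nat \<Rightarrow> real \<Rightarrow> (nat \<Rightarrow> real) \<Rightarrow> bool" where
  "open_simplex n s x \<longleftrightarrow> (\<forall>i\<in>{1..<n}. 0 < x i) \<and> (\<Sum>i\<in>{1..<n}. x i) < s"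

text \<open>The effect of one step of the recursion on the vector of weights.\<close>

definition stick_extend :: "nat \<Rightarrow> (nat \<Rightarrow> real) \<Rightarrow> real \<Rightarrow> nat \<Rightarrow> real" where
  "stick_extend n x w = (\<lambda>i\<in>{1..Suc n}. if i = Suc n then w else (1 - w) * x i)"

lemma measurable_simplex_point [measurable]:
  "simplex_point n \<in> measurable (Ln n) (Rn n)"
  unfolding simplex_point_def
proof (rule measurable_restrict)
  fix i assume i: "i \<in> {1..n}"
  have s: "(\<lambda>x. \<Sum>j\<in>{1..<n}. x j) \<in> borel_measurable (Ln n)"
    by (intro borel_measurable_sum) measurable
  show "(\<lambda>x. if i = n then 1 - (\<Sum>j\<in>{1..<n}. x j) else x i) \<in> borel_measurable (Ln n)"
  proof (cases "i = n")
    case True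
    then show ?thesis using s by simp
  next
    case False
    then have "i \<in> {1..<n}" using i by simp
    from measurable_component_singleton[OF this, of "\<lambda>_. lborel :: real measure"]
    show ?thesis using False by simp
  qed
qed

lemma pred_open_simplex [measurable]:
  "Measurable.pred (Ln n) (open_simplex n s)"
  unfolding open_simplex_def by measurable

lemma pred_open_simplex_pair [measurable]:
  "Measurable.pred (lborel \<Otimes>\<^sub>M (Ln n)) (\<lambda>(w, x). open_simplex n (1 - w) x)"
  unfolding open_simplex_def by measurable

lemma dirichlet_one_eq:
  assumes "n \<ge> 1"
  shows "dirichlet n (\<lambda>_. 1) = distr (density (Ln n) (\<lambda>x. ennreal (fact (n - 1)) * indicator {x. open_simplex n 1 x} x))
    (Rn n) (simplex_point n)"
proof -
  have "ennreal (dirichlet_density n (\<lambda>_. 1) x) = ennreal (fact (n - 1)) * indicator {x. open_simplex n 1 x} x" for x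
    unfolding dirichlet_density_one[OF assms] by (simp add: open_simplex_def indicator_def)
  then show ?thesis unfolding dirichlet_def simplex_point_def[abs_def] by simp
qed

lemma nn_integral_dirichlet_one:
  assumes "n \<ge> 1" and f[measurable]: "f \<in> borel_measurable (Rn n)"
  shows "(\<integral>\<^sup>+x. f x \<partial>dirichlet n (\<lambda>_. 1)) =
    (\<integral>\<^sup>+x. ennreal (fact (n - 1)) * indicator {x. open_simplex n 1 x} x * f (simplex_point n x) \<partial>(Ln n))"
  unfolding dirichlet_one_eq[OF assms(1)]
  by (subst nn_integral_distr, measurable, subst nn_integral_density) measurable

text \<open>For fixed \<open>w\<close> the substitution \<open>u = (1 - w) x\<close> turns the standard simplex into the one of size
  \<open>1 - w\<close> and absorbs the factor \<open>(1 - w) ^ (n - 1)\<close> of the Beta density; exchanging the integrals and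
  substituting \<open>w = 1 - \<Sum>u - y\<close> then gives the uniform distribution one dimension higher.\<close>

lemma dirichlet_one_Suc:
  assumes n: "n \<ge> 1" and f: "f \<in> borel_measurable (Rn (Suc n))"
  shows "(\<integral>\<^sup>+x. f x \<partial>dirichlet (Suc n) (\<lambda>_. 1)) =
    (\<integral>\<^sup>+w. ennreal (beta_density 1 (real n) w) * (\<integral>\<^sup>+x. f (stick_extend n x w) \<partial>dirichlet n (\<lambda>_. 1)) \<partial>lborel)"
proof -
  let ?L = "Ln n"
  interpret psf: product_sigma_finite "\<lambda>_::nat. lborel :: real measure" by standard
  interpret L: sigma_finite_measure ?L by (rule psf.sigma_finite) simp
  interpret pair_sigma_finite lborel ?L ..
  \<comment> \<open>After the substitution the last coordinate is w, the first \<open>n - 1\<close>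
    are the rescaled ones, and the n-th is whatever is missing from the total 1.\<close>
  define \<psi> where "\<psi> w u = (\<lambda>i\<in>{1..Suc n}. if i = Suc n then w else if i = n then 1 - w - (\<Sum>j\<in>{1..<n}. u j) else u i)"
    for w :: real and u :: "nat \<Rightarrow> real"
  have \<psi>_meas: "(\<lambda>(w, u). \<psi> w u) \<in> measurable (lborel \<Otimes>\<^sub>M ?L) (Rn (Suc n))"
    unfolding \<psi>_def split_beta
  proof (rule measurable_restrict)
    fix i assume i: "i \<in> {1..Suc n}"
    have u: "(\<lambda>p. snd p j) \<in> borel_measurable (lborel \<Otimes>\<^sub>M ?L)" if "j \<in> {1..<n}" for j
      using measurable_compose[OF measurable_snd measurable_component_singleton[OF that, of "\<lambda>_. lborel :: real measure"]] by simp
    have w: "fst \<in> borel_measurable (lborel \<Otimes>\<^sub>M ?L)"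
      using measurable_fst[of "lborel :: real measure" ?L] by simp
    have s: "(\<lambda>p. \<Sum>j\<in>{1..<n}. snd p j) \<in> borel_measurable (lborel \<Otimes>\<^sub>M ?L)"
      by (intro borel_measurable_sum u)
    consider "i = Suc n" | "i = n" | "i \<in> {1..<n}" using i by fastforce
    then show "(\<lambda>p. if i = Suc n then fst p else if i = n then 1 - fst p - (\<Sum>j\<in>{1..<n}. snd p j) else snd p i)
      \<in> borel_measurable (lborel \<Otimes>\<^sub>M ?L)"
      by cases (use u[of i] w s in simp_all)
  qed
  define g where "g w u = ennreal (fact n) * indicator {w. 0 < w \<and> w < 1} w * indicator {u. open_simplex n (1 - w) u} u * f (\<psi> w u)"
    for w u
  have g_meas: "(\<lambda>(w, u). g w u) \<in> borel_measurable (lborel \<Otimes>\<^sub>M ?L)"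
  proof -
    have 1: "(\<lambda>p. f (case p of (w, u) \<Rightarrow> \<psi> w u)) \<in> borel_measurable (lborel \<Otimes>\<^sub>M ?L)"
      by (rule measurable_compose[OF \<psi>_meas f])
    have 2: "{p \<in> space (lborel \<Otimes>\<^sub>M ?L). open_simplex n (1 - fst p) (snd p)} \<in> sets (lborel \<Otimes>\<^sub>M ?L)"
      using pred_open_simplex_pair[of n] unfolding pred_def split_beta .
    have 3: "{p \<in> space (lborel \<Otimes>\<^sub>M ?L). 0 < fst p \<and> fst p < (1::real)} \<in> sets (lborel \<Otimes>\<^sub>M ?L)"
      using measurable_sets[OF measurable_fst, of "{0<..<1::real}" lborel ?L] by (simp add: vimage_def Int_def conj_commute)
    have "(\<lambda>p. ennreal (fact n) * indicator {p \<in> space (lborel \<Otimes>\<^sub>M ?L). 0 < fst p \<and> fst p < 1} p *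
        indicator {p \<in> space (lborel \<Otimes>\<^sub>M ?L). open_simplex n (1 - fst p) (snd p)} p * f (case p of (w, u) \<Rightarrow> \<psi> w u))
      \<in> borel_measurable (lborel \<Otimes>\<^sub>M ?L)"
      using 1 2 3 by (intro borel_measurable_times_ennreal borel_measurable_indicator borel_measurable_const)
    then show ?thesis
      by (rule measurable_cong[THEN iffD1, rotated]) (auto simp: g_def indicator_def)
  qed
  have step_w: "ennreal (beta_density 1 (real n) w) * (\<integral>\<^sup>+x. f (stick_extend n x w) \<partial>dirichlet n (\<lambda>_. 1)) =
    (\<integral>\<^sup>+u. g w u \<partial>?L)" for w
  proof (cases "0 < w \<and> w < 1")
    case False
    have "beta_density 1 (real n) w = 0" by (simp only: beta_density_one[OF n] False if_False)
    moreover have "g w u = 0" for u using False by (simp add: g_def indicator_def)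
    ultimately show ?thesis by simp
  next
    case True
    define c where "c = 1 - w"
    have c: "c > 0" using True by (simp add: c_def)
    have se: "(\<lambda>x. f (stick_extend n x w)) \<in> borel_measurable (Rn n)"
    proof (rule measurable_compose[OF _ f])
      show "(\<lambda>x. stick_extend n x w) \<in> measurable (Rn n) (Rn (Suc n))"
        unfolding stick_extend_def
      proof (rule measurable_restrict)
        fix i assume "i \<in> {1..Suc n}"
        then have "i = Suc n \<or> i \<in> {1..n}" by auto
        then show "(\<lambda>x. if i = Suc n then w else (1 - w) * x i) \<in> borel_measurable (Rn n)"
          using measurable_component_singleton[of i "{1..n}" "\<lambda>_. borel :: real measure"] by auto
      qed
    qed
    have gw: "g w \<in> borel_measurable ?L"
      using measurable_compose[OF measurable_Pair1' g_meas, of w] by simp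
    have "g w (\<lambda>i\<in>{1..<n}. c * x i) = ennreal (fact n) * (indicator {x. open_simplex n 1 x} x * f (stick_extend n (simplex_point n x) w))" for x
    proof -
      have sum: "(\<Sum>j\<in>{1..<n}. (\<lambda>i\<in>{1..<n}. c * x i) j) = c * (\<Sum>j\<in>{1..<n}. x j)"
        unfolding sum_distrib_left by (intro sum.cong) simp_all
      have "c * (\<Sum>j\<in>{1..<n}. x j) < c \<longleftrightarrow> (\<Sum>j\<in>{1..<n}. x j) < 1" using c by simp
      then have "open_simplex n (1 - w) (\<lambda>i\<in>{1..<n}. c * x i) \<longleftrightarrow> open_simplex n 1 x"
        using c unfolding open_simplex_def sum c_def[symmetric] by (simp add: zero_less_mult_iff)
      moreover have "\<psi> w (\<lambda>i\<in>{1..<n}. c * x i) = stick_extend n (simplex_point n x) w"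
        unfolding \<psi>_def stick_extend_def simplex_point_def sum
        by (rule restrict_ext) (auto simp: c_def algebra_simps)
      ultimately show ?thesis using True by (simp add: g_def indicator_def)
    qed
    then have "(\<integral>\<^sup>+u. g w u \<partial>?L) = ennreal (c ^ (n - 1)) *
      (\<integral>\<^sup>+x. ennreal (fact n) * (indicator {x. open_simplex n 1 x} x * f (stick_extend n (simplex_point n x) w)) \<partial>?L)"
      using nn_integral_PiM_lborel_scale[OF _ c gw] by simp
    also have "\<dots> = ennreal (real n * c ^ (n - 1)) *
      (\<integral>\<^sup>+x. ennreal (fact (n - 1)) * indicator {x. open_simplex n 1 x} x * f (stick_extend n (simplex_point n x) w) \<partial>?L)"
    proof -
      have "(\<lambda>x. indicator {x. open_simplex n 1 x} x * f (stick_extend n (simplex_point n x) w)) \<in> borel_measurable ?L"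
        using measurable_compose[OF measurable_simplex_point se] by measurable
      moreover have "(fact n :: real) = real n * fact (n - 1)" using n by (simp add: fact_reduce)
      ultimately show ?thesis using c
        by (simp add: nn_integral_cmult mult.assoc ennreal_mult) (simp add: mult_ac)
    qed
    also have "\<dots> = ennreal (beta_density 1 (real n) w) * (\<integral>\<^sup>+x. f (stick_extend n x w) \<partial>dirichlet n (\<lambda>_. 1))"
      unfolding nn_integral_dirichlet_one[OF n se] using True n by (simp add: beta_density_one c_def)
    finally show ?thesis ..
  qed
  have fubini: "(\<integral>\<^sup>+w. (\<integral>\<^sup>+u. g w u \<partial>?L) \<partial>lborel) = (\<integral>\<^sup>+u. (\<integral>\<^sup>+w. g w u \<partial>lborel) \<partial>?L)"
    using Fubini'[OF g_meas] by simp
  \<comment> \<open>The Dirichlet density is expressed in all coordinates but the last, while the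
    Beta variable is the last one. The reflection of w exchanges which of the coordinates n and
    \<open>n + 1\<close> is the dependent one.\<close>
  have affine: "(\<integral>\<^sup>+w. g w u \<partial>lborel) = (\<integral>\<^sup>+y. g (1 - (\<Sum>j\<in>{1..<n}. u j) - y) u \<partial>lborel)" if "u \<in> space ?L" for u
  proof -
    have "(\<lambda>w. g w u) \<in> borel_measurable borel"
      using measurable_compose[OF measurable_Pair2'[OF that] g_meas] by simp
    from nn_integral_real_affine[OF this, of "-1" "1 - (\<Sum>j\<in>{1..<n}. u j)"] show ?thesis by simp
  qed
  have sub: "g (1 - (\<Sum>j\<in>{1..<n}. u j) - y) u =
    ennreal (fact n) * indicator {x. open_simplex (Suc n) 1 x} (u(n := y)) * f (simplex_point (Suc n) (u(n := y)))" for u y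
  proof -
    define s where "s = (\<Sum>j\<in>{1..<n}. u j)"
    have ins: "{1..<Suc n} = insert n {1..<n}" using n by auto
    have sum: "(\<Sum>j\<in>{1..<Suc n}. (u(n := y)) j) = s + y"
      unfolding ins s_def by (subst sum.insert) (auto intro!: sum.cong)
    have s0: "0 \<le> s" if "\<forall>i\<in>{1..<n}. 0 < u i" unfolding s_def using that by (intro sum_nonneg) (simp add: less_imp_le)
    have "open_simplex (Suc n) 1 (u(n := y)) \<longleftrightarrow> (\<forall>i\<in>{1..<n}. 0 < u i) \<and> 0 < y \<and> s + y < 1"
      unfolding open_simplex_def sum unfolding ins by auto
    also have "\<dots> \<longleftrightarrow> 0 < 1 - s - y \<and> 1 - s - y < 1 \<and> open_simplex n (1 - (1 - s - y)) u"
      unfolding open_simplex_def s_def[symmetric] using s0 by auto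
    finally have os: "open_simplex (Suc n) 1 (u(n := y)) \<longleftrightarrow> 0 < 1 - s - y \<and> 1 - s - y < 1 \<and> open_simplex n (1 - (1 - s - y)) u" .
    have "\<psi> (1 - s - y) u = simplex_point (Suc n) (u(n := y))"
      unfolding \<psi>_def simplex_point_def sum s_def[symmetric]
      by (rule restrict_ext) auto
    then show ?thesis unfolding s_def[symmetric] g_def using os by (simp add: indicator_def)
  qed
  have "(\<integral>\<^sup>+x. f x \<partial>dirichlet (Suc n) (\<lambda>_. 1)) =
    (\<integral>\<^sup>+x. ennreal (fact n) * indicator {x. open_simplex (Suc n) 1 x} x * f (simplex_point (Suc n) x) \<partial>(Ln (Suc n)))"
    using nn_integral_dirichlet_one[OF _ f] by simp
  also have "\<dots> = (\<integral>\<^sup>+u. (\<integral>\<^sup>+y. ennreal (fact n) * indicator {x. open_simplex (Suc n) 1 x} (u(n := y)) * f (simplex_point (Suc n) (u(n := y))) \<partial>lborel) \<partial>?L)"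
  proof -
    have ins: "{1..<Suc n} = insert n {1..<n}" using n by auto
    have "(\<lambda>x. ennreal (fact n) * indicator {x. open_simplex (Suc n) 1 x} x * f (simplex_point (Suc n) x))
      \<in> borel_measurable (Ln (Suc n))"
      using measurable_compose[OF measurable_simplex_point f] by measurable
    then show ?thesis unfolding ins by (intro psf.product_nn_integral_insert) simp_all
  qed
  also have "\<dots> = (\<integral>\<^sup>+u. (\<integral>\<^sup>+w. g w u \<partial>lborel) \<partial>?L)"
    unfolding sub[symmetric] by (intro nn_integral_cong affine[symmetric])
  finally show ?thesis unfolding step_w fubini .
qed

section \<open>Beta stick breaking\<close>

definition stick_weight :: "nat \<Rightarrow> nat \<Rightarrow> (nat \<Rightarrow> real) \<Rightarrow> real" where
  "stick_weight n i v = v i * (\<Prod>j\<in>{i<..n}. 1 - v j)"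

lemma stick_weight_self: "stick_weight n n v = v n"
  by (simp add: stick_weight_def)

lemma stick_weight_Suc:
  assumes "i \<le> n"
  shows "stick_weight (Suc n) i v = (1 - v (Suc n)) * stick_weight n i v"
proof -
  have "{i<..Suc n} = insert (Suc n) {i<..n}" using assms by auto
  then show ?thesis by (simp add: stick_weight_def)
qed

text \<open>\<open>v 1 = 1\<close> spends the whole stick at the first place, so no mass of
  \<open>Q 0\<close> is left; each later step only redistributes.\<close>

lemma sum_stick_weight:
  assumes "v 1 = 1" "n \<ge> 1"
  shows "(\<Sum>i = 1..n. stick_weight n i v) = 1"
  using assms(2)
proof (induction n rule: dec_induct)
  case base
  show ?case by (simp add: stick_weight_self assms(1)[unfolded One_nat_def])
next
  case (step n)
  have "(\<Sum>i = 1..Suc n. stick_weight (Suc n) i v) = (\<Sum>i = 1..n. (1 - v (Suc n)) * stick_weight n i v) + v (Suc n)"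
    by (simp add: stick_weight_self stick_weight_Suc)
  also have "\<dots> = 1" unfolding sum_distrib_left[symmetric] step.IH by simp
  finally show ?case .
qed

lemma stick_weight_range:
  assumes "\<And>j. 0 \<le> v j" "\<And>j. v j \<le> 1"
  shows "0 \<le> stick_weight n i v" "stick_weight n i v \<le> 1"
  unfolding stick_weight_def using assms
  by (intro mult_nonneg_nonneg mult_le_one prod_nonneg prod_le_1; simp)+

lemma stick_weight_cong:
  assumes "\<And>j. j \<in> {i..n} \<Longrightarrow> v j = v' j" "i \<le> n"
  shows "stick_weight n i v = stick_weight n i v'"
  unfolding stick_weight_def using assms by (intro arg_cong2[where f="(*)"] prod.cong) simp_all

lemma measurable_stick_weight:
  assumes "{i..n} \<subseteq> I" "i \<le> n"
  shows "stick_weight n i \<in> borel_measurable (\<Pi>\<^sub>M j\<in>I. borel)"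
proof -
  have c: "(\<lambda>v. v j) \<in> borel_measurable (\<Pi>\<^sub>M j\<in>I. borel :: real measure)" if "j \<in> {i..n}" for j
    using assms(1) that by (intro measurable_component_singleton) blast
  have "(\<lambda>v. v i * (\<Prod>j\<in>{i<..n}. 1 - v j)) \<in> borel_measurable (\<Pi>\<^sub>M j\<in>I. borel :: real measure)"
    using assms(2) by (intro borel_measurable_times borel_measurable_prod borel_measurable_diff borel_measurable_const c) simp_all
  then show ?thesis unfolding stick_weight_def[abs_def] .
qed

text \<open>The bounds and \<open>V 1 = 1\<close> are required at every point, so that the weights
  form a probability vector everywhere and all moments below are integrals of bounded
  functions.\<close>

locale beta_sticks = prob_space M for M :: "'w measure" +
  fixes V :: "nat \<Rightarrow> 'w \<Rightarrow> real"
  assumes V_indep: "indep_vars (\<lambda>_. borel) V {1..}"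
    and V_nonneg: "\<And>n \<omega>. 0 \<le> V n \<omega>" and V_le_1: "\<And>n \<omega>. V n \<omega> \<le> 1"
    and V_1: "\<And>\<omega>. V 1 \<omega> = 1"
    and V_beta: "\<And>n. n \<ge> 1 \<Longrightarrow> distributed M lborel (V (Suc n)) (\<lambda>x. ennreal (beta_density 1 (real n) x))"
begin

definition weight :: "nat \<Rightarrow> nat \<Rightarrow> 'w \<Rightarrow> real" where
  "weight n i \<omega> = stick_weight n i (\<lambda>j. V j \<omega>)"

definition weights :: "nat \<Rightarrow> 'w \<Rightarrow> nat \<Rightarrow> real" where
  "weights n \<omega> = (\<lambda>i\<in>{1..n}. weight n i \<omega>)"

lemma measurable_V: "n \<ge> 1 \<Longrightarrow> V n \<in> borel_measurable M"
  using V_indep unfolding indep_vars_def by simp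

lemma weight_nonneg: "0 \<le> weight n i \<omega>" and weight_le_1: "weight n i \<omega> \<le> 1"
  unfolding weight_def using V_nonneg V_le_1 by (intro stick_weight_range; simp)+

lemma sum_weight: "n \<ge> 1 \<Longrightarrow> (\<Sum>i = 1..n. weight n i \<omega>) = 1"
  unfolding weight_def by (intro sum_stick_weight V_1)

lemma weight_Suc: "i \<le> n \<Longrightarrow> weight (Suc n) i \<omega> = (1 - V (Suc n) \<omega>) * weight n i \<omega>"
  unfolding weight_def by (rule stick_weight_Suc)

lemma weight_self: "weight n n \<omega> = V n \<omega>"
  unfolding weight_def by (rule stick_weight_self)

lemma measurable_weight: "1 \<le> i \<Longrightarrow> i \<le> n \<Longrightarrow> weight n i \<in> borel_measurable M"
  unfolding weight_def[abs_def] stick_weight_def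
  by (intro borel_measurable_times borel_measurable_prod borel_measurable_diff borel_measurable_const measurable_V) simp_all

lemma measurable_weights: "weights n \<in> measurable M (Rn n)"
  unfolding weights_def using measurable_weight by (intro measurable_restrict) simp

lemma weights_Suc: "weights (Suc n) \<omega> = stick_extend n (weights n \<omega>) (V (Suc n) \<omega>)"
  unfolding weights_def stick_extend_def
  by (rule restrict_ext) (auto simp: weight_self weight_Suc le_Suc_eq)

text \<open>The weights of level n are functions of \<open>V 1, ..., V n\<close>. The variable
  \<open>V (Suc n)\<close> is kept as a family over a one-element index set because
  \<open>indep_var\<close> wants the same value type on both sides.\<close>

lemma indep_weights_V:
  "indep_var (Rn n) (weights n) (\<Pi>\<^sub>M i\<in>{Suc n}. borel) (\<lambda>\<omega>. \<lambda>i\<in>{Suc n}. V i \<omega>)"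
proof -
  have "indep_var (Rn n) (\<lambda>\<omega>. \<lambda>i\<in>{1..n}. V i \<omega>) (\<Pi>\<^sub>M i\<in>{Suc n}. borel) (\<lambda>\<omega>. \<lambda>i\<in>{Suc n}. V i \<omega>)"
    by (rule indep_var_restrict[OF V_indep]) auto
  moreover have "(\<lambda>v. \<lambda>i\<in>{1..n}. stick_weight n i v) \<in> measurable (Rn n) (Rn n)"
    by (intro measurable_restrict measurable_stick_weight) auto
  ultimately have "indep_var (Rn n) ((\<lambda>v. \<lambda>i\<in>{1..n}. stick_weight n i v) \<circ> (\<lambda>\<omega>. \<lambda>i\<in>{1..n}. V i \<omega>))
    (\<Pi>\<^sub>M i\<in>{Suc n}. borel) (id \<circ> (\<lambda>\<omega>. \<lambda>i\<in>{Suc n}. V i \<omega>))"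
    by (rule indep_var_compose) simp
  moreover have "(\<lambda>v. \<lambda>i\<in>{1..n}. stick_weight n i v) \<circ> (\<lambda>\<omega>. \<lambda>i\<in>{1..n}. V i \<omega>) = weights n"
    unfolding comp_def weights_def weight_def
    by (intro ext restrict_ext stick_weight_cong) auto
  ultimately show ?thesis by simp
qed

lemma indep_weights_V_compose:
  assumes "f \<in> measurable (Rn n) N" "g \<in> measurable borel N'"
  shows "indep_var N (\<lambda>\<omega>. f (weights n \<omega>)) N' (\<lambda>\<omega>. g (V (Suc n) \<omega>))"
proof -
  have "(\<lambda>v. g (v (Suc n))) \<in> measurable (\<Pi>\<^sub>M i\<in>{Suc n}. borel) N'"
    by (rule measurable_compose[OF measurable_component_singleton[of "Suc n" "{Suc n}" "\<lambda>_. borel"] assms(2)]) simp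
  from indep_var_compose[OF indep_weights_V assms(1) this] show ?thesis by (simp add: comp_def)
qed

text \<open>By independence the pair of \<open>weights n\<close> and \<open>V (Suc n)\<close> has a
  product law, so the law of \<open>weights (Suc n)\<close> is exactly the mixture over the Beta
  variable that \<open>dirichlet_one_Suc\<close> evaluates.\<close>

lemma distr_weights:
  assumes "n \<ge> 1"
  shows "distr M (Rn n) (weights n) = dirichlet n (\<lambda>_. 1)"
  using assms
proof (induction n rule: dec_induct)
  case base
  show ?case
  proof (rule measure_eqI)
    fix A assume "A \<in> sets (distr M (Rn 1) (weights 1))"
    then have A: "A \<in> sets (Rn 1)" by simp
    \<comment> \<open>For n = 1 the Lebesgue factor runs over the empty index set, so both laws are
      the point mass at the vector with the single entry 1.\<close>
    define e :: "nat \<Rightarrow> real" where "e = (\<lambda>i\<in>{1..1}. 1)"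
    have w: "weights 1 \<omega> = e" for \<omega>
      unfolding weights_def e_def by (rule restrict_ext) (simp add: weight_self V_1[unfolded One_nat_def])
    have s: "simplex_point 1 x = e" for x
      unfolding simplex_point_def e_def by (rule restrict_ext) simp
    have os: "open_simplex 1 1 x" for x by (simp add: open_simplex_def)
    have "emeasure (dirichlet 1 (\<lambda>_. 1)) A = (\<integral>\<^sup>+x. indicator A x \<partial>dirichlet 1 (\<lambda>_. 1))"
      using A by (intro nn_integral_indicator[symmetric]) (simp add: sets_dirichlet)
    also have "\<dots> = (\<integral>\<^sup>+x. indicator A e \<partial>(\<Pi>\<^sub>M i\<in>{1..<1::nat}. lborel :: real measure))"
      using A by (subst nn_integral_dirichlet_one) (simp_all add: s[unfolded One_nat_def] os[unfolded One_nat_def])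
    also have "\<dots> = indicator A e" by (simp add: PiM_empty)
    finally have "emeasure (dirichlet 1 (\<lambda>_. 1)) A = indicator A e" .
    moreover have "emeasure (distr M (Rn 1) (weights 1)) A = indicator A e"
      unfolding emeasure_distr[OF measurable_weights A] vimage_def w by (simp add: indicator_def emeasure_space_1)
    ultimately show "emeasure (distr M (Rn 1) (weights 1)) A = emeasure (dirichlet 1 (\<lambda>_. 1)) A" by simp
  qed (simp add: sets_dirichlet)
next
  case (step n)
  let ?D = "Rn n" and ?E = "Rn (Suc n)"
  show ?case
  proof (rule measure_eqI)
    fix A assume "A \<in> sets (distr M ?E (weights (Suc n)))"
    then have A: "A \<in> sets ?E" by simp
    then have ind: "indicator A \<in> borel_measurable ?E" by (rule borel_measurable_indicator)
    have ext: "(\<lambda>(x, w). stick_extend n x w) \<in> measurable (?D \<Otimes>\<^sub>M borel) ?E"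
      unfolding stick_extend_def split_beta
    proof (rule measurable_restrict)
      fix i assume "i \<in> {1..Suc n}"
      then consider "i = Suc n" | "i \<noteq> Suc n" "i \<in> {1..n}" by fastforce
      then show "(\<lambda>p. if i = Suc n then snd p else (1 - snd p) * fst p i) \<in> borel_measurable (?D \<Otimes>\<^sub>M borel)"
      proof cases
        case 2
        have "(\<lambda>p. fst p i) \<in> borel_measurable (?D \<Otimes>\<^sub>M (borel :: real measure))"
          by (rule measurable_compose[OF measurable_fst measurable_component_singleton[OF 2(2)]])
        then show ?thesis using 2(1) by simp
      qed simp
    qed
    have h: "(\<lambda>p. indicator A (case p of (x, w) \<Rightarrow> stick_extend n x w) :: ennreal) \<in> borel_measurable (?D \<Otimes>\<^sub>M borel)"
      by (rule measurable_compose[OF ext ind])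
    let ?S = "\<Pi>\<^sub>M i\<in>{Suc n}. borel :: real measure"
    define R where "R \<omega> = (\<lambda>i\<in>{Suc n}. V i \<omega>)" for \<omega>
    have R: "R \<in> measurable M ?S" unfolding R_def using measurable_V by (intro measurable_restrict) simp
    have R_Suc: "R \<omega> (Suc n) = V (Suc n) \<omega>" for \<omega> by (simp add: R_def)
    have comp: "(\<lambda>v. v (Suc n)) \<in> borel_measurable ?S" by (rule measurable_component_singleton) simp
    define F where "F w = (\<integral>\<^sup>+x. indicator A (stick_extend n x w) \<partial>distr M ?D (weights n))" for w
    have joint: "distr M ?D (weights n) \<Otimes>\<^sub>M distr M ?S R = distr M (?D \<Otimes>\<^sub>M ?S) (\<lambda>\<omega>. (weights n \<omega>, R \<omega>))"
      using indep_weights_V[of n] unfolding R_def indep_var_distribution_eq by blast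
    interpret D: prob_space "distr M ?D (weights n)" by (rule prob_space_distr[OF measurable_weights])
    interpret R: prob_space "distr M ?S R" by (rule prob_space_distr[OF R])
    interpret pair_sigma_finite "distr M ?D (weights n)" "distr M ?S R" ..
    have F: "F \<in> borel_measurable borel"
      unfolding F_def
    proof (rule D.borel_measurable_nn_integral)
      have "(\<lambda>p. (snd p, fst p)) \<in> measurable (borel \<Otimes>\<^sub>M distr M ?D (weights n)) (?D \<Otimes>\<^sub>M (borel :: real measure))"
        using measurable_pair_swap'[of "borel :: real measure" ?D] by (simp add: split_beta' cong: measurable_cong_sets)
      from measurable_compose[OF this h]
      show "(\<lambda>(w, x). indicator A (stick_extend n x w) :: ennreal) \<in> borel_measurable (borel \<Otimes>\<^sub>M distr M ?D (weights n))"
        by (simp add: split_beta')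
    qed
    have h': "(\<lambda>p. indicator A (stick_extend n (fst p) (snd p (Suc n))) :: ennreal) \<in> borel_measurable (?D \<Otimes>\<^sub>M ?S)"
    proof -
      have "(\<lambda>p. (fst p, snd p (Suc n))) \<in> measurable (?D \<Otimes>\<^sub>M ?S) (?D \<Otimes>\<^sub>M borel)"
        by (intro measurable_Pair measurable_fst measurable_compose[OF measurable_snd comp])
      from measurable_compose[OF this h] show ?thesis by simp
    qed
    have "emeasure (distr M ?E (weights (Suc n))) A = (\<integral>\<^sup>+x. indicator A x \<partial>distr M ?E (weights (Suc n)))"
      using A by simp
    also have "\<dots> = (\<integral>\<^sup>+\<omega>. indicator A (weights (Suc n) \<omega>) \<partial>M)"
      by (rule nn_integral_distr[OF measurable_weights]) (use ind in simp)
    also have "\<dots> = (\<integral>\<^sup>+\<omega>. indicator A (stick_extend n (fst (weights n \<omega>, R \<omega>)) (snd (weights n \<omega>, R \<omega>) (Suc n))) \<partial>M)"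
      by (simp add: weights_Suc R_Suc)
    also have "\<dots> = (\<integral>\<^sup>+p. indicator A (stick_extend n (fst p) (snd p (Suc n))) \<partial>distr M (?D \<Otimes>\<^sub>M ?S) (\<lambda>\<omega>. (weights n \<omega>, R \<omega>)))"
      by (rule nn_integral_distr[symmetric, OF measurable_Pair[OF measurable_weights R]]) (use h' in simp)
    also have "\<dots> = (\<integral>\<^sup>+v. (\<integral>\<^sup>+x. indicator A (stick_extend n x (v (Suc n))) \<partial>distr M ?D (weights n)) \<partial>distr M ?S R)"
    proof -
      have "(\<lambda>p. indicator A (stick_extend n (fst p) (snd p (Suc n))) :: ennreal)
        \<in> borel_measurable (distr M ?D (weights n) \<Otimes>\<^sub>M distr M ?S R)"
        using h' by (simp cong: measurable_cong_sets)
      from nn_integral_snd[OF this] show ?thesis unfolding joint by simp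
    qed
    also have "\<dots> = (\<integral>\<^sup>+v. F (v (Suc n)) \<partial>distr M ?S R)" unfolding F_def ..
    also have "\<dots> = (\<integral>\<^sup>+\<omega>. F (V (Suc n) \<omega>) \<partial>M)"
      unfolding R_Suc[symmetric] by (rule nn_integral_distr[OF R]) (use measurable_compose[OF comp F] in simp)
    also have "\<dots> = (\<integral>\<^sup>+w. ennreal (beta_density 1 (real n) w) * F w \<partial>lborel)"
      by (rule distributed_nn_integral[OF V_beta[OF step.hyps(1)], symmetric]) (use F in simp)
    also have "\<dots> = (\<integral>\<^sup>+x. indicator A x \<partial>dirichlet (Suc n) (\<lambda>_. 1))"
      unfolding F_def step.IH by (rule dirichlet_one_Suc[OF step.hyps(1) ind, symmetric])
    also have "\<dots> = emeasure (dirichlet (Suc n) (\<lambda>_. 1)) A"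
      using A by (intro nn_integral_indicator) (simp add: sets_dirichlet)
    finally show "emeasure (distr M ?E (weights (Suc n))) A = emeasure (dirichlet (Suc n) (\<lambda>_. 1)) A" .
  qed (simp add: sets_dirichlet)
qed

text \<open>Multiplying the density of parameter \<open>n\<close> by \<open>(1 - x) ^ k\<close> gives, up to a constant, the density of
  parameter \<open>n + k\<close>, which is normalised because it is the density of \<open>V (n + k + 1)\<close>.\<close>

lemma moment_one_minus_V:
  assumes n: "n \<ge> 1"
  shows "(\<integral>\<omega>. (1 - V (Suc n) \<omega>) ^ k \<partial>M) = real n / real (n + k)"
proof -
  have norm: "(\<integral>\<^sup>+x. ennreal (beta_density 1 (real m) x) \<partial>lborel) = 1" if "m \<ge> 1" for m
    using distributed_nn_integral[OF V_beta[OF that], of "\<lambda>_. 1"] by (simp add: emeasure_space_1)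
  have nn: "0 \<le> (1 - V (Suc n) \<omega>) ^ k" "(1 - V (Suc n) \<omega>) ^ k \<le> 1" for \<omega>
    using V_nonneg[of "Suc n" \<omega>] V_le_1[of "Suc n" \<omega>] by (simp_all add: power_le_one)
  have int: "integrable M (\<lambda>\<omega>. (1 - V (Suc n) \<omega>) ^ k)"
    using measurable_V[of "Suc n"] nn by (intro integrable_const_bound[of _ 1]) simp_all
  have "ennreal (\<integral>\<omega>. (1 - V (Suc n) \<omega>) ^ k \<partial>M) = (\<integral>\<^sup>+\<omega>. ennreal ((1 - V (Suc n) \<omega>) ^ k) \<partial>M)"
    using nn_integral_eq_integral[OF int] nn by simp
  also have "\<dots> = (\<integral>\<^sup>+x. ennreal (beta_density 1 (real n) x) * ennreal ((1 - x) ^ k) \<partial>lborel)"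
    by (rule distributed_nn_integral[OF V_beta[OF n], symmetric]) simp
  also have "\<dots> = (\<integral>\<^sup>+x. ennreal (real n / real (n + k)) * ennreal (beta_density 1 (real (n + k)) x) \<partial>lborel)"
  proof (rule nn_integral_cong)
    fix x :: real
    have nk: "n + k \<ge> 1" using n by simp
    show "ennreal (beta_density 1 (real n) x) * ennreal ((1 - x) ^ k) =
      ennreal (real n / real (n + k)) * ennreal (beta_density 1 (real (n + k)) x)"
    proof (cases "0 < x \<and> x < 1")
      case True
      have "(1 - x) ^ (n - 1) * (1 - x) ^ k = (1 - x) ^ (n + k - 1)"
        using n by (simp add: power_add[symmetric])
      then have "beta_density 1 (real n) x * (1 - x) ^ k = real n / real (n + k) * beta_density 1 (real (n + k)) x"
        unfolding beta_density_one[OF n] beta_density_one[OF nk] using True n by simp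
      moreover have "0 \<le> beta_density 1 (real n) x" "0 \<le> (1 - x) ^ k" "0 \<le> beta_density 1 (real (n + k)) x"
        unfolding beta_density_one[OF n] beta_density_one[OF nk] using True by simp_all
      ultimately show ?thesis by (simp only: ennreal_mult[symmetric] divide_nonneg_nonneg of_nat_0_le_iff)
    next
      case False
      then have "beta_density 1 (real n) x = 0" "beta_density 1 (real (n + k)) x = 0"
        by (simp_all only: beta_density_one[OF n] beta_density_one[OF nk] if_False)
      then show ?thesis by simp
    qed
  qed
  also have "\<dots> = ennreal (real n / real (n + k))"
    using distributed_borel_measurable[OF V_beta[of "n + k"]] n norm[of "n + k"] by (subst nn_integral_cmult) simp_all
  finally show ?thesis using nn by (subst (asm) ennreal_inj) simp_all
qed

text \<open>Expanding the square in powers of \<open>1 - V\<close> leaves the moments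
  \<open>n / (n + k)\<close> for k = 1 and k = 2.\<close>

lemma second_moment_V:
  assumes n: "n \<ge> 1"
  shows "(\<integral>\<omega>. (V (Suc n) \<omega>)\<^sup>2 \<partial>M) = 2 / (real (n + 1) * real (n + 2))"
proof -
  have int: "integrable M (\<lambda>\<omega>. (1 - V (Suc n) \<omega>) ^ k)" for k
    using measurable_V[of "Suc n"] V_nonneg[of "Suc n"] V_le_1[of "Suc n"]
    by (intro integrable_const_bound[of _ 1]) (simp_all add: power_le_one)
  have "(\<integral>\<omega>. (V (Suc n) \<omega>)\<^sup>2 \<partial>M) = (\<integral>\<omega>. 1 - 2 * (1 - V (Suc n) \<omega>) ^ 1 + (1 - V (Suc n) \<omega>) ^ 2 \<partial>M)"
    by (intro Bochner_Integration.integral_cong refl) (simp add: power2_eq_square algebra_simps)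
  also have "\<dots> = 1 - 2 * (\<integral>\<omega>. (1 - V (Suc n) \<omega>) ^ 1 \<partial>M) + (\<integral>\<omega>. (1 - V (Suc n) \<omega>) ^ 2 \<partial>M)"
    using Bochner_Integration.integrable_diff[OF integrable_const[of 1] Bochner_Integration.integrable_mult_right[OF int[of 1], of 2]] int
    by (subst Bochner_Integration.integral_add, simp, simp, subst Bochner_Integration.integral_diff) (simp_all only: integral_mult_right_zero prob_space lebesgue_integral_const integrable_const integrable_mult_right int scaleR_one)
  also have "\<dots> = 2 / (real (n + 1) * real (n + 2))"
    unfolding moment_one_minus_V[OF n] by (simp add: field_simps)
  finally show ?thesis .
qed

text \<open>With \<open>s n\<close> for the sum, independence of the new stick gives
  \<open>s (n + 1) = n / (n + 2) * s n + 2 / ((n + 1) * (n + 2))\<close>, and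
  \<open>2 / (n + 1)\<close> solves this recursion with \<open>s 1 = 1\<close>.\<close>

lemma sum_second_moment_weight:
  assumes "n \<ge> 1"
  shows "(\<Sum>i = 1..n. \<integral>\<omega>. (weight n i \<omega>)\<^sup>2 \<partial>M) = 2 / real (n + 1)"
  using assms
proof (induction n rule: dec_induct)
  case base
  show ?case by (simp add: weight_self V_1[unfolded One_nat_def] prob_space)
next
  case (step n)
  have "(\<integral>\<omega>. (weight (Suc n) i \<omega>)\<^sup>2 \<partial>M) = real n / real (n + 2) * (\<integral>\<omega>. (weight n i \<omega>)\<^sup>2 \<partial>M)" if i: "i \<in> {1..n}" for i
  proof -
    have "indep_var borel (\<lambda>\<omega>. (weights n \<omega> i)\<^sup>2) borel (\<lambda>\<omega>. (1 - V (Suc n) \<omega>)\<^sup>2)"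
      using i by (intro indep_weights_V_compose borel_measurable_power measurable_component_singleton) simp_all
    then have "indep_var borel (\<lambda>\<omega>. (weight n i \<omega>)\<^sup>2) borel (\<lambda>\<omega>. (1 - V (Suc n) \<omega>)\<^sup>2)"
      using i by (simp add: weights_def)
    moreover have "integrable M (\<lambda>\<omega>. (weight n i \<omega>)\<^sup>2)"
      using measurable_weight[of i n] i weight_nonneg[of n i] weight_le_1[of n i]
      by (intro integrable_const_bound[of _ 1]) (simp_all add: power_le_one)
    moreover have "integrable M (\<lambda>\<omega>. (1 - V (Suc n) \<omega>)\<^sup>2)"
      using measurable_V[of "Suc n"] V_nonneg[of "Suc n"] V_le_1[of "Suc n"]
      by (intro integrable_const_bound[of _ 1]) (simp_all add: power_le_one)
    ultimately have "(\<integral>\<omega>. (weight n i \<omega>)\<^sup>2 * (1 - V (Suc n) \<omega>)\<^sup>2 \<partial>M) = (\<integral>\<omega>. (weight n i \<omega>)\<^sup>2 \<partial>M) * (\<integral>\<omega>. (1 - V (Suc n) \<omega>)\<^sup>2 \<partial>M)"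
      by (rule indep_var_lebesgue_integral)
    then show ?thesis
      unfolding moment_one_minus_V[OF step.hyps(1)] using i by (simp add: weight_Suc power_mult_distrib mult.commute)
  qed
  then have "(\<Sum>i = 1..Suc n. \<integral>\<omega>. (weight (Suc n) i \<omega>)\<^sup>2 \<partial>M) =
    (\<Sum>i = 1..n. real n / real (n + 2) * (\<integral>\<omega>. (weight n i \<omega>)\<^sup>2 \<partial>M)) + (\<integral>\<omega>. (V (Suc n) \<omega>)\<^sup>2 \<partial>M)"
    by (simp add: weight_self)
  also have "\<dots> = real n / real (n + 2) * (2 / real (n + 1)) + 2 / (real (n + 1) * real (n + 2))"
    unfolding sum_distrib_left[symmetric] step.IH second_moment_V[OF step.hyps(1)] ..
  also have "\<dots> = (2 * (real n + 1)) / ((real n + 1) * (real n + 2))"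
    by (simp add: add_divide_distrib[symmetric] algebra_simps)
  also have "\<dots> = 2 / real (Suc n + 1)"
    using nonzero_mult_divide_mult_cancel_left[of "real n + 1" 2 "real n + 2"] by (simp add: mult_ac)
  finally show ?case .
qed
end

section \<open>Convergence of the weighted frequencies\<close>

lemma (in prob_space) indep_rand_elems_compose:
  assumes ind: "indep_rand_elems M N X N' Y" and f: "f \<in> measurable N S" and g: "g \<in> measurable N' S'"
  shows "indep_rand_elems M S (\<lambda>\<omega>. f (X \<omega>)) S' (\<lambda>\<omega>. g (Y \<omega>))"
proof -
  have X: "X \<in> measurable M N" and Y: "Y \<in> measurable M N'"
    and set: "indep_set {X -` A \<inter> space M | A. A \<in> sets N} {Y -` B \<inter> space M | B. B \<in> sets N'}"
    using ind unfolding indep_rand_elems_def by auto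
  have pull: "{(\<lambda>\<omega>. h (U \<omega>)) -` A \<inter> space M | A. A \<in> sets T} \<subseteq> {U -` A \<inter> space M | A. A \<in> sets T'}"
    if "U \<in> measurable M T'" "h \<in> measurable T' T" for U T' h T
  proof safe
    fix A assume "A \<in> sets T"
    then have "h -` A \<inter> space T' \<in> sets T'" using that(2) by (rule measurable_sets[rotated])
    moreover have "(\<lambda>\<omega>. h (U \<omega>)) -` A \<inter> space M = U -` (h -` A \<inter> space T') \<inter> space M"
      using measurable_space[OF that(1)] by auto
    ultimately show "\<exists>A'. (\<lambda>\<omega>. h (U \<omega>)) -` A \<inter> space M = U -` A' \<inter> space M \<and> A' \<in> sets T'" by blast
  qed
  have "indep_set {(\<lambda>\<omega>. f (X \<omega>)) -` A \<inter> space M | A. A \<in> sets S} {(\<lambda>\<omega>. g (Y \<omega>)) -` B \<inter> space M | B. B \<in> sets S'}"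
    using set unfolding indep_set_def
    by (rule indep_sets_mono_sets) (use pull[OF X f] pull[OF Y g] in \<open>simp split: bool.split\<close>)
  then show ?thesis
    unfolding indep_rand_elems_def using measurable_compose[OF X f] measurable_compose[OF Y g] by simp
qed

text \<open>Families of preimages are stable under intersection, so independence extends to the
  \<sigma>-fields they generate.\<close>

lemma (in prob_space) indep_rand_elems_imp_indep_var:
  assumes "indep_rand_elems M N X N' Y"
  shows "indep_var N X N' Y"
proof -
  have stable: "Int_stable {U -` A \<inter> space M | A. A \<in> sets T}" for U :: "'a \<Rightarrow> 'b" and T
  proof (rule Int_stableI)
    fix a b assume "a \<in> {U -` A \<inter> space M | A. A \<in> sets T}" "b \<in> {U -` A \<inter> space M | A. A \<in> sets T}"
    then obtain A B where "A \<in> sets T" "B \<in> sets T" "a = U -` A \<inter> space M" "b = U -` B \<inter> space M" by blast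
    then have "a \<inter> b = U -` (A \<inter> B) \<inter> space M" "A \<inter> B \<in> sets T" by auto
    then show "a \<inter> b \<in> {U -` A \<inter> space M | A. A \<in> sets T}" by blast
  qed
  show ?thesis
    using assms indep_set_sigma_sets[OF _ stable stable] unfolding indep_rand_elems_def indep_var_eq by blast
qed

lemma summable_inverse_squares: "summable (\<lambda>k. c / real (Suc k) ^ 2)"
proof -
  have "summable (\<lambda>k. inverse (real (Suc k) ^ 2))"
    using inverse_power_summable[of 2, where 'a=real] by (subst summable_Suc_iff) simp
  from summable_mult[OF this, of c] show ?thesis by (simp add: divide_inverse)
qed

lemma summable_squares_tendsto_0:
  fixes f :: "nat \<Rightarrow> real"
  assumes "summable (\<lambda>k. (f k)\<^sup>2)"
  shows "f \<longlonglongrightarrow> 0"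
proof -
  have "(\<lambda>k. sqrt ((f k)\<^sup>2)) \<longlonglongrightarrow> sqrt 0" by (intro tendsto_real_sqrt summable_LIMSEQ_zero assms)
  then have "(\<lambda>k. \<bar>f k\<bar>) \<longlonglongrightarrow> 0" by simp
  then show ?thesis by (simp add: tendsto_rabs_zero_iff)
qed

lemma between_squares: "n \<ge> 1 \<Longrightarrow> \<exists>k. (Suc k)\<^sup>2 \<le> n \<and> n \<le> (Suc (Suc k))\<^sup>2" for n :: nat
proof (induction n rule: dec_induct)
  case base
  show ?case by (intro exI[of _ 0]) simp
next
  case (step n)
  then obtain k where k: "(Suc k)\<^sup>2 \<le> n" "n \<le> (Suc (Suc k))\<^sup>2" by blast
  show ?case
  proof (cases "n = (Suc (Suc k))\<^sup>2")
    case True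
    have "Suc ((Suc (Suc k))\<^sup>2) \<le> (Suc (Suc (Suc k)))\<^sup>2" by (simp add: power2_eq_square)
    then show ?thesis using True by (intro exI[of _ "Suc k"]) simp
  next
    case False
    then show ?thesis using k by (intro exI[of _ k]) simp
  qed
qed

section \<open>Comparing random weights with empirical frequencies\<close>

locale weighted_exchangeable_sequence =
  exchangeable_sequence M Z + beta_sticks M V
  for M :: "'w measure" and Z :: "nat \<Rightarrow> 'w \<Rightarrow> 'a::polish_space" and V +
  assumes VZ_indep: "indep_rand_elems M Rinf (\<lambda>\<omega>. \<lambda>n\<in>{1..}. V n \<omega>) S path"
begin

abbreviation sticks :: "'w \<Rightarrow> nat \<Rightarrow> real" where "sticks \<omega> \<equiv> \<lambda>n\<in>{1..}. V n \<omega>"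

text \<open>Sticks and observations live in different spaces, so their independence is used through
  real functionals of the two sequences; boundedness supplies integrability.\<close>

lemma integral_weights_path:
  fixes f :: "(nat \<Rightarrow> real) \<Rightarrow> real" and g :: "(nat \<Rightarrow> 'a) \<Rightarrow> real"
  assumes f: "f \<in> borel_measurable Rinf" "\<And>x. \<bar>f x\<bar> \<le> C"
    and g: "g \<in> borel_measurable S" "\<And>x. \<bar>g x\<bar> \<le> D"
  shows "(\<integral>\<omega>. f (sticks \<omega>) * g (path \<omega>) \<partial>M) = (\<integral>\<omega>. f (sticks \<omega>) \<partial>M) * (\<integral>\<omega>. g (path \<omega>) \<partial>M)"
proof (rule indep_var_lebesgue_integral)
  show iv: "indep_var borel (\<lambda>\<omega>. f (sticks \<omega>)) borel (\<lambda>\<omega>. g (path \<omega>))"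
    by (intro indep_rand_elems_imp_indep_var indep_rand_elems_compose[OF VZ_indep f(1) g(1)])
  show "integrable M (\<lambda>\<omega>. f (sticks \<omega>))"
    using indep_var_rv1[OF iv] f(2) by (intro integrable_const_bound[of _ C]) simp_all
  show "integrable M (\<lambda>\<omega>. g (path \<omega>))"
    using indep_var_rv2[OF iv] g(2) by (intro integrable_const_bound[of _ D]) simp_all
qed

text \<open>An everywhere defined version of the mass that \<open>Q n\<close> gives to B.\<close>

definition wfreq :: "'a set \<Rightarrow> nat \<Rightarrow> 'w \<Rightarrow> real" where
  "wfreq B n \<omega> = (\<Sum>i = 1..n. weight n i \<omega> * hit B i \<omega>)"

lemma measurable_wfreq: "B \<in> sets borel \<Longrightarrow> wfreq B n \<in> borel_measurable M"
  unfolding wfreq_def[abs_def]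
  by (intro borel_measurable_sum borel_measurable_times measurable_weight measurable_indicator_Z) simp_all

lemma wfreq_nonneg: "0 \<le> wfreq B n \<omega>"
  unfolding wfreq_def by (intro sum_nonneg mult_nonneg_nonneg weight_nonneg) simp

lemma wfreq_le_1: "n \<ge> 1 \<Longrightarrow> wfreq B n \<omega> \<le> 1"
proof -
  assume n: "n \<ge> 1"
  have "wfreq B n \<omega> \<le> (\<Sum>i = 1..n. weight n i \<omega>)"
    unfolding wfreq_def using weight_nonneg by (intro sum_mono) (simp add: indicator_def)
  then show ?thesis using sum_weight[OF n] by simp
qed

lemma wfreq_Suc: "wfreq B (Suc n) \<omega> = V (Suc n) \<omega> * hit B (Suc n) \<omega> + (1 - V (Suc n) \<omega>) * wfreq B n \<omega>"
proof -
  have "(\<Sum>i = 1..n. weight (Suc n) i \<omega> * hit B i \<omega>) = (\<Sum>i = 1..n. (1 - V (Suc n) \<omega>) * (weight n i \<omega> * hit B i \<omega>))"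
    by (intro sum.cong refl) (simp add: weight_Suc)
  then have "(\<Sum>i = 1..n. weight (Suc n) i \<omega> * hit B i \<omega>) = (1 - V (Suc n) \<omega>) * wfreq B n \<omega>"
    unfolding wfreq_def sum_distrib_left .
  moreover have "wfreq B (Suc n) \<omega> = weight (Suc n) (Suc n) \<omega> * hit B (Suc n) \<omega> + (\<Sum>i = 1..n. weight (Suc n) i \<omega> * hit B i \<omega>)"
    unfolding wfreq_def by (rule sum.nat_ivl_Suc') simp
  ultimately show ?thesis by (simp only: weight_self)
qed

text \<open>One step of the recursion moves the current value towards a number in
  \<open>[0,1]\<close> by the fraction \<open>V (Suc n)\<close>. The resulting bound does not depend
  on B.\<close>

lemma wfreq_gap:
  assumes "1 \<le> m" "m \<le> n"
  shows "\<bar>wfreq B n \<omega> - wfreq B m \<omega>\<bar> \<le> (\<Sum>j\<in>{m<..n}. V j \<omega>)"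
  using assms(2)
proof (induction n rule: dec_induct)
  case (step n)
  have "\<bar>V (Suc n) \<omega> * (hit B (Suc n) \<omega> - wfreq B n \<omega>)\<bar> \<le> V (Suc n) \<omega> * 1"
    unfolding abs_mult abs_of_nonneg[OF V_nonneg]
    using wfreq_nonneg[of B n \<omega>] wfreq_le_1[of n B \<omega>] assms(1) step.hyps
    by (intro mult_left_mono V_nonneg) (simp add: indicator_def)
  moreover have "wfreq B (Suc n) \<omega> - wfreq B m \<omega> = V (Suc n) \<omega> * (hit B (Suc n) \<omega> - wfreq B n \<omega>) + (wfreq B n \<omega> - wfreq B m \<omega>)"
    by (simp add: wfreq_Suc algebra_simps)
  moreover have "{m<..Suc n} = insert (Suc n) {m<..n}" using step.hyps by auto
  ultimately show ?case using step.IH by simp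
qed simp

text \<open>Both weight vectors have total 1, so the difference is a sum with weights of total 0.
  These are random but independent of \<open>Z\<close>, hence \<open>second_moment_bound\<close>
  applies, and each kind of weight contributes at most twice its sum of squares.\<close>

lemma wfreq_freq_L2:
  assumes B: "B \<in> sets borel" and n: "n \<ge> 1" and m: "m \<ge> 1"
  shows "(\<integral>\<omega>. (wfreq B n \<omega> - freq B m (path \<omega>))\<^sup>2 \<partial>M) \<le> 4 / real (n + 1) + 2 / real m"
proof -
  define I where "I = {1..max n m}"
  \<comment> \<open>\<open>e\<close> is a functional of the whole stick sequence and
    \<open>c\<close> its value at \<omega>: independence from the observations is available at the
    level of sequences.\<close>
  define e where "e i v = (if i \<le> n then stick_weight n i v else 0) - (if i \<le> m then 1 / real m else 0)" for i v
  define c where "c i \<omega> = e i (sticks \<omega>)" for i \<omega>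
  have restr: "(\<Sum>i\<in>I. if i \<le> k then f i else 0) = (\<Sum>i = 1..k. f i)" if "k \<le> max n m" for f :: "nat \<Rightarrow> real" and k
  proof -
    have "I \<inter> {i. i \<le> k} = {1..k}" using that unfolding I_def by auto
    then show ?thesis unfolding I_def by (simp add: sum.If_cases)
  qed
  have c_eq: "c i \<omega> = (if i \<le> n then weight n i \<omega> else 0) - (if i \<le> m then 1 / real m else 0)" if "i \<in> I" for i \<omega>
  proof -
    have "stick_weight n i (sticks \<omega>) = weight n i \<omega>" if "i \<le> n"
      unfolding weight_def using that \<open>i \<in> I\<close> by (intro stick_weight_cong) (auto simp: I_def)
    then show ?thesis unfolding c_def e_def by simp
  qed
  have m01: "0 \<le> 1 / real m" "1 / real m \<le> 1" using m by simp_all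
  have cb: "\<bar>c i \<omega>\<bar> \<le> 1" if "i \<in> I" for i \<omega>
  proof -
    have "\<bar>(if P then a else 0) - (if R then b else 0)\<bar> \<le> 1" if "0 \<le> a" "a \<le> 1" "0 \<le> b" "b \<le> 1" for a b :: real and P R
      using that by (simp add: abs_le_iff)
    then show ?thesis unfolding c_eq[OF that] using weight_nonneg weight_le_1 m01 by blast
  qed
  have em: "e i \<in> borel_measurable Rinf" if "i \<in> I" for i
  proof (cases "i \<le> n")
    case True
    then have "stick_weight n i \<in> borel_measurable Rinf"
      using that by (intro measurable_stick_weight) (auto simp: I_def)
    then show ?thesis unfolding e_def using True by simp
  next
    case False
    then show ?thesis unfolding e_def by simp
  qed
  have cm: "c i \<in> borel_measurable M" if "i \<in> I" for i
  proof -
    have "sticks \<in> measurable M Rinf"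
      using measurable_V by (intro measurable_restrict) simp
    from measurable_compose[OF this em[OF that]] show ?thesis unfolding c_def .
  qed
  have eq: "wfreq B n \<omega> - freq B m (path \<omega>) = (\<Sum>i\<in>I. c i \<omega> * hit B i \<omega>)" for \<omega>
  proof -
    have "(\<Sum>i\<in>I. c i \<omega> * hit B i \<omega>) = (\<Sum>i\<in>I. (if i \<le> n then weight n i \<omega> * hit B i \<omega> else 0) -
      (if i \<le> m then 1 / real m * hit B i \<omega> else 0))"
      by (intro sum.cong refl) (simp add: c_eq left_diff_distrib)
    then show ?thesis unfolding sum_subtractf wfreq_def freq_path by (simp add: restr)
  qed
  have "(\<integral>\<omega>. (wfreq B n \<omega> - freq B m (path \<omega>))\<^sup>2 \<partial>M) \<le> (\<Sum>i\<in>I. \<integral>\<omega>. (c i \<omega>)\<^sup>2 \<partial>M)"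
    unfolding eq
  proof (rule second_moment_bound[OF B _ _ cm cb])
    show "(\<Sum>i\<in>I. c i \<omega>) = 0" for \<omega>
    proof -
      have "(\<Sum>i\<in>I. c i \<omega>) = (\<Sum>i\<in>I. (if i \<le> n then weight n i \<omega> else 0) - (if i \<le> m then 1 / real m else 0))"
        by (intro sum.cong refl c_eq)
      also have "\<dots> = (\<Sum>i = 1..n. weight n i \<omega>) - (\<Sum>i = 1..m. 1 / real m)"
        unfolding sum_subtractf by (simp add: restr)
      also have "\<dots> = 0" unfolding sum_weight[OF n] using m by simp
      finally show ?thesis .
    qed
    fix i j assume ij: "i \<in> I" "j \<in> I"
    \<comment> \<open>\<open>integral_weights_path\<close> asks for bounded functionals, but the
      product of \<open>e i\<close> and \<open>e j\<close> is bounded only at stick sequences with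
      values in \<open>[0,1]\<close>; the cut-off does not change it there.\<close>
    let ?e = "\<lambda>x. if \<bar>e i x * e j x\<bar> \<le> 1 then e i x * e j x else 0"
    have ec: "?e (sticks \<omega>) = c i \<omega> * c j \<omega>" for \<omega>
      using cb[OF ij(1), of \<omega>] cb[OF ij(2), of \<omega>] unfolding c_def by (simp add: abs_mult mult_le_one)
    have gp: "indicator B (path \<omega> i) * indicator B (path \<omega> j) = (hit B i \<omega> * hit B j \<omega> :: real)" for \<omega>
      using ij by (simp add: path_eq I_def)
    have "?e \<in> borel_measurable Rinf"
      using em[OF ij(1)] em[OF ij(2)] by measurable
    moreover have "(\<lambda>z. indicator B (z i) * indicator B (z j) :: real) \<in> borel_measurable S"
      using ij by (intro borel_measurable_times measurable_indicator_component[OF B]) (simp_all add: I_def)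
    ultimately show "(\<integral>\<omega>. c i \<omega> * c j \<omega> * (hit B i \<omega> * hit B j \<omega>) \<partial>M) =
      (\<integral>\<omega>. c i \<omega> * c j \<omega> \<partial>M) * (\<integral>\<omega>. hit B i \<omega> * hit B j \<omega> \<partial>M)"
      using integral_weights_path[of ?e 1 "\<lambda>z. indicator B (z i) * indicator B (z j)" 1]
      unfolding ec gp by (simp add: indicator_def)
  qed (auto simp: I_def)
  also have "\<dots> \<le> (\<Sum>i\<in>I. (if i \<le> n then 2 * (\<integral>\<omega>. (weight n i \<omega>)\<^sup>2 \<partial>M) else 0) + (if i \<le> m then 2 * (1 / real m)\<^sup>2 else 0))"
  proof (rule sum_mono)
    fix i assume i: "i \<in> I"
    define b where "b = (if i \<le> m then 1 / real m else 0)"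
    have sq: "(a - b)\<^sup>2 \<le> 2 * a\<^sup>2 + 2 * b\<^sup>2" for a :: real using sum_squares_bound[of a "- b"] by (simp add: power2_diff)
    have cc: "integrable M (\<lambda>\<omega>. (c i \<omega>)\<^sup>2)"
      using cm[OF i] cb[OF i] by (intro integrable_const_bound[of _ 1]) (simp_all add: abs_square_le_1)
    show "(\<integral>\<omega>. (c i \<omega>)\<^sup>2 \<partial>M) \<le> (if i \<le> n then 2 * (\<integral>\<omega>. (weight n i \<omega>)\<^sup>2 \<partial>M) else 0) + (if i \<le> m then 2 * (1 / real m)\<^sup>2 else 0)"
    proof (cases "i \<le> n")
      case True
      have iw: "integrable M (\<lambda>\<omega>. (weight n i \<omega>)\<^sup>2)"
        using measurable_weight[of i n] i True weight_nonneg[of n i] weight_le_1[of n i]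
        by (intro integrable_const_bound[of _ 1]) (simp_all add: power_le_one I_def)
      have "(\<integral>\<omega>. (c i \<omega>)\<^sup>2 \<partial>M) \<le> (\<integral>\<omega>. 2 * (weight n i \<omega>)\<^sup>2 + 2 * b\<^sup>2 \<partial>M)"
        using cc iw sq True by (intro integral_mono) (simp_all add: c_eq[OF i] b_def[symmetric])
      also have "\<dots> = 2 * (\<integral>\<omega>. (weight n i \<omega>)\<^sup>2 \<partial>M) + 2 * b\<^sup>2" using iw by (simp add: prob_space)
      finally show ?thesis using True unfolding b_def by (cases "i \<le> m") simp_all
    next
      case False
      then show ?thesis by (cases "i \<le> m") (simp_all add: c_eq[OF i] prob_space)
    qed
  qed
  also have "\<dots> = 2 * (\<Sum>i = 1..n. \<integral>\<omega>. (weight n i \<omega>)\<^sup>2 \<partial>M) + (\<Sum>i = 1..m. 2 * (1 / real m)\<^sup>2)"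
    unfolding sum.distrib by (simp add: restr sum_distrib_left)
  also have "\<dots> = 4 / real (n + 1) + 2 / real m"
    unfolding sum_second_moment_weight[OF n] using m by (simp add: power2_eq_square)
  finally show ?thesis .
qed

text \<open>The comparison with frequencies over \<open>4 ^ k\<close> terms is taken to the limit in
  k: the second error term disappears, and dominated convergence turns the frequency into
  \<open>mass B\<close>.\<close>

lemma wfreq_limfreq_L2:
  assumes B: "B \<in> sets borel" and n: "n \<ge> 1"
  shows "(\<integral>\<omega>. (wfreq B n \<omega> - mass B \<omega>)\<^sup>2 \<partial>M) \<le> 4 / real (n + 1)"
proof (rule LIMSEQ_le)
  have bound: "\<bar>(wfreq B n \<omega> - a)\<^sup>2\<bar> \<le> 1" if "0 \<le> a" "a \<le> 1" for \<omega> a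
  proof -
    have "\<bar>wfreq B n \<omega> - a\<bar> \<le> 1"
      using wfreq_nonneg[of B n \<omega>] wfreq_le_1[OF n, of B \<omega>] that by (simp add: abs_le_iff)
    then show ?thesis by (simp add: abs_square_le_1)
  qed
  show "(\<lambda>k. \<integral>\<omega>. (wfreq B n \<omega> - freq B (4 ^ k) (path \<omega>))\<^sup>2 \<partial>M) \<longlonglongrightarrow> (\<integral>\<omega>. (wfreq B n \<omega> - mass B \<omega>)\<^sup>2 \<partial>M)"
  proof (rule integral_dominated_convergence[where w="\<lambda>_. 1"])
    show "AE \<omega> in M. (\<lambda>k. (wfreq B n \<omega> - freq B (4 ^ k) (path \<omega>))\<^sup>2) \<longlonglongrightarrow> (wfreq B n \<omega> - mass B \<omega>)\<^sup>2"
      using freq_convergent[OF B] by eventually_elim (intro tendsto_power tendsto_diff tendsto_const)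
    show "AE \<omega> in M. norm ((wfreq B n \<omega> - freq B (4 ^ k) (path \<omega>))\<^sup>2) \<le> 1" for k
      unfolding real_norm_def by (intro AE_I2 bound freq_nonneg freq_le_1)
  qed (use measurable_wfreq[OF B] measurable_freq_path[OF B] measurable_limfreq_path[OF B] in simp_all)
  show "(\<lambda>k. 4 / real (n + 1) + 2 / real (4 ^ k)) \<longlonglongrightarrow> 4 / real (n + 1)"
  proof -
    have "(\<lambda>k. 4 / real (n + 1) + 2 * (1 / 4) ^ k) \<longlonglongrightarrow> 4 / real (n + 1) + 2 * 0"
      by (intro tendsto_add tendsto_mult tendsto_const LIMSEQ_power_zero) simp
    then show ?thesis by (simp add: power_one_over)
  qed
  show "\<exists>N. \<forall>k\<ge>N. (\<integral>\<omega>. (wfreq B n \<omega> - freq B (4 ^ k) (path \<omega>))\<^sup>2 \<partial>M) \<le> 4 / real (n + 1) + 2 / real (4 ^ k)"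
    by (intro exI[of _ 0] allI impI wfreq_freq_L2[OF B n]) simp
qed

section \<open>From second moments to almost sure convergence\<close>

lemma AE_square_subsequence:
  assumes B: "B \<in> sets borel"
  shows "AE \<omega> in M. (\<lambda>k. wfreq B ((Suc k)\<^sup>2) \<omega> - mass B \<omega>) \<longlonglongrightarrow> 0"
proof -
  have "AE \<omega> in M. summable (\<lambda>k. (wfreq B ((Suc k)\<^sup>2) \<omega> - mass B \<omega>)\<^sup>2)"
  proof (rule AE_summable[OF _ _ _ summable_inverse_squares[of 4]])
    fix k :: nat
    have k1: "(Suc k)\<^sup>2 \<ge> 1" by simp
    have "\<bar>wfreq B ((Suc k)\<^sup>2) \<omega> - mass B \<omega>\<bar> \<le> 1" for \<omega>
      using wfreq_nonneg[of B "(Suc k)\<^sup>2" \<omega>] wfreq_le_1[OF k1, of B \<omega>] limfreq_nonneg[of B "path \<omega>"] limfreq_le_1[of B "path \<omega>"]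
      by (simp add: abs_le_iff)
    then show "integrable M (\<lambda>\<omega>. (wfreq B ((Suc k)\<^sup>2) \<omega> - mass B \<omega>)\<^sup>2)"
      using measurable_wfreq[OF B] measurable_limfreq_path[OF B]
      by (intro integrable_const_bound[of _ 1]) (simp_all add: abs_square_le_1)
    have "(\<integral>\<omega>. (wfreq B ((Suc k)\<^sup>2) \<omega> - mass B \<omega>)\<^sup>2 \<partial>M) \<le> 4 / real ((Suc k)\<^sup>2 + 1)"
      by (rule wfreq_limfreq_L2[OF B k1])
    also have "\<dots> \<le> 4 / real (Suc k) ^ 2"
      by (intro divide_left_mono) (simp_all del: of_nat_Suc add: of_nat_power)
    finally show "(\<integral>\<omega>. (wfreq B ((Suc k)\<^sup>2) \<omega> - mass B \<omega>)\<^sup>2 \<partial>M) \<le> 4 / real (Suc k) ^ 2" .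
  qed simp
  then show ?thesis by eventually_elim (rule summable_squares_tendsto_0)
qed

abbreviation gap :: "nat \<Rightarrow> 'w \<Rightarrow> real" where
  "gap k \<omega> \<equiv> \<Sum>j\<in>{(Suc k)\<^sup>2<..(Suc (Suc k))\<^sup>2}. V j \<omega>"

text \<open>With \<open>r = k + 1\<close> the block has \<open>2 * k + 3\<close>, hence at most
  \<open>3 * r\<close>, sticks, each of second moment at most \<open>2 / r ^ 4\<close>.
  Cauchy-Schwarz bounds the mean of the squared sum by \<open>9 * r ^ 2 * 2 / r ^ 4\<close>, whence
  the 18. The first moments are of order \<open>1 / k\<close> and would not be summable.\<close>

lemma AE_gaps: "AE \<omega> in M. (\<lambda>k. gap k \<omega>) \<longlonglongrightarrow> 0"
proof -
  have "AE \<omega> in M. summable (\<lambda>k. (gap k \<omega>)\<^sup>2)"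
  proof (rule AE_summable[OF _ _ _ summable_inverse_squares[of 18]])
    fix k :: nat
    define J where "J = {(Suc k)\<^sup>2<..(Suc (Suc k))\<^sup>2}"
    define r where "r = real (Suc k)"
    have r: "r \<ge> 1" unfolding r_def by simp
    have cardJ: "real (card J) \<le> 3 * r"
      unfolding J_def r_def by (simp add: power2_eq_square)
    have J1: "j \<ge> 1" if "j \<in> J" for j using that unfolding J_def by simp
    have Vi: "integrable M (\<lambda>\<omega>. (V j \<omega>)\<^sup>2)" if "j \<in> J" for j
      using measurable_V[OF J1[OF that]] V_nonneg[of j] V_le_1[of j]
      by (intro integrable_const_bound[of _ 1]) (simp_all add: power_le_one)
    have Sm: "(\<lambda>\<omega>. \<Sum>j\<in>J. V j \<omega>) \<in> borel_measurable M"
      using measurable_V J1 by (intro borel_measurable_sum) simp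
    have CS: "(\<Sum>j\<in>J. V j \<omega>)\<^sup>2 \<le> real (card J) * (\<Sum>j\<in>J. (V j \<omega>)\<^sup>2)" for \<omega>
      using Cauchy_Schwarz_ineq_sum[of "\<lambda>_. 1" "\<lambda>j. V j \<omega>" J] by simp
    have Ri: "integrable M (\<lambda>\<omega>. real (card J) * (\<Sum>j\<in>J. (V j \<omega>)\<^sup>2))"
      using Vi by (intro Bochner_Integration.integrable_mult_right Bochner_Integration.integrable_sum)
    show Li: "integrable M (\<lambda>\<omega>. (gap k \<omega>)\<^sup>2)"
      unfolding J_def[symmetric]
      by (rule Bochner_Integration.integrable_bound[OF Ri]) (use Sm CS in \<open>simp_all add: order_trans[OF CS abs_ge_self]\<close>)
    have "(\<integral>\<omega>. (\<Sum>j\<in>J. V j \<omega>)\<^sup>2 \<partial>M) \<le> (\<integral>\<omega>. real (card J) * (\<Sum>j\<in>J. (V j \<omega>)\<^sup>2) \<partial>M)"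
      by (intro integral_mono Ri CS Li[folded J_def])
    also have "\<dots> = real (card J) * (\<Sum>j\<in>J. \<integral>\<omega>. (V j \<omega>)\<^sup>2 \<partial>M)"
      using Vi by (simp add: Bochner_Integration.integral_sum)
    also have "\<dots> \<le> real (card J) * (\<Sum>j\<in>J. 2 / r ^ 4)"
    proof (intro mult_left_mono sum_mono)
      fix j assume j: "j \<in> J"
      then obtain n where n: "j = Suc n" "n \<ge> (Suc k)\<^sup>2" unfolding J_def by (cases j) simp_all
      have n1: "n \<ge> 1" using n(2) by (simp add: power2_eq_square)
      have rn: "r\<^sup>2 \<le> real n" using n(2) unfolding r_def by (metis of_nat_le_iff of_nat_power)
      have "r ^ 4 = r\<^sup>2 * r\<^sup>2" by (simp add: power2_eq_square power4_eq_xxxx)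
      also have "\<dots> \<le> real (n + 1) * real (n + 2)" using rn by (intro mult_mono) simp_all
      finally have "2 / (real (n + 1) * real (n + 2)) \<le> 2 / r ^ 4"
        using r by (intro divide_left_mono mult_pos_pos) simp_all
      then show "(\<integral>\<omega>. (V j \<omega>)\<^sup>2 \<partial>M) \<le> 2 / r ^ 4" unfolding n(1) second_moment_V[OF n1] .
    qed simp
    also have "\<dots> = real (card J) * real (card J) * (2 / r ^ 4)" by simp
    also have "\<dots> \<le> (3 * r) * (3 * r) * (2 / r ^ 4)"
      using r by (intro mult_right_mono mult_mono cardJ) simp_all
    also have "\<dots> = 18 / r ^ 2" using r by (simp add: power2_eq_square power4_eq_xxxx)
    finally show "(\<integral>\<omega>. (gap k \<omega>)\<^sup>2 \<partial>M) \<le> 18 / real (Suc k) ^ 2"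
      unfolding J_def r_def .
  qed simp
  then show ?thesis by eventually_elim (rule summable_squares_tendsto_0)
qed

theorem wfreq_convergent:
  assumes B: "B \<in> sets borel"
  shows "AE \<omega> in M. (\<lambda>n. wfreq B n \<omega>) \<longlonglongrightarrow> mass B \<omega>"
  using AE_square_subsequence[OF B] AE_gaps
proof eventually_elim
  case (elim \<omega>)
  show ?case
  proof (rule LIMSEQ_I)
    fix r :: real assume "r > 0"
    then have "r / 2 > 0" by simp
    from LIMSEQ_D[OF elim(1) this] LIMSEQ_D[OF elim(2) this]
    obtain K1 K2 where K: "\<And>k. k \<ge> K1 \<Longrightarrow> norm (wfreq B ((Suc k)\<^sup>2) \<omega> - mass B \<omega> - 0) < r / 2"
      "\<And>k. k \<ge> K2 \<Longrightarrow> norm ((gap k \<omega>) - 0) < r / 2" by blast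
    show "\<exists>no. \<forall>n\<ge>no. norm (wfreq B n \<omega> - mass B \<omega>) < r"
    \<comment> \<open>The outer \<open>Suc\<close> makes n strictly larger than the square. Blocks
      between squares share endpoints, and equality would admit the block ending at
      \<open>(K1 + K2 + 1)^2\<close>, whose index is too small.\<close>
    proof (intro exI[of _ "Suc ((Suc (K1 + K2))\<^sup>2)"] allI impI)
      fix n assume n: "n \<ge> Suc ((Suc (K1 + K2))\<^sup>2)"
      then obtain k where k: "(Suc k)\<^sup>2 \<le> n" "n \<le> (Suc (Suc k))\<^sup>2" using between_squares[of n] by auto
      have "K1 + K2 \<le> k"
      proof (rule ccontr)
        assume "\<not> K1 + K2 \<le> k"
        then have "(Suc (Suc k))\<^sup>2 \<le> (Suc (K1 + K2))\<^sup>2" by (intro power_mono) simp_all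
        with k n show False by simp
      qed
      then have kK: "k \<ge> K1" "k \<ge> K2" by simp_all
      have "\<bar>wfreq B n \<omega> - wfreq B ((Suc k)\<^sup>2) \<omega>\<bar> \<le> (\<Sum>j\<in>{(Suc k)\<^sup>2<..n}. V j \<omega>)"
        using k(1) by (intro wfreq_gap) simp_all
      also have "\<dots> \<le> (gap k \<omega>)"
        using k(2) V_nonneg by (intro sum_mono2) auto
      also have "\<dots> < r / 2" using K(2)[OF kK(2)] by simp
      finally have "\<bar>wfreq B n \<omega> - wfreq B ((Suc k)\<^sup>2) \<omega>\<bar> < r / 2" .
      moreover have "\<bar>wfreq B ((Suc k)\<^sup>2) \<omega> - mass B \<omega>\<bar> < r / 2" using K(1)[OF kK(1)] by simp
      ultimately show "norm (wfreq B n \<omega> - mass B \<omega>) < r" unfolding real_norm_def by linarith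
    qed
  qed
qed
end

section \<open>Representation and almost sure limit of the measure-valued chain\<close>

theorem theorem1:
  fixes M :: "'w measure"
    and W :: "nat \<Rightarrow> 'w \<Rightarrow> real"
    and Z :: "nat \<Rightarrow> 'w \<Rightarrow> 'a::polish_space"
    and Q :: "nat \<Rightarrow> 'w \<Rightarrow> 'a measure"
  assumes M: "prob_space M"
    and W_indep: "prob_space.indep_vars M (\<lambda>_. borel) W {1..}"
    and W_1: "AE \<omega> in M. W 1 \<omega> = 1"
    and W_beta: "\<And>n. n \<ge> 2 \<Longrightarrow>
      distributed M lborel (W n) (\<lambda>x. ennreal (beta_density 1 (real n - 1) x))"
    and Z_exch: "exchangeable M Z"
    and WZ_indep: "indep_rand_elems M
      (\<Pi>\<^sub>M n\<in>{1..}. borel) (\<lambda>\<omega>. \<lambda>n\<in>{1..}. W n \<omega>)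
      (\<Pi>\<^sub>M n\<in>{1..}. borel) (\<lambda>\<omega>. \<lambda>n\<in>{1..}. Z n \<omega>)"
    and Q_random: "\<And>n. Q n \<in> measurable M prob_measures"
    and Q_rec: "\<And>n. n \<ge> 1 \<Longrightarrow> AE \<omega> in M. \<forall>B\<in>sets borel.
      measure (Q n \<omega>) B =
        W n \<omega> * measure (return borel (Z n \<omega>)) B + (1 - W n \<omega>) * measure (Q (n - 1) \<omega>) B"
  shows
    "(\<exists>q :: nat \<Rightarrow> nat \<Rightarrow> 'w \<Rightarrow> real.
        (\<forall>n\<ge>1. AE \<omega> in M. \<forall>B\<in>sets borel.
           measure (Q n \<omega>) B = (\<Sum>i = 1..n. q n i \<omega> * measure (return borel (Z i \<omega>)) B)) \<and>
        (\<forall>n\<ge>1. \<forall>\<omega>\<in>space M. (\<Sum>i = 1..n. q n i \<omega>) = 1) \<and>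
        (\<forall>n\<ge>1. distr M (\<Pi>\<^sub>M i\<in>{1..n}. borel) (\<lambda>\<omega>. \<lambda>i\<in>{1..n}. q n i \<omega>) = dirichlet n (\<lambda>_. 1)) \<and>
        indep_rand_elems M
          (\<Pi>\<^sub>M n\<in>{1..}. \<Pi>\<^sub>M i\<in>{1..n}. borel) (\<lambda>\<omega>. \<lambda>n\<in>{1..}. \<lambda>i\<in>{1..n}. q n i \<omega>)
          (\<Pi>\<^sub>M n\<in>{1..}. borel) (\<lambda>\<omega>. \<lambda>n\<in>{1..}. Z n \<omega>)) \<and>
     (\<exists>Q_lim :: 'w \<Rightarrow> 'a measure.
        Q_lim \<in> measurable M prob_measures \<and>
        (\<exists>A\<in>sets M. measure M A = 1 \<and>
           (\<forall>\<omega>\<in>A. weakly_converges (\<lambda>n. Q n \<omega>) (Q_lim \<omega>))) \<and>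
        is_de_Finetti_measure M Z (distr M prob_measures Q_lim))"
proof -
  interpret exchangeable_sequence M Z
    using M Z_exch by (simp add: exchangeable_sequence_def exchangeable_sequence_axioms_def)
  have W_meas: "W n \<in> borel_measurable M" if "n \<ge> 1" for n
    using W_indep that unfolding indep_vars_def by simp
  \<comment> \<open>\<open>W\<close> lies in \<open>[0,1]\<close> and \<open>W 1\<close> equals 1
    only almost surely, whereas the weights must add up to 1 at every point. Clamping changes
    \<open>W\<close> on null sets only, since the Beta density vanishes outside
    \<open>(0,1)\<close>; it acts on each coordinate separately and so preserves both kinds of
    independence.\<close>
  define clamp :: "nat \<Rightarrow> real \<Rightarrow> real" where "clamp n x = (if n = 1 then 1 else max 0 (min 1 x))" for n x
  have clamp_meas: "clamp n \<in> borel_measurable borel" for n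
    unfolding clamp_def by (cases "n = 1") simp_all
  define V where "V n \<omega> = clamp n (W n \<omega>)" for n \<omega>
  have V_W: "AE \<omega> in M. V n \<omega> = W n \<omega>" if "n \<ge> 1" for n
  proof (cases "n = 1")
    case True
    then show ?thesis using W_1 by (simp add: V_def clamp_def)
  next
    case False
    then have n: "n \<ge> 2" using that by simp
    have "AE x in distr M lborel (W n). clamp n x = x"
      unfolding distributed_distr_eq_density[OF W_beta[OF n]]
      using distributed_borel_measurable[OF W_beta[OF n]] False
      by (subst AE_density) (auto simp: beta_density_def clamp_def)
    then show ?thesis unfolding V_def by (rule AE_distrD[OF distributed_measurable[OF W_beta[OF n]]])
  qed
  interpret weighted_exchangeable_sequence M Z V
  proof
    show "indep_vars (\<lambda>_. borel) V {1..}"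
      using indep_vars_compose2[OF W_indep, of clamp "\<lambda>_. borel"] clamp_meas unfolding V_def[abs_def] by simp
    show "0 \<le> V n \<omega>" "V n \<omega> \<le> 1" for n \<omega> unfolding V_def clamp_def by simp_all
    show "V 1 \<omega> = 1" for \<omega> unfolding V_def clamp_def by simp
    show "distributed M lborel (V (Suc n)) (\<lambda>x. ennreal (beta_density 1 (real n) x))" if "n \<ge> 1" for n
    proof -
      have W: "distributed M lborel (W (Suc n)) (\<lambda>x. ennreal (beta_density 1 (real n) x))"
        using W_beta[of "Suc n"] that by simp
      have Vm: "V (Suc n) \<in> borel_measurable M"
        unfolding V_def[abs_def] by (rule measurable_compose[OF W_meas clamp_meas]) simp
      have "distr M lborel (V (Suc n)) = distr M lborel (W (Suc n))"
        using V_W[of "Suc n"] Vm W_meas[of "Suc n"] by (intro distr_cong_AE) simp_all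
      then show ?thesis using W Vm unfolding distributed_def by simp
    qed
    have "(\<lambda>w. \<lambda>n\<in>{1..}. clamp n (w n)) \<in> measurable (\<Pi>\<^sub>M n\<in>{1..}. borel) (\<Pi>\<^sub>M n\<in>{1..}. borel)"
    proof (rule measurable_restrict)
      fix n :: nat assume "n \<in> {1..}"
      then have "(\<lambda>w. w n) \<in> borel_measurable (\<Pi>\<^sub>M n\<in>{1..}. borel :: real measure)"
        by (rule measurable_component_singleton)
      from measurable_compose[OF this clamp_meas]
      show "(\<lambda>w. clamp n (w n)) \<in> borel_measurable (\<Pi>\<^sub>M n\<in>{1..}. borel)" .
    qed
    from indep_rand_elems_compose[OF WZ_indep this measurable_ident]
    have "indep_rand_elems M (\<Pi>\<^sub>M n\<in>{1..}. borel) (\<lambda>\<omega>. \<lambda>n\<in>{1..}. clamp n ((\<lambda>n\<in>{1..}. W n \<omega>) n)) S (\<lambda>\<omega>. id (\<lambda>n\<in>{1..}. Z n \<omega>))" .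
    moreover have "(\<lambda>n\<in>{1..}. clamp n ((\<lambda>n\<in>{1..}. W n \<omega>) n)) = (\<lambda>n\<in>{1..}. V n \<omega>)" for \<omega>
      by (rule restrict_ext) (simp add: V_def)
    ultimately show "indep_rand_elems M (\<Pi>\<^sub>M n\<in>{1..}. borel) (\<lambda>\<omega>. \<lambda>n\<in>{1..}. V n \<omega>) S path"
      unfolding path_def[abs_def] by simp
  qed
  have Q_wfreq: "AE \<omega> in M. \<forall>B\<in>sets borel. measure (Q n \<omega>) B = wfreq B n \<omega>" if "n \<ge> 1" for n
    using that
  proof (induction n rule: dec_induct)
    \<comment> \<open>The coefficient \<open>1 - W 1\<close> of \<open>Q 0\<close> is 0 almost
      surely, which starts the induction.\<close>
    case base
    from Q_rec[of 1] W_1 show ?case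
      by (auto simp: wfreq_def weight_self V_1[unfolded One_nat_def] measure_return elim!: eventually_elim2)
  next
    case (step n)
    have "AE \<omega> in M. \<forall>B\<in>sets borel. measure (Q (Suc n) \<omega>) B =
      W (Suc n) \<omega> * measure (return borel (Z (Suc n) \<omega>)) B + (1 - W (Suc n) \<omega>) * measure (Q n \<omega>) B"
      using Q_rec[of "Suc n"] by simp
    moreover have "AE \<omega> in M. V (Suc n) \<omega> = W (Suc n) \<omega>" by (rule V_W) simp
    ultimately show ?case using step.IH
      by eventually_elim (simp add: wfreq_Suc measure_return)
  qed
  have "AE \<omega> in M. \<forall>B\<in>sets borel. measure (Q n \<omega>) B = (\<Sum>i = 1..n. weight n i \<omega> * measure (return borel (Z i \<omega>)) B)"
    if "n \<ge> 1" for n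
    using Q_wfreq[OF that] by eventually_elim (simp add: wfreq_def measure_return)
  moreover have "distr M (\<Pi>\<^sub>M i\<in>{1..n}. borel) (\<lambda>\<omega>. \<lambda>i\<in>{1..n}. weight n i \<omega>) = dirichlet n (\<lambda>_. 1)" if "n \<ge> 1" for n
    using distr_weights[OF that] unfolding weights_def[abs_def] .
  moreover have "indep_rand_elems M
    (\<Pi>\<^sub>M n\<in>{1..}. \<Pi>\<^sub>M i\<in>{1..n}. borel) (\<lambda>\<omega>. \<lambda>n\<in>{1..}. \<lambda>i\<in>{1..n}. weight n i \<omega>)
    (\<Pi>\<^sub>M n\<in>{1..}. borel) (\<lambda>\<omega>. \<lambda>n\<in>{1..}. Z n \<omega>)"
  proof -
    have "(\<lambda>v. \<lambda>n\<in>{1..}. \<lambda>i\<in>{1..n}. stick_weight n i v) \<in>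
      measurable (\<Pi>\<^sub>M n\<in>{1..}. borel) (\<Pi>\<^sub>M n\<in>{1..}. \<Pi>\<^sub>M i\<in>{1..n}. borel)"
      by (intro measurable_restrict measurable_stick_weight) auto
    from indep_rand_elems_compose[OF VZ_indep this measurable_ident]
    have "indep_rand_elems M (\<Pi>\<^sub>M n\<in>{1..}. \<Pi>\<^sub>M i\<in>{1..n}. borel)
      (\<lambda>\<omega>. \<lambda>n\<in>{1..}. \<lambda>i\<in>{1..n}. stick_weight n i (\<lambda>n\<in>{1..}. V n \<omega>)) S (\<lambda>\<omega>. id (path \<omega>))" .
    moreover have "(\<lambda>n\<in>{1..}. \<lambda>i\<in>{1..n}. stick_weight n i (\<lambda>n\<in>{1..}. V n \<omega>)) = (\<lambda>n\<in>{1..}. \<lambda>i\<in>{1..n}. weight n i \<omega>)" for \<omega>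
      unfolding weight_def by (intro restrict_ext stick_weight_cong) auto
    ultimately show ?thesis unfolding path_def[abs_def] by simp
  qed
  moreover have "\<exists>Q_lim :: 'w \<Rightarrow> 'a measure.
        Q_lim \<in> measurable M prob_measures \<and>
        (\<exists>A\<in>sets M. measure M A = 1 \<and>
           (\<forall>\<omega>\<in>A. weakly_converges (\<lambda>n. Q n \<omega>) (Q_lim \<omega>))) \<and>
        is_de_Finetti_measure M Z (distr M prob_measures Q_lim)"
  proof -
    obtain P where P: "P \<in> measurable M (prob_algebra borel)" "cond_iid M Z P"
      and P_lim: "\<forall>B\<in>sets borel. AE \<omega> in M. measure (P \<omega>) B = mass B \<omega>"
      by (rule de_Finetti)
    \<comment> \<open>\<open>Q_wfreq\<close> has one null set for all Borel sets, but the limit of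
      \<open>wfreq\<close> and the value of \<open>P\<close> have null sets depending on the set;
      the countable \<open>base_unions\<close> gathers them into one.\<close>
    have "AE \<omega> in M. \<forall>U\<in>base_unions. (\<lambda>n. measure (Q n \<omega>) U) \<longlonglongrightarrow> measure (P \<omega>) U"
      unfolding AE_ball_countable[OF countable_base_unions]
    proof
      fix U :: "'a set" assume "U \<in> base_unions"
      then have U: "U \<in> sets borel" by (intro borel_open open_base_unions)
      have "AE \<omega> in M. \<forall>n. n \<ge> 1 \<longrightarrow> (\<forall>B\<in>sets borel. measure (Q n \<omega>) B = wfreq B n \<omega>)"
        unfolding AE_all_countable using Q_wfreq by (intro allI AE_impI)
      then show "AE \<omega> in M. (\<lambda>n. measure (Q n \<omega>) U) \<longlonglongrightarrow> measure (P \<omega>) U"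
        using bspec[OF P_lim U] wfreq_convergent[OF U]
      proof eventually_elim
        case (elim \<omega>)
        have "\<forall>\<^sub>F n in sequentially. measure (Q n \<omega>) U = wfreq U n \<omega>"
          using elim(1) U by (intro eventually_sequentiallyI[of 1]) blast
        from tendsto_cong[OF this] elim(2,3) show ?case by simp
      qed
    qed
    moreover have "weakly_converges (\<lambda>n. Q n \<omega>) (P \<omega>)"
      if "\<omega> \<in> space M" "\<forall>U\<in>base_unions. (\<lambda>n. measure (Q n \<omega>) U) \<longlonglongrightarrow> measure (P \<omega>) U" for \<omega>
      using that measurable_space[OF Q_random that(1)] measurable_space[OF P(1) that(1)]
      by (intro weakly_converges_base_unions) (simp_all add: space_prob_measures)
    ultimately have "AE \<omega> in M. weakly_converges (\<lambda>n. Q n \<omega>) (P \<omega>)"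
      using AE_space by (auto elim: eventually_elim2)
    then obtain N where N: "{\<omega> \<in> space M. \<not> weakly_converges (\<lambda>n. Q n \<omega>) (P \<omega>)} \<subseteq> N" "emeasure M N = 0" "N \<in> sets M"
      by (rule AE_E)
    have "measure M (space M - N) = 1"
      using prob_compl[OF N(3)] N(2) by (simp add: Sigma_Algebra.measure_def)
    moreover have "\<forall>\<omega>\<in>space M - N. weakly_converges (\<lambda>n. Q n \<omega>) (P \<omega>)" using N(1) by blast
    ultimately have "\<exists>A\<in>sets M. measure M A = 1 \<and> (\<forall>\<omega>\<in>A. weakly_converges (\<lambda>n. Q n \<omega>) (P \<omega>))"
      using N(3) by (intro bexI[of _ "space M - N"] conjI) auto
    moreover have "P \<in> measurable M prob_measures" using P(2) unfolding cond_iid_def by blast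
    moreover have "is_de_Finetti_measure M Z (distr M prob_measures P)"
      unfolding is_de_Finetti_measure_def using P(2) by blast
    ultimately show ?thesis by blast
  qed
  ultimately show ?thesis using sum_weight by (intro conjI exI[of _ weight]) simp_all
qed

end
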